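(* The variety of complex $3$-dimensional binary associative superalgebras of type $(2,1)$ has dimension $5$ and has exactly $13$ irreducible components, namely $\overline{\mathcal{O}(\mathbf{R}_{k})}$ for $k\in\{01,03,04,05,07,23,25,28,30,31,32,33,36\}$. In particular, exactly $13$ superalgebras are rigid in this variety.
   Context: All algebras are over $\mathbb{C}$. A superalgebra is a $\mathbb{Z}_2$-graded algebra $A=A_0\oplus A_1$ with $A_iA_j\subseteq A_{i+j \bmod 2}$; $|x|\in\{0,1\}$ is the degree of a homogeneous $x$. It has type $(n,m)$ if $\dim A_0=n$, $\dim A_1=m$. The associator is $(x,y,z)=(xy)z-x(yz)$. A binary associative superalgebra is a superalgebra satisfying $(x,y,z)=-(-1)^{|y||z|}(x,z,y)=-(-1)^{|x||y|}(y,x,z)$ for all homogeneous $x,y,z$. Geometric setting: fix a graded space $V=V_0\oplus V_1$ of type $(n,m)$ with a homogeneous basis. Superalgebra structures on $V$ are even bilinear maps $\mu:V\times V\to V$, identified with their structure constants; those satisfying a given family of graded polynomial identities form a Zariski-closed subset (an affine variety) of this affine space. The group $GL(V_0)\times GL(V_1)$ acts by $(g*\mu)(x,y)=g\mu(g^{-1}x,g^{-1}y)$; its orbits are the isomorphism classes. $\mathcal{O}(A)$ denotes the orbit of (a structure representing) $A$ and $\overline{\mathcal{O}(A)}$ its Zariski closure. A superalgebra is rigid if its orbit is open in the variety. The dimension of the variety is the maximal dimension of its irreducible components. Superalgebras of type $(2,1)$, in basis $e_1,e_2$ (even), $f_1$ (odd), listed by nonzero products (unlisted products are zero): $\mathbf{R}_{01}$: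 $e_1e_1=e_1,\ e_2e_2=e_2$; $\mathbf{R}_{03}$: $e_1e_1=e_1,\ e_2e_2=e_2,\ e_1f_1=f_1,\ f_1e_1=f_1,\ f_1f_1=e_1$; $\mathbf{R}_{04}$: $e_1e_1=e_1,\ e_2e_2=e_2,\ f_1e_1=f_1$; $\mathbf{R}_{05}$: $e_1e_1=e_1,\ e_2e_2=e_2,\ e_1f_1=f_1$; $\mathbf{R}_{07}$: $e_1e_1=e_1,\ e_2e_2=e_2,\ e_2f_1=f_1,\ f_1e_1=f_1$; $\mathbf{R}_{23}$: $e_1e_1=e_1,\ e_1e_2=e_2$; $\mathbf{R}_{25}$: $e_1e_1=e_1,\ e_2e_1=e_2$; $\mathbf{R}_{28}$: $e_1e_1=e_1,\ e_2e_1=e_2,\ e_1f_1=f_1,\ f_1f_1=e_2$; $\mathbf{R}_{30}$: $e_1e_1=e_1,\ e_1e_2=e_2,\ f_1e_1=f_1,\ f_1f_1=e_2$; $\mathbf{R}_{31}$: $e_1e_1=e_1,\ e_2e_1=e_2,\ f_1e_1=f_1$; $\mathbf{R}_{32}$: $e_1e_1=e_1,\ e_1e_2=e_2,\ e_1f_1=f_1$; $\mathbf{R}_{33}$: $e_1e_1=e_1,\ e_2e_1=e_2,\ e_1f_1=f_1,\ f_1e_1=f_1$; $\mathbf{R}_{36}$: $e_1e_1=e_1,\ e_1e_2=e_2,\ e_1f_1=f_1,\ f_1e_1=f_1$. *)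

theory Defs
  imports Complex_Main "HOL-Library.Extended_Nat"
begin

text \<open>Basis indices: 0 = e1, 1 = e2 (even), 2 = f1 (odd). Vectors of V are
  functions nat => complex supported on {0,1,2}.\<close>

definition deg :: "nat \<Rightarrow> nat" where
  "deg i = (if i = 2 then 1 else 0)"

definition homog :: "(nat \<Rightarrow> complex) \<Rightarrow> nat \<Rightarrow> bool" where
  "homog x d \<longleftrightarrow> (\<forall>i. x i \<noteq> 0 \<longrightarrow> i < 3 \<and> deg i = d)"

text \<open>Structure constants: c i j k is the coefficient of b_k in b_i b_j.\<close>
type_synonym sconst = "nat \<Rightarrow> nat \<Rightarrow> nat \<Rightarrow> complex"

text \<open>The affine space of even bilinear maps V x V -> V (14-dimensional).\<close>
definition ambient :: "sconst set" where
  "ambient = {c. \<forall>i j k. c i j k \<noteq> 0 \<longrightarrow>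
      i < 3 \<and> j < 3 \<and> k < 3 \<and> deg k = (deg i + deg j) mod 2}"

definition mult :: "sconst \<Rightarrow> (nat \<Rightarrow> complex) \<Rightarrow> (nat \<Rightarrow> complex) \<Rightarrow> (nat \<Rightarrow> complex)" where
  "mult c x y = (\<lambda>k. \<Sum>i<3. \<Sum>j<3. x i * y j * c i j k)"

definition assoc :: "sconst \<Rightarrow> (nat \<Rightarrow> complex) \<Rightarrow> (nat \<Rightarrow> complex) \<Rightarrow> (nat \<Rightarrow> complex) \<Rightarrow> (nat \<Rightarrow> complex)" where
  "assoc c x y z = mult c (mult c x y) z - mult c x (mult c y z)"

definition bin_assoc :: "sconst \<Rightarrow> bool" where
  "bin_assoc c \<longleftrightarrow> (\<forall>x y z a b d. homog x a \<longrightarrow> homog y b \<longrightarrow> homog z d \<longrightarrow>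
      assoc c x y z = (\<lambda>k. - ((-1::complex) ^ (b * d)) * assoc c x z y k) \<and>
      assoc c x y z = (\<lambda>k. - ((-1::complex) ^ (a * b)) * assoc c y x z k))"

definition BAS21 :: "sconst set" where
  "BAS21 = {c \<in> ambient. bin_assoc c}"

inductive_set polyfun :: "(sconst \<Rightarrow> complex) set" where
  pconst: "(\<lambda>_. a) \<in> polyfun"
| pvar: "(\<lambda>c. c i j k) \<in> polyfun"
| padd: "f \<in> polyfun \<Longrightarrow> g \<in> polyfun \<Longrightarrow> (\<lambda>c. f c + g c) \<in> polyfun"
| pmult: "f \<in> polyfun \<Longrightarrow> g \<in> polyfun \<Longrightarrow> (\<lambda>c. f c * g c) \<in> polyfun"

definition zclosed :: "sconst set \<Rightarrow> bool" where
  "zclosed S \<longleftrightarrow> (\<exists>F \<subseteq> polyfun. S = {c \<in> ambient. \<forall>f \<in> F. f c = 0})"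

definition zclosure :: "sconst set \<Rightarrow> sconst set" where
  "zclosure S = \<Inter> {C. zclosed C \<and> S \<subseteq> C}"

definition zirreducible :: "sconst set \<Rightarrow> bool" where
  "zirreducible Z \<longleftrightarrow> Z \<noteq> {} \<and>
     (\<forall>C1 C2. zclosed C1 \<longrightarrow> zclosed C2 \<longrightarrow> Z \<subseteq> C1 \<union> C2 \<longrightarrow> Z \<subseteq> C1 \<or> Z \<subseteq> C2)"

definition irr_components :: "sconst set \<Rightarrow> sconst set set" where
  "irr_components X = {Z. Z \<subseteq> X \<and> zirreducible Z \<and>
      (\<forall>W. zirreducible W \<longrightarrow> Z \<subseteq> W \<longrightarrow> W \<subseteq> X \<longrightarrow> W = Z)}"

definition zdim :: "sconst set \<Rightarrow> enat" where
  "zdim X = Sup {enat n | n. \<exists>Z :: nat \<Rightarrow> sconst set.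
      (\<forall>i\<le>n. zclosed (Z i) \<and> zirreducible (Z i) \<and> Z i \<subseteq> X) \<and>
      (\<forall>i<n. Z i \<subset> Z (Suc i))}"

text \<open>Pairs (G, H) of mutually inverse block-diagonal 3x3 matrices, i.e.
  elements g of GL(V0) x GL(V1) together with g^{-1}.\<close>
definition glpairs :: "((nat \<Rightarrow> nat \<Rightarrow> complex) \<times> (nat \<Rightarrow> nat \<Rightarrow> complex)) set" where
  "glpairs = {(G, H).
      (\<forall>i j. G i j \<noteq> 0 \<longrightarrow> i < 3 \<and> j < 3 \<and> deg i = deg j) \<and>
      (\<forall>i j. H i j \<noteq> 0 \<longrightarrow> i < 3 \<and> j < 3 \<and> deg i = deg j) \<and>
      (\<forall>i<3. \<forall>j<3. (\<Sum>k<3. G i k * H k j) = (if i = j then 1 else 0)) \<and>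
      (\<forall>i<3. \<forall>j<3. (\<Sum>k<3. H i k * G k j) = (if i = j then 1 else 0))}"

text \<open>(g * mu)(x, y) = g mu(g^{-1} x, g^{-1} y) in structure constants.\<close>
definition act :: "(nat \<Rightarrow> nat \<Rightarrow> complex) \<Rightarrow> (nat \<Rightarrow> nat \<Rightarrow> complex) \<Rightarrow> sconst \<Rightarrow> sconst" where
  "act G H c = (\<lambda>i j k. \<Sum>p<3. \<Sum>q<3. \<Sum>r<3. H p i * H q j * c p q r * G k r)"

definition orbit :: "sconst \<Rightarrow> sconst set" where
  "orbit c = {act G H c | G H. (G, H) \<in> glpairs}"

definition rigid_in :: "sconst set \<Rightarrow> sconst \<Rightarrow> bool" where
  "rigid_in X c \<longleftrightarrow> c \<in> X \<and> (\<exists>C. zclosed C \<and> orbit c = X - C)"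

definition sc_of :: "(nat \<times> nat \<times> nat) list \<Rightarrow> sconst" where
  "sc_of l = (\<lambda>i j k. if (i, j, k) \<in> set l then 1 else 0)"

definition "R01 = sc_of [(0,0,0),(1,1,1)]"
definition "R03 = sc_of [(0,0,0),(1,1,1),(0,2,2),(2,0,2),(2,2,0)]"
definition "R04 = sc_of [(0,0,0),(1,1,1),(2,0,2)]"
definition "R05 = sc_of [(0,0,0),(1,1,1),(0,2,2)]"
definition "R07 = sc_of [(0,0,0),(1,1,1),(1,2,2),(2,0,2)]"
definition "R23 = sc_of [(0,0,0),(0,1,1)]"
definition "R25 = sc_of [(0,0,0),(1,0,1)]"
definition "R28 = sc_of [(0,0,0),(1,0,1),(0,2,2),(2,2,1)]"
definition "R30 = sc_of [(0,0,0),(0,1,1),(2,0,2),(2,2,1)]"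
definition "R31 = sc_of [(0,0,0),(1,0,1),(2,0,2)]"
definition "R32 = sc_of [(0,0,0),(0,1,1),(0,2,2)]"
definition "R33 = sc_of [(0,0,0),(1,0,1),(0,2,2),(2,0,2)]"
definition "R36 = sc_of [(0,0,0),(0,1,1),(0,2,2),(2,0,2)]"

definition Rlist :: "sconst set" where
  "Rlist = {R01, R03, R04, R05, R07, R23, R25, R28, R30, R31, R32, R33, R36}"

end

(* For an even part A and an odd vector f the identities say that A is a two-dimensional
   associative algebra, that f spans a bimodule given by two characters l, r of A, and that p = f f
   satisfies x p = r(x) p and p x = l(x) p.  Either A has an element x with x, x^2 independent, and
   then the structure is determined by the roots of the cubic equation of x, by l(x), r(x) and by p, or
   A is x y = lam(x) y or x y = lam(y) x.  This gives thirteen polynomial families whose generic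
   members form single orbits, so every structure lies in the closure of one of thirteen orbits; degenerate
   members satisfy additional equations that fail on the orbit, so the orbits are open.

   Orbits are images of polynomial maps of C^5, up to a hypersurface.  Restriction to lines shows that they are
   irreducible, and counting monomials shows that any six polynomial functions on an orbit are algebraically
   dependent.  Passing to a smaller irreducible closed set lowers this number, so chains in the variety have
   length at most 5.  A chain of length 5 is written down. *)

theory Submission
  imports Defs "HOL-Library.FuncSet" "HOL-Computational_Algebra.Polynomial"
begin

hide_const (open) Multiset.mult
hide_fact (open) Multiset.mult_def

section \<open>Polynomial functions\<close>

text \<open>The thirteen closures have different dimensions: the family
  \<open>x y = lam(x) y\<close> with fixed ratios \<open>l / lam\<close>, \<open>r / lam\<close> and
  \<open>f f = 0\<close> depends only on the two values of \<open>lam\<close>, whereas the group has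
  dimension 4 + 1 = 5. Comparing dimensions therefore cannot exclude that one of the orbits lies in
  the closure of another. Equations do this: commutativity, \<open>l = r\<close> or the vanishing of
  a character pass to the closure. The delicate point is a character that might degenerate to 0; it
  is held by the equation that its value at e1 + e2 is an eigenvalue of left multiplication by e1 +
  e2. Covering and openness come from a single statement: every structure is assigned to one of the
  closures and, if it misses the orbit, also to a closed set disjoint from that orbit. Three such
  sets suffice: degenerate trace form of the even part, f f = 0, and \<open>lam = 0\<close>, the
  last read off from two coordinates. Complex numbers enter through roots: those of the cubic, a
  square root to normalize \<open>f f\<close>, and a fourth root to make the parametrization of an
  orbit surjective.\<close>

lemma polyfun_uminus: "f \<in> polyfun \<Longrightarrow> (\<lambda>c. - f c) \<in> polyfun"
  using pmult[OF pconst[of "-1"]] by simp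

lemma polyfun_diff: "f \<in> polyfun \<Longrightarrow> g \<in> polyfun \<Longrightarrow> (\<lambda>c. f c - g c) \<in> polyfun"
  using padd[OF _ polyfun_uminus] by simp

lemma polyfun_sum: "(\<And>i. i \<in> I \<Longrightarrow> f i \<in> polyfun) \<Longrightarrow> (\<lambda>c. \<Sum>i\<in>I. f i c) \<in> polyfun"
  by (induction I rule: infinite_finite_induct) (auto intro: polyfun.intros)

lemma polyfun_prod: "(\<And>i. i \<in> I \<Longrightarrow> f i \<in> polyfun) \<Longrightarrow> (\<lambda>c. \<Prod>i\<in>I. f i c) \<in> polyfun"
  by (induction I rule: infinite_finite_induct) (auto intro: polyfun.intros)

lemma polyfun_power: "f \<in> polyfun \<Longrightarrow> (\<lambda>c. f c ^ n) \<in> polyfun"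
  by (induction n) (auto intro: polyfun.intros)

lemmas polyfun_intros = polyfun.intros polyfun_uminus polyfun_diff polyfun_sum polyfun_prod polyfun_power

lemma polyfun_comp:
  assumes "f \<in> polyfun" "\<And>i j k. (\<lambda>c. \<Phi> c i j k) \<in> polyfun"
  shows "(\<lambda>c. f (\<Phi> c)) \<in> polyfun"
  using assms(1) by induction (auto intro: polyfun.intros assms(2))

lemma polyfun_act: "(\<lambda>c. act G H c i j k) \<in> polyfun"
  unfolding act_def by (intro polyfun_intros)

section \<open>Polynomial functions of finitely many parameters, with their number recorded\<close>

inductive_set ppoly :: "nat \<Rightarrow> ((nat \<Rightarrow> complex) \<Rightarrow> complex) set" for n where
  const: "(\<lambda>_. a) \<in> ppoly n"
| var: "i < n \<Longrightarrow> (\<lambda>h. h i) \<in> ppoly n"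
| add: "f \<in> ppoly n \<Longrightarrow> g \<in> ppoly n \<Longrightarrow> (\<lambda>h. f h + g h) \<in> ppoly n"
| mult: "f \<in> ppoly n \<Longrightarrow> g \<in> ppoly n \<Longrightarrow> (\<lambda>h. f h * g h) \<in> ppoly n"

lemma ppoly_uminus: "f \<in> ppoly n \<Longrightarrow> (\<lambda>c. - f c) \<in> ppoly n"
  using ppoly.mult[OF ppoly.const[of "-1"]] by simp

lemma ppoly_diff: "f \<in> ppoly n \<Longrightarrow> g \<in> ppoly n \<Longrightarrow> (\<lambda>c. f c - g c) \<in> ppoly n"
  using ppoly.add[OF _ ppoly_uminus] by simp

lemma ppoly_sum: "(\<And>i. i \<in> I \<Longrightarrow> f i \<in> ppoly n) \<Longrightarrow> (\<lambda>c. \<Sum>i\<in>I. f i c) \<in> ppoly n"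
  by (induction I rule: infinite_finite_induct) (auto intro: ppoly.intros)

lemma ppoly_power: "f \<in> ppoly n \<Longrightarrow> (\<lambda>c. f c ^ m) \<in> ppoly n"
  by (induction m) (auto intro: ppoly.intros)

lemma ppoly_if: "(P \<Longrightarrow> f \<in> ppoly n) \<Longrightarrow> (\<not> P \<Longrightarrow> g \<in> ppoly n) \<Longrightarrow> (\<lambda>c. if P then f c else g c) \<in> ppoly n"
  by (cases P) simp_all

lemmas ppoly_intros = ppoly.intros ppoly_uminus ppoly_diff ppoly_sum ppoly_power ppoly_if

lemma ppoly_comp:
  assumes "f \<in> polyfun" "\<And>i j k. (\<lambda>h. \<Phi> h i j k) \<in> ppoly n"
  shows "(\<lambda>h. f (\<Phi> h)) \<in> ppoly n"
  using assms(1) by induction (auto intro: ppoly.intros assms(2))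

lemma ppoly_line:
  assumes "f \<in> ppoly n"
  shows "\<exists>P. \<forall>t. f (\<lambda>i. h0 i + t * (h1 i - h0 i)) = poly P t"
  using assms
proof induction
  case (const a)
  show ?case by (rule exI[of _ "[:a:]"]) simp
next
  case (var i)
  show ?case by (rule exI[of _ "[:h0 i, h1 i - h0 i:]"]) simp
next
  case (add f g)
  then show ?case by (metis poly_add)
next
  case (mult f g)
  then show ?case by (metis poly_mult)
qed

section \<open>The Zariski topology\<close>

lemma zclosedI_poly: "F \<subseteq> polyfun \<Longrightarrow> zclosed {c \<in> ambient. \<forall>f\<in>F. f c = 0}"
  unfolding zclosed_def by blast

lemma zclosed_zeros: "f \<in> polyfun \<Longrightarrow> zclosed {c \<in> ambient. f c = 0}"
  using zclosedI_poly[of "{f}"] by simp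

lemma zclosed_subset_ambient: "zclosed C \<Longrightarrow> C \<subseteq> ambient"
  unfolding zclosed_def by auto

lemma zclosed_ambient: "zclosed ambient"
  using zclosedI_poly[of "{}"] by simp

lemma zclosed_empty: "zclosed {}"
  using zclosed_zeros[OF pconst[of 1]] by simp

text \<open>Closed sets are cut out inside \<open>ambient\<close>, while the intersection of the
  empty family is the whole type; hence the second premise.\<close>

lemma zclosed_Inter:
  assumes "\<And>C. C \<in> \<C> \<Longrightarrow> zclosed C" "\<C> \<noteq> {}"
  shows "zclosed (\<Inter>\<C>)"
proof -
  have "\<exists>F\<subseteq>polyfun. \<forall>c. c \<in> C \<longleftrightarrow> c \<in> ambient \<and> (\<forall>f\<in>F. f c = 0)" if "C \<in> \<C>" for C
    using assms(1)[OF that] unfolding zclosed_def by auto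
  then obtain F where F: "\<And>C. C \<in> \<C> \<Longrightarrow> F C \<subseteq> polyfun"
    and mem: "\<And>C c. C \<in> \<C> \<Longrightarrow> c \<in> C \<longleftrightarrow> c \<in> ambient \<and> (\<forall>f\<in>F C. f c = 0)"
    by metis
  have "\<Inter>\<C> = {c \<in> ambient. \<forall>f\<in>(\<Union>C\<in>\<C>. F C). f c = 0}"
    using mem assms(2) by fastforce
  then show ?thesis
    unfolding zclosed_def
    by (intro exI[of _ "\<Union>C\<in>\<C>. F C"] conjI UN_least F)
qed

lemma zclosed_Int: "zclosed A \<Longrightarrow> zclosed B \<Longrightarrow> zclosed (A \<inter> B)"
  using zclosed_Inter[of "{A, B}"] by auto

lemma zclosed_Un:
  assumes "zclosed A" "zclosed B"
  shows "zclosed (A \<union> B)"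
proof -
  obtain F where F: "F \<subseteq> polyfun" "A = {c \<in> ambient. \<forall>f\<in>F. f c = 0}"
    using assms(1) unfolding zclosed_def by blast
  obtain G where G: "G \<subseteq> polyfun" "B = {c \<in> ambient. \<forall>f\<in>G. f c = 0}"
    using assms(2) unfolding zclosed_def by blast
  let ?P = "(\<lambda>(f, g) c. f c * g c) ` (F \<times> G)"
  have "A \<union> B = {c \<in> ambient. \<forall>p\<in>?P. p c = 0}"
    unfolding F(2) G(2) by (auto simp: ball_simps)
  moreover have "?P \<subseteq> polyfun"
    using F(1) G(1) by (auto intro!: pmult)
  ultimately show ?thesis
    unfolding zclosed_def by blast
qed

lemma zclosed_UN: "finite I \<Longrightarrow> (\<And>i. i \<in> I \<Longrightarrow> zclosed (C i)) \<Longrightarrow> zclosed (\<Union>i\<in>I. C i)"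
  by (induction I rule: finite_induct) (auto intro: zclosed_Un zclosed_empty)

lemma zclosed_zclosure: "S \<subseteq> ambient \<Longrightarrow> zclosed (zclosure S)"
  unfolding zclosure_def using zclosed_ambient by (intro zclosed_Inter) auto

lemma zclosure_superset: "S \<subseteq> zclosure S"
  unfolding zclosure_def by blast

lemma zclosure_minimal: "zclosed C \<Longrightarrow> S \<subseteq> C \<Longrightarrow> zclosure S \<subseteq> C"
  unfolding zclosure_def by blast

lemma zclosure_mono: "S \<subseteq> T \<Longrightarrow> zclosure S \<subseteq> zclosure T"
  unfolding zclosure_def by blast

lemma zclosed_avoid:
  assumes "zclosed C" "x \<in> ambient" "x \<notin> C"
  obtains f where "f \<in> polyfun" "\<And>c. c \<in> C \<Longrightarrow> f c = 0" "f x \<noteq> 0"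
  using assms unfolding zclosed_def by auto

lemma polyfun_zero_zclosure:
  assumes "f \<in> polyfun" "S \<subseteq> ambient" "\<And>c. c \<in> S \<Longrightarrow> f c = 0" "c \<in> zclosure S"
  shows "f c = 0"
  using zclosure_minimal[OF zclosed_zeros[OF assms(1)], of S] assms by auto

text \<open>A closed set contains \<open>S\<close> exactly when it contains the closure of
  \<open>S\<close>. Irreducibility can thus be proved for parametrized sets, which need not be
  closed.\<close>

lemma zirreducible_zclosure:
  assumes "zirreducible S"
  shows "zirreducible (zclosure S)"
  using assms zclosure_superset[of S] unfolding zirreducible_def
  by (metis (no_types, lifting) order_trans subset_empty zclosure_minimal)

lemma zirreducible_mult_zero:
  assumes "zirreducible Z" "Z \<subseteq> ambient" "f \<in> polyfun" "g \<in> polyfun"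
    "\<And>c. c \<in> Z \<Longrightarrow> f c * g c = 0"
  shows "(\<forall>c\<in>Z. f c = 0) \<or> (\<forall>c\<in>Z. g c = 0)"
proof -
  have "Z \<subseteq> {c \<in> ambient. f c = 0} \<union> {c \<in> ambient. g c = 0}"
    using assms(2,5) by auto
  then have "Z \<subseteq> {c \<in> ambient. f c = 0} \<or> Z \<subseteq> {c \<in> ambient. g c = 0}"
    using assms(1,3,4) zclosed_zeros unfolding zirreducible_def by blast
  then show ?thesis by auto
qed

lemma zirreducible_Union:
  assumes "zirreducible Z" "finite \<C>" "\<And>C. C \<in> \<C> \<Longrightarrow> zclosed C" "Z \<subseteq> \<Union>\<C>"
  shows "\<exists>C\<in>\<C>. Z \<subseteq> C"
  using assms(2,3,4)
proof (induction \<C> rule: finite_induct)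
  case empty
  then show ?case using assms(1) unfolding zirreducible_def by simp
next
  case (insert C \<C>)
  have "zclosed (\<Union>\<C>)"
    using insert zclosed_UN[of \<C> "\<lambda>C. C"] by simp
  then have "Z \<subseteq> C \<or> Z \<subseteq> \<Union>\<C>"
    using assms(1) insert.prems unfolding zirreducible_def by auto
  then show ?case using insert by auto
qed

lemma ppoly_line_zero:
  assumes f: "f \<in> ppoly n" and g: "g \<in> ppoly n" and q: "q \<in> ppoly n"
    and z: "\<And>h. q h \<noteq> 0 \<Longrightarrow> f h * g h = 0"
    and h: "f h0 \<noteq> 0" "g h1 \<noteq> 0" "q h2 \<noteq> 0"
  shows False
proof -
  \<comment> \<open>On the line through two points of nonvanishing, a product of nonzero univariate polynomials.\<close>
  have join: "\<exists>h. f h * g h \<noteq> 0"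
    if fg: "f \<in> ppoly n" "g \<in> ppoly n" "f h0 \<noteq> 0" "g h1 \<noteq> 0" for f g h0 h1
  proof -
    obtain P Q where P: "\<And>t. f (\<lambda>i. h0 i + t * (h1 i - h0 i)) = poly P t"
      and Q: "\<And>t. g (\<lambda>i. h0 i + t * (h1 i - h0 i)) = poly Q t"
      using ppoly_line fg by metis
    have "P \<noteq> 0" "Q \<noteq> 0"
      using P[of 0] Q[of 1] fg by auto
    then have "P * Q \<noteq> 0" by simp
    then obtain t where "poly (P * Q) t \<noteq> 0"
      using poly_all_0_iff_0 by blast
    then show ?thesis using P Q by (metis poly_mult)
  qed
  obtain h' where "f h' * g h' \<noteq> 0" using join[OF f g h(1,2)] by blast
  \<comment> \<open>\<open>q\<close> joins as a third factor, because nothing is known about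
    \<open>f h * g h\<close> where \<open>q\<close> vanishes.\<close>
  then obtain h'' where "f h'' * g h'' * q h'' \<noteq> 0"
    using join[OF ppoly.mult[OF f g] q, of h' h2] h(3) by blast
  then show False using z by force
qed

text \<open>If the image lies in neither \<open>C1\<close> nor \<open>C2\<close>, an equation of
  each pulls back to a nonzero polynomial in the parameters, and the product of the two vanishes
  wherever \<open>q\<close> does not.\<close>

lemma zirreducible_image:
  assumes \<Phi>: "\<And>i j k. (\<lambda>h. \<Phi> h i j k) \<in> ppoly n" and amb: "\<And>h. \<Phi> h \<in> ambient"
    and q: "q \<in> ppoly n" "q h2 \<noteq> 0"
  shows "zirreducible (\<Phi> ` {h. q h \<noteq> 0})" (is "zirreducible ?S")
  unfolding zirreducible_def
proof (intro conjI allI impI)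
  show "?S \<noteq> {}" using q by auto
next
  fix C1 C2 assume C: "zclosed C1" "zclosed C2" "?S \<subseteq> C1 \<union> C2"
  show "?S \<subseteq> C1 \<or> ?S \<subseteq> C2"
  proof (rule ccontr)
    assume "\<not> (?S \<subseteq> C1 \<or> ?S \<subseteq> C2)"
    then obtain h0 h1 where h: "\<Phi> h0 \<notin> C1" "\<Phi> h1 \<notin> C2" by blast
    obtain f where f: "f \<in> polyfun" "\<And>c. c \<in> C1 \<Longrightarrow> f c = 0" "f (\<Phi> h0) \<noteq> 0"
      using zclosed_avoid[OF C(1) amb h(1)] by blast
    obtain g where g: "g \<in> polyfun" "\<And>c. c \<in> C2 \<Longrightarrow> g c = 0" "g (\<Phi> h1) \<noteq> 0"
      using zclosed_avoid[OF C(2) amb h(2)] by blast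
    show False
      using C(3) f(2) g(2)
      by (intro ppoly_line_zero[OF ppoly_comp[OF f(1) \<Phi>] ppoly_comp[OF g(1) \<Phi>] q(1) _ f(3) g(3) q(2)])
        force
  qed
qed

lemma zirreducible_range:
  assumes \<Phi>: "\<And>i j k. (\<lambda>h. \<Phi> h i j k) \<in> ppoly n" and amb: "\<And>h. \<Phi> h \<in> ambient"
  shows "zirreducible (range \<Phi>)"
  using zirreducible_image[OF assms ppoly.const[of 1]] by simp

text \<open>A polynomial that vanishes on \<open>S\<close> pulls back to one that vanishes off the
  hypersurface \<open>q = 0\<close>, hence everywhere. All degenerations to members of the families
  come from this: only the generic member has to be placed in the orbit.\<close>

lemma dense_image:
  assumes \<Phi>: "\<And>i j k. (\<lambda>h. \<Phi> h i j k) \<in> ppoly n" and amb: "\<And>h. \<Phi> h \<in> ambient"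
    and q: "q \<in> ppoly n" "q h2 \<noteq> 0" and S: "\<And>h. q h \<noteq> 0 \<Longrightarrow> \<Phi> h \<in> S" "S \<subseteq> ambient"
  shows "\<Phi> h \<in> zclosure S"
proof (rule ccontr)
  assume "\<Phi> h \<notin> zclosure S"
  then obtain f where f: "f \<in> polyfun" "\<And>c. c \<in> zclosure S \<Longrightarrow> f c = 0" "f (\<Phi> h) \<noteq> 0"
    using zclosed_avoid[OF zclosed_zclosure[OF S(2)] amb] by blast
  show False
    using S f(2) zclosure_superset[of S]
    by (intro ppoly_line_zero[OF ppoly_comp[OF f(1) \<Phi>] ppoly.const[of 1] q(1) _ f(3) _ q(2)]) auto
qed

section \<open>Algebraic dependence and dimension\<close>

text \<open>Gaussian elimination on the equations \<open>J\<close>: if equation \<open>j\<close> has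
  a nonzero coefficient at \<open>k\<close>, this unknown is eliminated from the other equations,
  and both numbers drop by one.\<close>

lemma homogeneous_system_nontrivial:
  fixes M :: "'a \<Rightarrow> 'b \<Rightarrow> 'f::field"
  assumes "finite J" "finite I" "card J < card I"
  shows "\<exists>x. (\<exists>i\<in>I. x i \<noteq> 0) \<and> (\<forall>j\<in>J. (\<Sum>i\<in>I. x i * M i j) = 0)"
  using assms
proof (induction J arbitrary: I M rule: finite_induct)
  case empty
  then have "I \<noteq> {}" by auto
  then show ?case by (intro exI[of _ "\<lambda>_. 1"]) auto
next
  case (insert j J)
  show ?case
  proof (cases "\<exists>k\<in>I. M k j \<noteq> 0")
    case False
    obtain x where "\<exists>i\<in>I. x i \<noteq> 0" "\<forall>j\<in>J. (\<Sum>i\<in>I. x i * M i j) = 0"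
      using insert.IH[of I M] insert.prems insert.hyps by auto
    then show ?thesis using False by (intro exI[of _ x]) auto
  next
    case True
    then obtain k where k: "k \<in> I" "M k j \<noteq> 0" by blast
    let ?I = "I - {k}" and ?M = "\<lambda>i l. M i l - M i j / M k j * M k l"
    have "card J < card ?I"
      using insert.prems insert.hyps k by simp
    then obtain x where x: "\<exists>i\<in>?I. x i \<noteq> 0" "\<forall>l\<in>J. (\<Sum>i\<in>?I. x i * ?M i l) = 0"
      using insert.IH[of ?I ?M] insert.prems by auto
    let ?s = "\<Sum>i\<in>?I. x i * M i j"
    \<comment> \<open>The value at the pivot is the one that equation \<open>j\<close>
      prescribes.\<close>
    define y where "y = x(k := - ?s / M k j)"
    have split: "(\<Sum>i\<in>I. y i * M i l) = - ?s / M k j * M k l + (\<Sum>i\<in>?I. x i * M i l)" for l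
    proof -
      have "(\<Sum>i\<in>?I. y i * M i l) = (\<Sum>i\<in>?I. x i * M i l)"
        by (rule sum.cong) (auto simp: y_def)
      then show ?thesis
        using sum.remove[OF insert.prems(1) k(1), of "\<lambda>i. y i * M i l"] by (simp add: y_def)
    qed
    have "(\<Sum>i\<in>I. y i * M i l) = 0" if "l \<in> J" for l
    proof -
      have "(\<Sum>i\<in>?I. x i * ?M i l) = (\<Sum>i\<in>?I. x i * M i l) - (\<Sum>i\<in>?I. x i * M i j * (M k l / M k j))"
        unfolding sum_subtractf[symmetric] by (rule sum.cong) (auto simp: algebra_simps)
      also have "(\<Sum>i\<in>?I. x i * M i j * (M k l / M k j)) = ?s * (M k l / M k j)"
        by (rule sum_distrib_right[symmetric])
      finally show ?thesis
        using x(2) that unfolding split by (simp add: field_simps)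
    qed
    moreover have "(\<Sum>i\<in>I. y i * M i j) = 0"
      unfolding split using k(2) by simp
    moreover have "\<exists>i\<in>I. y i \<noteq> 0"
      using x(1) by (auto simp: y_def)
    ultimately show ?thesis by (intro exI[of _ y]) auto
  qed
qed

section \<open>Counting monomials of bounded degree\<close>

definition expo :: "nat \<Rightarrow> nat \<Rightarrow> (nat \<Rightarrow> nat) set" where
  "expo n N = {..<n} \<rightarrow>\<^sub>E {..N}"

lemma finite_expo: "finite (expo n N)"
  unfolding expo_def by (intro finite_PiE) auto

lemma card_expo: "card (expo n N) = Suc N ^ n"
  unfolding expo_def by (simp add: card_PiE)

text \<open>The exponent of each variable is bounded separately: the monomials form a box of
  \<open>Suc N ^ n\<close> elements, and bounds add up under products.\<close>

definition bdeg :: "nat \<Rightarrow> nat \<Rightarrow> ((nat \<Rightarrow> complex) \<Rightarrow> complex) set" where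
  "bdeg n N = {f. \<exists>P. \<forall>h. f h = (\<Sum>b\<in>expo n N. P b * (\<Prod>i<n. h i ^ b i))}"

lemma bdeg_sum:
  assumes "\<And>i. i \<in> I \<Longrightarrow> f i \<in> bdeg n N"
  shows "(\<lambda>h. \<Sum>i\<in>I. f i h) \<in> bdeg n N"
proof -
  have "\<forall>i\<in>I. \<exists>P. \<forall>h. f i h = (\<Sum>b\<in>expo n N. P b * (\<Prod>k<n. h k ^ b k))"
    using assms unfolding bdeg_def by simp
  then obtain P where P: "\<And>i h. i \<in> I \<Longrightarrow> f i h = (\<Sum>b\<in>expo n N. P i b * (\<Prod>k<n. h k ^ b k))"
    by metis
  have "(\<Sum>i\<in>I. f i h) = (\<Sum>b\<in>expo n N. (\<Sum>i\<in>I. P i b) * (\<Prod>k<n. h k ^ b k))" for h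
  proof -
    have "(\<Sum>i\<in>I. f i h) = (\<Sum>i\<in>I. \<Sum>b\<in>expo n N. P i b * (\<Prod>k<n. h k ^ b k))"
      by (rule sum.cong) (auto simp: P)
    also have "\<dots> = (\<Sum>b\<in>expo n N. \<Sum>i\<in>I. P i b * (\<Prod>k<n. h k ^ b k))"
      by (rule sum.swap)
    finally show ?thesis by (simp add: sum_distrib_right)
  qed
  then show ?thesis
    unfolding bdeg_def by (intro CollectI exI[of _ "\<lambda>b. \<Sum>i\<in>I. P i b"]) blast
qed

lemma bdeg_monomial:
  assumes "\<And>i. i < n \<Longrightarrow> b i \<le> N"
  shows "(\<lambda>h. a * (\<Prod>i<n. h i ^ b i)) \<in> bdeg n N"
proof -
  let ?b = "restrict b {..<n}"
  have "?b \<in> expo n N" using assms unfolding expo_def by auto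
  moreover have "(\<Prod>i<n. h i ^ b i) = (\<Prod>i<n. h i ^ ?b i)" for h :: "nat \<Rightarrow> complex"
    by (rule prod.cong) auto
  ultimately have "a * (\<Prod>i<n. h i ^ b i)
      = (\<Sum>c\<in>expo n N. (if c = ?b then a else 0) * (\<Prod>i<n. h i ^ c i))" for h
    using finite_expo[of n N] by (simp add: if_distrib[of "\<lambda>x. x * _"] sum.delta cong: if_cong)
  then show ?thesis
    unfolding bdeg_def by (intro CollectI exI[of _ "\<lambda>c. if c = ?b then a else 0"]) blast
qed

lemma bdeg_mult:
  assumes "f \<in> bdeg n N" "g \<in> bdeg n M"
  shows "(\<lambda>h. f h * g h) \<in> bdeg n (N + M)"
proof -
  obtain P where P: "\<And>h. f h = (\<Sum>b\<in>expo n N. P b * (\<Prod>i<n. h i ^ b i))"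
    using assms(1) unfolding bdeg_def by blast
  obtain Q where Q: "\<And>h. g h = (\<Sum>b\<in>expo n M. Q b * (\<Prod>i<n. h i ^ b i))"
    using assms(2) unfolding bdeg_def by blast
  have "f h * g h = (\<Sum>b\<in>expo n N. \<Sum>d\<in>expo n M. (P b * Q d) * (\<Prod>i<n. h i ^ (b i + d i)))" for h
    unfolding P Q sum_product by (intro sum.cong refl) (simp add: power_add prod.distrib)
  moreover have "(\<lambda>h. (P b * Q d) * (\<Prod>i<n. h i ^ (b i + d i))) \<in> bdeg n (N + M)"
    if "b \<in> expo n N" "d \<in> expo n M" for b d
    using that unfolding expo_def by (intro bdeg_monomial add_mono) auto
  ultimately show ?thesis by (simp add: bdeg_sum)
qed

lemma bdeg_const: "(\<lambda>_. a) \<in> bdeg n N"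
  using bdeg_monomial[of n "\<lambda>_. 0" N a] by simp

lemma bdeg_mono:
  assumes "f \<in> bdeg n N" "N \<le> M"
  shows "f \<in> bdeg n M"
  using bdeg_mult[OF assms(1) bdeg_const[of 1 n "M - N"]] assms(2) by simp

lemma ppoly_bdeg: "f \<in> ppoly n \<Longrightarrow> \<exists>N. f \<in> bdeg n N"
proof (induction rule: ppoly.induct)
  case (const a)
  then show ?case using bdeg_const by blast
next
  case (var i)
  have "(\<Prod>j<n. h j ^ (if j = i then 1 else 0)) = h i" for h :: "nat \<Rightarrow> complex"
    using var by (simp add: if_distrib[of "power _"] prod.delta cong: if_cong)
  then show ?case
    using bdeg_monomial[of n "\<lambda>j. if j = i then 1 else 0" 1 1] by (auto intro!: exI[of _ "Suc 0"])
next
  case (add f g)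
  then obtain N M where "f \<in> bdeg n N" "g \<in> bdeg n M" by blast
  then have "f \<in> bdeg n (max N M)" "g \<in> bdeg n (max N M)"
    by (auto intro: bdeg_mono)
  then show ?case
    using bdeg_sum[of "{True, False}" "\<lambda>b. if b then f else g" n "max N M"]
    by (intro exI[of _ "max N M"]) simp
next
  case (mult f g)
  then show ?case using bdeg_mult by blast
qed

lemma bdeg_power: "f \<in> bdeg n N \<Longrightarrow> (\<lambda>h. f h ^ k) \<in> bdeg n (k * N)"
  by (induction k) (auto simp: bdeg_const intro: bdeg_mult)

lemma bdeg_prod:
  assumes "finite I" "\<And>i. i \<in> I \<Longrightarrow> f i \<in> bdeg n N"
  shows "(\<lambda>h. \<Prod>i\<in>I. f i h) \<in> bdeg n (card I * N)"
  using assms by (induction I rule: finite_induct) (auto simp: bdeg_const intro: bdeg_mult)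

text \<open>\<open>A\<close> holds the exponent vectors of a polynomial relation. They are
  extensional so that different elements of \<open>A\<close> are different monomials; two copies of
  one monomial could otherwise cancel and make everything dependent. The type of points stays open
  because a relation is found on the parameter space and then used on structures.\<close>

definition alg_dep :: "'c set \<Rightarrow> nat \<Rightarrow> (nat \<Rightarrow> 'c \<Rightarrow> complex) \<Rightarrow> bool" where
  "alg_dep Z n y \<longleftrightarrow> (\<exists>A P. finite A \<and> A \<subseteq> extensional {..<n} \<and> (\<exists>a\<in>A. P a \<noteq> 0) \<and>
     (\<forall>c\<in>Z. (\<Sum>a\<in>A. P a * (\<Prod>i<n. y i c ^ a i)) = 0))"

lemma alg_depI:
  assumes "finite A" "A \<subseteq> extensional {..<n}" "\<exists>a\<in>A. P a \<noteq> 0"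
    "\<And>c. c \<in> Z \<Longrightarrow> (\<Sum>a\<in>A. P a * (\<Prod>i<n. y i c ^ a i)) = 0"
  shows "alg_dep Z n y"
  unfolding alg_dep_def by (rule exI[of _ A], rule exI[of _ P]) (use assms in simp)

lemma alg_depE:
  assumes "alg_dep Z n y"
  obtains A P where "finite A" "A \<subseteq> extensional {..<n}" "\<exists>a\<in>A. P a \<noteq> 0"
    "\<And>c. c \<in> Z \<Longrightarrow> (\<Sum>a\<in>A. P a * (\<Prod>i<n. y i c ^ a i)) = 0"
  using assms unfolding alg_dep_def by (elim exE conjE) (rule that, assumption+, erule bspec)

text \<open>Counting: the \<open>(D + 1)\<^sup>n\<^sup>+\<^sup>1\<close> monomials in the \<open>y i\<close> lie in a space of
  dimension \<open>O(D\<^sup>n)\<close>.\<close>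

lemma ppoly_alg_dep:
  assumes "\<And>i. i < Suc n \<Longrightarrow> y i \<in> ppoly n"
  shows "alg_dep UNIV (Suc n) y"
proof -
  have "\<exists>N. y i \<in> bdeg n N" if "i < Suc n" for i
    using assms[OF that] ppoly_bdeg by blast
  then obtain N' where N': "\<And>i. i < Suc n \<Longrightarrow> y i \<in> bdeg n (N' i)" by metis
  define N where "N = (\<Sum>i<Suc n. N' i)"
  have N: "y i \<in> bdeg n N" if "i < Suc n" for i
    by (rule bdeg_mono[OF N'[OF that]]) (unfold N_def, rule member_le_sum, use that in auto)
  \<comment> \<open>A monomial in the \<open>y i\<close> with exponents at most \<open>D\<close> has
    degree at most \<open>Suc n * D * N\<close>, hence at most \<open>K * D\<close>, in each
    parameter. The summand 1 makes \<open>K\<close> positive, so that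
    \<open>Suc (K * D) \<le> K * Suc D\<close>; and \<open>D = K ^ n\<close> makes
    \<open>(K * Suc D) ^ n\<close> equal to \<open>D * Suc D ^ n\<close>, just below the number
    \<open>Suc D ^ Suc n\<close> of monomials.\<close>
  define K where "K = Suc n * N + 1"
  define D where "D = K ^ n"
  let ?A = "expo (Suc n) D"
  have "(\<lambda>h. \<Prod>i<Suc n. y i h ^ a i) \<in> bdeg n (K * D)" if "a \<in> ?A" for a
  proof -
    have "(\<lambda>h. \<Prod>i\<in>{..<Suc n}. y i h ^ a i) \<in> bdeg n (card {..<Suc n} * (D * N))"
    proof (rule bdeg_prod)
      fix i assume "i \<in> {..<Suc n}"
      moreover from this that have "a i \<le> D" unfolding expo_def by blast
      ultimately show "(\<lambda>h. y i h ^ a i) \<in> bdeg n (D * N)"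
        using bdeg_mono[OF bdeg_power[OF N[of i], of "a i"]] by simp
    qed simp
    then show ?thesis
      by (rule bdeg_mono) (simp add: K_def algebra_simps)
  qed
  then have "\<forall>a\<in>?A. \<exists>M. \<forall>h. (\<Prod>i<Suc n. y i h ^ a i) = (\<Sum>b\<in>expo n (K * D). M b * (\<Prod>i<n. h i ^ b i))"
    unfolding bdeg_def mem_Collect_eq by (intro ballI)
  from bchoice[OF this] obtain M where M: "\<And>a h. a \<in> ?A \<Longrightarrow>
      (\<Prod>i<Suc n. y i h ^ a i) = (\<Sum>b\<in>expo n (K * D). M a b * (\<Prod>i<n. h i ^ b i))"
    by (elim exE) (rule that, drule (1) bspec, erule spec)
  have "Suc (K * D) ^ n \<le> (K * Suc D) ^ n"
    by (rule power_mono) (auto simp: K_def)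
  also have "\<dots> = D * Suc D ^ n"
    unfolding D_def by (rule power_mult_distrib)
  also have "\<dots> < Suc D ^ Suc n"
    by simp
  finally have "card (expo n (K * D)) < card ?A"
    unfolding card_expo .
  then obtain P where P: "\<exists>a\<in>?A. P a \<noteq> 0" "\<forall>b\<in>expo n (K * D). (\<Sum>a\<in>?A. P a * M a b) = 0"
    using homogeneous_system_nontrivial[OF finite_expo finite_expo, of n "K * D" "Suc n" D M] by blast
  have "(\<Sum>a\<in>?A. P a * (\<Prod>i<Suc n. y i h ^ a i)) = 0" for h
  proof -
    have "(\<Sum>a\<in>?A. P a * (\<Prod>i<Suc n. y i h ^ a i))
        = (\<Sum>a\<in>?A. \<Sum>b\<in>expo n (K * D). P a * M a b * (\<Prod>i<n. h i ^ b i))"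
      by (intro sum.cong refl) (simp only: M sum_distrib_left mult.assoc)
    also have "\<dots> = (\<Sum>b\<in>expo n (K * D). \<Sum>a\<in>?A. P a * M a b * (\<Prod>i<n. h i ^ b i))"
      by (rule sum.swap)
    also have "\<dots> = (\<Sum>b\<in>expo n (K * D). (\<Sum>a\<in>?A. P a * M a b) * (\<Prod>i<n. h i ^ b i))"
      by (simp add: sum_distrib_right)
    finally show ?thesis using P(2) by simp
  qed
  then show ?thesis
    using P(1) finite_expo by (intro alg_depI[of ?A _ P]) (auto simp: expo_def PiE_def)
qed

text \<open>For irreducible \<open>Z\<close> this says that the transcendence degree of the field of
  rational functions is less than \<open>n\<close>. Stated through relations, it makes sense for
  arbitrary sets.\<close>

definition trdeg_less :: "sconst set \<Rightarrow> nat \<Rightarrow> bool" where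
  "trdeg_less Z n \<longleftrightarrow> (\<forall>y. (\<forall>i<n. y i \<in> polyfun) \<longrightarrow> alg_dep Z n y)"

lemma trdeg_less_image:
  assumes "\<And>i j k. (\<lambda>h. \<Phi> h i j k) \<in> ppoly n"
  shows "trdeg_less (\<Phi> ` S) (Suc n)"
  unfolding trdeg_less_def
proof (intro allI impI)
  fix y assume y: "\<forall>i<Suc n. y i \<in> polyfun"
  have "alg_dep UNIV (Suc n) (\<lambda>i h. y i (\<Phi> h))"
    by (rule ppoly_alg_dep, rule ppoly_comp[OF _ assms]) (use y in auto)
  then show "alg_dep (\<Phi> ` S) (Suc n) y"
    by (elim alg_depE, intro alg_depI) auto
qed

lemma trdeg_less_zclosure:
  assumes "trdeg_less S n" "S \<subseteq> ambient"
  shows "trdeg_less (zclosure S) n"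
  unfolding trdeg_less_def
proof (intro allI impI)
  fix y assume y: "\<forall>i<n. y i \<in> polyfun"
  then have "alg_dep S n y"
    using assms(1) unfolding trdeg_less_def by blast
  then obtain A P where AP: "finite A" "A \<subseteq> extensional {..<n}" "\<exists>a\<in>A. P a \<noteq> 0"
    "\<And>c. c \<in> S \<Longrightarrow> (\<Sum>a\<in>A. P a * (\<Prod>i<n. y i c ^ a i)) = 0"
    by (rule alg_depE) blast
  have "(\<lambda>c. \<Sum>a\<in>A. P a * (\<Prod>i<n. y i c ^ a i)) \<in> polyfun"
    using y by (intro polyfun_intros) auto
  from polyfun_zero_zclosure[OF this assms(2) AP(4)]
  show "alg_dep (zclosure S) n y"
    using AP(1-3) by (intro alg_depI[of A _ P])
qed

lemma trdeg_less_mono: "trdeg_less Z n \<Longrightarrow> Z' \<subseteq> Z \<Longrightarrow> trdeg_less Z' n"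
  unfolding trdeg_less_def alg_dep_def by (rule allI, rule impI, drule spec, drule (1) mp) fast

text \<open>There is only one exponent vector on the empty index set and its monomial is 1, so a
  relation says that a nonzero constant vanishes on \<open>Z\<close>.\<close>

lemma trdeg_less_0: "trdeg_less Z 0 \<Longrightarrow> Z = {}"
proof (rule ccontr)
  assume "trdeg_less Z 0" "Z \<noteq> {}"
  then have "alg_dep Z 0 (\<lambda>_ _. 0)" unfolding trdeg_less_def by blast
  then obtain A P where A: "A \<subseteq> extensional {..<0::nat}" "\<exists>a\<in>A. P a \<noteq> (0::complex)"
    "\<And>c. c \<in> Z \<Longrightarrow> (\<Sum>a\<in>A. P a * (\<Prod>i<0::nat. 0 ^ a i)) = 0"
    by (rule alg_depE) blast
  then have "A = {\<lambda>_. undefined}" by auto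
  then show False using A \<open>Z \<noteq> {}\<close> by auto
qed

text \<open>Adjoin to \<open>n\<close> given functions a function \<open>u\<close> that vanishes on \<open>Z'\<close> but not on \<open>Z\<close>.
  As \<open>Z\<close> is irreducible, the largest power of \<open>u\<close> can be cancelled from the resulting
  relation on \<open>Z\<close>; what is left restricts to a nontrivial relation on \<open>Z'\<close>.\<close>

lemma trdeg_less_step:
  assumes Z: "zirreducible Z" "Z \<subseteq> ambient" and Z': "zclosed Z'" "Z' \<subset> Z"
    and td: "trdeg_less Z (Suc n)"
  shows "trdeg_less Z' n"
  unfolding trdeg_less_def
proof (intro allI impI)
  fix y assume y: "\<forall>i<n. y i \<in> polyfun"
  obtain z where z: "z \<in> Z" "z \<notin> Z'" using Z'(2) by blast
  then obtain u where u: "u \<in> polyfun" "\<And>c. c \<in> Z' \<Longrightarrow> u c = 0" "u z \<noteq> 0"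
    using zclosed_avoid[OF Z'(1)] Z(2) by blast
  have "\<forall>i<Suc n. (y(n := u)) i \<in> polyfun"
    using y u(1) by (auto simp: less_Suc_eq)
  then have "alg_dep Z (Suc n) (y(n := u))"
    using td unfolding trdeg_less_def by blast
  then obtain A P where AP: "finite A" "A \<subseteq> extensional {..<Suc n}" "\<exists>a\<in>A. P a \<noteq> 0"
    "\<And>c. c \<in> Z \<Longrightarrow> (\<Sum>a\<in>A. P a * (\<Prod>i<Suc n. (y(n := u)) i c ^ a i)) = 0"
    by (rule alg_depE) blast
  define B where "B = {a \<in> A. P a \<noteq> 0}"
  define m where "m = Min ((\<lambda>a. a n) ` B)"
  have finB: "finite B" and "B \<noteq> {}" using AP unfolding B_def by auto
  then have m_le: "\<And>a. a \<in> B \<Longrightarrow> m \<le> a n" and m_in: "m \<in> (\<lambda>a. a n) ` B"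
    unfolding m_def by auto
  let ?mon = "\<lambda>a c. P a * (\<Prod>i<n. y i c ^ a i)"
  let ?g = "\<lambda>c. \<Sum>a\<in>B. ?mon a c * u c ^ (a n - m)"
  have g: "?g \<in> polyfun"
    using y u(1) by (intro polyfun_intros) auto
  have "u c ^ m * ?g c = 0" if "c \<in> Z" for c
  proof -
    have "(\<Sum>a\<in>A. P a * (\<Prod>i<Suc n. (y(n := u)) i c ^ a i)) = (\<Sum>a\<in>B. ?mon a c * u c ^ a n)"
      unfolding B_def using AP(1) by (intro sum.mono_neutral_cong_right) auto
    also have "\<dots> = (\<Sum>a\<in>B. u c ^ m * (?mon a c * u c ^ (a n - m)))"
      by (intro sum.cong refl) (simp add: m_le flip: power_add)
    finally show ?thesis using AP(4)[OF that] by (simp add: sum_distrib_left)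
  qed
  from zirreducible_mult_zero[OF Z polyfun_power[OF u(1)] g this]
  have g0: "?g c = 0" if "c \<in> Z" for c
    using z(1) u(3) that by auto
  \<comment> \<open>On \<open>Z'\<close> only the terms that have lost all factors \<open>u\<close>
    survive. Their last exponent is constantly \<open>m\<close>, so forgetting it merges no two
    monomials and the relation stays nontrivial.\<close>
  define B' where "B' = {a \<in> B. a n = m}"
  let ?r = "\<lambda>a. restrict a {..<n}" and ?e = "\<lambda>b :: nat \<Rightarrow> nat. b(n := m)"
  have ext: "a \<in> extensional {..<Suc n}" if "a \<in> B'" for a
    using that AP(2) unfolding B'_def B_def by auto
  have er: "?e (?r a) = a" if "a \<in> B'" for a
    using that ext[OF that] unfolding B'_def by (auto simp: fun_eq_iff extensional_def restrict_def)
  have inj: "inj_on ?r B'"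
    by (rule inj_on_inverseI[of _ ?e]) (rule er)
  show "alg_dep Z' n y"
  proof (rule alg_depI)
    show "finite (?r ` B')" using finB unfolding B'_def by simp
    show "?r ` B' \<subseteq> extensional {..<n}" by auto
    show "\<exists>b\<in>?r ` B'. (P \<circ> ?e) b \<noteq> 0"
      using m_in er unfolding B'_def B_def by force
    show "(\<Sum>b\<in>?r ` B'. (P \<circ> ?e) b * (\<Prod>i<n. y i c ^ b i)) = 0" if c: "c \<in> Z'" for c
    proof -
      have "(\<Sum>b\<in>?r ` B'. (P \<circ> ?e) b * (\<Prod>i<n. y i c ^ b i)) = (\<Sum>a\<in>B'. ?mon a c)"
        unfolding sum.reindex[OF inj] o_def by (rule sum.cong[OF refl]) (simp only: er, simp)
      also have "\<dots> = ?g c"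
        unfolding B'_def using finB m_le
        by (intro sum.mono_neutral_cong_left)
          (auto simp: u(2)[OF c] power_0_left le_antisym)
      finally show ?thesis
        using g0 c Z'(2) by auto
    qed
  qed
qed

text \<open>If \<open>n\<close> exceeded \<open>d\<close>, then \<open>Suc d\<close> steps down from
  the top would lead to a set with \<open>trdeg_less _ 0\<close>; this set would be empty, hence not
  irreducible.\<close>

lemma chain_length_le:
  assumes "\<And>i. i \<le> n \<Longrightarrow> zclosed (Z i) \<and> zirreducible (Z i)"
    "\<And>i. i < n \<Longrightarrow> Z i \<subset> Z (Suc i)" "trdeg_less (Z n) (Suc d)"
  shows "n \<le> d"
proof (rule ccontr)
  assume "\<not> n \<le> d"
  have "trdeg_less (Z (n - k)) (Suc d - k)" if "k \<le> Suc d" for k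
    using that
  proof (induction k)
    case 0
    then show ?case using assms(3) by simp
  next
    case (Suc k)
    have *: "Suc (n - Suc k) = n - k" "Suc d - k = Suc (Suc d - Suc k)"
      using Suc.prems \<open>\<not> n \<le> d\<close> by auto
    show ?case
    proof (rule trdeg_less_step)
      show "zirreducible (Z (n - k))" "Z (n - k) \<subseteq> ambient"
        using assms(1)[of "n - k"] zclosed_subset_ambient by auto
      show "zclosed (Z (n - Suc k))" using assms(1) by simp
      show "Z (n - Suc k) \<subset> Z (n - k)"
        using assms(2)[of "n - Suc k"] * Suc.prems \<open>\<not> n \<le> d\<close> by simp
      show "trdeg_less (Z (n - k)) (Suc (Suc d - Suc k))" using Suc * by simp
    qed
  qed
  from trdeg_less_0[OF this[of "Suc d", simplified]]
  show False using assms(1)[of "n - Suc d"] unfolding zirreducible_def by simp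
qed

section \<open>Structure constants of binary associative superalgebras\<close>

lemma sum_lessThan_3: "(\<Sum>i<3::nat. f i) = f 0 + f 1 + f 2" for f :: "nat \<Rightarrow> 'a::comm_monoid_add"
  by (simp add: numeral_3_eq_3 numeral_2_eq_2)

lemma sum_lessThan_2: "(\<Sum>i<2::nat. f i) = f 0 + f 1" for f :: "nat \<Rightarrow> 'a::comm_monoid_add"
  by (simp add: numeral_2_eq_2)

lemma less_3_iff: "(i::nat) < 3 \<longleftrightarrow> i = 0 \<or> i = 1 \<or> i = 2"
  by auto

lemma less_2_iff: "(i::nat) < 2 \<longleftrightarrow> i = 0 \<or> i = 1"
  by auto

definition unitv :: "nat \<Rightarrow> nat \<Rightarrow> complex" where
  "unitv i = (\<lambda>j. if j = i then 1 else 0)"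

lemma homog_unitv: "i < 3 \<Longrightarrow> homog (unitv i) (deg i)"
  unfolding homog_def unitv_def by auto

lemma mult_unitv: "i < 3 \<Longrightarrow> j < 3 \<Longrightarrow> mult c (unitv i) (unitv j) = c i j"
  unfolding mult_def unitv_def less_3_iff by (auto simp: sum_lessThan_3 fun_eq_iff)

definition assoc_const :: "sconst \<Rightarrow> nat \<Rightarrow> nat \<Rightarrow> nat \<Rightarrow> nat \<Rightarrow> complex" where
  "assoc_const c i j l k = (\<Sum>m<3. c i j m * c m l k - c j l m * c i m k)"

lemma assoc_expand:
  "assoc c x y z k = (\<Sum>i<3. \<Sum>j<3. \<Sum>l<3. x i * y j * z l * assoc_const c i j l k)"
  by (simp add: assoc_def mult_def assoc_const_def sum_lessThan_3 algebra_simps)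

lemma assoc_unitv:
  assumes "i < 3" "j < 3" "l < 3"
  shows "assoc c (unitv i) (unitv j) (unitv l) = assoc_const c i j l"
proof
  fix k
  show "assoc c (unitv i) (unitv j) (unitv l) k = assoc_const c i j l k"
    using assms unfolding assoc_expand unitv_def less_3_iff sum_lessThan_3 by (elim disjE) simp_all
qed

text \<open>Associators are trilinear, and wherever a product of coordinates is nonzero the basis
  vectors involved have the degrees of \<open>x\<close>, \<open>y\<close>, \<open>z\<close>, hence
  the same signs. So basis vectors suffice, and the identities become polynomial equations.\<close>

lemma bin_assoc_iff:
  "bin_assoc c \<longleftrightarrow> (\<forall>i<3. \<forall>j<3. \<forall>l<3. \<forall>k.
     assoc_const c i j l k = - ((-1) ^ (deg j * deg l)) * assoc_const c i l j k \<and>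
     assoc_const c i j l k = - ((-1) ^ (deg i * deg j)) * assoc_const c j i l k)"
    (is "_ \<longleftrightarrow> ?R")
proof
  assume L: "bin_assoc c"
  show ?R
  proof (intro allI impI)
    fix i j l k :: nat assume i: "i < 3" and j: "j < 3" and l: "l < 3"
    show "assoc_const c i j l k = - ((-1) ^ (deg j * deg l)) * assoc_const c i l j k \<and>
     assoc_const c i j l k = - ((-1) ^ (deg i * deg j)) * assoc_const c j i l k"
      using L[unfolded bin_assoc_def, rule_format, OF homog_unitv[OF i] homog_unitv[OF j] homog_unitv[OF l]]
      unfolding assoc_unitv[OF i j l] assoc_unitv[OF i l j] assoc_unitv[OF j i l]
      by (metis (no_types))
  qed
next
  assume R: ?R
  show "bin_assoc c"
    unfolding bin_assoc_def
  proof (intro allI impI conjI ext)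
    fix x y z a b d k assume h: "homog x a" "homog y b" "homog z d"
    have supp: "x i = 0 \<or> deg i = a" "y i = 0 \<or> deg i = b" "z i = 0 \<or> deg i = d" for i
      using h unfolding homog_def by blast+
    let ?A = "assoc_const c"
    have "assoc c x y z k = (\<Sum>i<3. \<Sum>j<3. \<Sum>l<3. - ((-1) ^ (b * d)) * (x i * z l * y j * ?A i l j k))"
      unfolding assoc_expand
    proof (intro sum.cong refl)
      fix i j l :: nat assume "i \<in> {..<3}" "j \<in> {..<3}" "l \<in> {..<3}"
      then have "?A i j l k = - ((-1) ^ (deg j * deg l)) * ?A i l j k"
        using R by blast
      then show "x i * y j * z l * ?A i j l k = - ((-1) ^ (b * d)) * (x i * z l * y j * ?A i l j k)"
        using supp(2)[of j] supp(3)[of l] by auto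
    qed
    also have "\<dots> = - ((-1) ^ (b * d)) * (\<Sum>i<3. \<Sum>j<3. \<Sum>l<3. x i * z l * y j * ?A i l j k)"
      by (simp only: sum_distrib_left)
    also have "(\<Sum>i<3. \<Sum>j<3. \<Sum>l<3. x i * z l * y j * ?A i l j k) = assoc c x z y k"
      unfolding assoc_expand by (intro sum.cong refl sum.swap)
    finally show "assoc c x y z k = - ((-1) ^ (b * d)) * assoc c x z y k" .
    have "assoc c x y z k = (\<Sum>i<3. \<Sum>j<3. \<Sum>l<3. - ((-1) ^ (a * b)) * (y j * x i * z l * ?A j i l k))"
      unfolding assoc_expand
    proof (intro sum.cong refl)
      fix i j l :: nat assume "i \<in> {..<3}" "j \<in> {..<3}" "l \<in> {..<3}"
      then have "?A i j l k = - ((-1) ^ (deg i * deg j)) * ?A j i l k"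
        using R by blast
      then show "x i * y j * z l * ?A i j l k = - ((-1) ^ (a * b)) * (y j * x i * z l * ?A j i l k)"
        using supp(2)[of j] supp(1)[of i] by auto
    qed
    also have "\<dots> = - ((-1) ^ (a * b)) * (\<Sum>i<3. \<Sum>j<3. \<Sum>l<3. y j * x i * z l * ?A j i l k)"
      by (simp only: sum_distrib_left)
    also have "(\<Sum>i<3. \<Sum>j<3. \<Sum>l<3. y j * x i * z l * ?A j i l k) = assoc c y x z k"
      unfolding assoc_expand by (rule sum.swap)
    finally show "assoc c x y z k = - ((-1) ^ (a * b)) * assoc c y x z k" .
  qed
qed

lemma zclosed_BAS21: "zclosed BAS21"
proof -
  let ?f = "\<lambda>(i, j, l, k) c. assoc_const c i j l k + (-1) ^ (deg j * deg l) * assoc_const c i l j k"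
  let ?g = "\<lambda>(i, j, l, k) c. assoc_const c i j l k + (-1) ^ (deg i * deg j) * assoc_const c j i l k"
  let ?I = "{..<3} \<times> {..<3} \<times> {..<3} \<times> UNIV"
  have eq: "(x = - s * y \<longleftrightarrow> x + s * y = 0)" for x y s :: complex
    by (simp add: eq_neg_iff_add_eq_0)
  have "BAS21 = {c \<in> ambient. \<forall>f\<in>?f ` ?I \<union> ?g ` ?I. f c = 0}"
    unfolding BAS21_def bin_assoc_iff eq
    by (rule Collect_cong) (simp add: ball_Un split_paired_Ball_Sigma, blast)
  moreover have "?f ` ?I \<union> ?g ` ?I \<subseteq> polyfun"
    unfolding assoc_const_def by (auto intro!: polyfun_intros)
  ultimately show ?thesis
    unfolding zclosed_def by blast
qed

lemma BAS21_subset_ambient: "BAS21 \<subseteq> ambient"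
  unfolding BAS21_def by auto

lemma ambient_zero:
  assumes "c \<in> ambient"
  shows "c 0 0 2 = 0" "c 0 1 2 = 0" "c 1 0 2 = 0" "c 1 1 2 = 0" "c 0 2 0 = 0" "c 0 2 1 = 0"
    "c 1 2 0 = 0" "c 1 2 1 = 0" "c 2 0 0 = 0" "c 2 0 1 = 0" "c 2 1 0 = 0" "c 2 1 1 = 0" "c 2 2 2 = 0"
    "\<not> k < 3 \<Longrightarrow> c i j k = 0"
  using assms unfolding ambient_def by (fastforce simp: deg_def)+

text \<open>The grading leaves 8 + 2 + 2 + 2 = 14 coordinates, covered in this order by the last
  four premises.\<close>

lemma ambient_eqI:
  assumes c: "c \<in> ambient" and d: "d \<in> ambient"
    and eq: "\<And>i j k. i < 2 \<Longrightarrow> j < 2 \<Longrightarrow> k < 2 \<Longrightarrow> c i j k = d i j k"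
      "\<And>i. i < 2 \<Longrightarrow> c i 2 2 = d i 2 2" "\<And>i. i < 2 \<Longrightarrow> c 2 i 2 = d 2 i 2"
      "\<And>k. k < 2 \<Longrightarrow> c 2 2 k = d 2 2 k"
  shows "c = d"
proof (intro ext)
  fix i j k
  have lt: "i < 3 \<Longrightarrow> i = 2 \<or> i < 2" for i :: nat by auto
  show "c i j k = d i j k"
  proof (cases "i < 3 \<and> j < 3 \<and> k < 3 \<and> deg k = (deg i + deg j) mod 2")
    case True
    then have "i = 2 \<or> i < 2" "j = 2 \<or> j < 2" "k = 2 \<or> k < 2" and "deg k = (deg i + deg j) mod 2"
      using lt by auto
    then show ?thesis using eq by (elim disjE) (auto simp: deg_def)
  next
    case False
    then show ?thesis using c d unfolding ambient_def mem_Collect_eq by metis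
  qed
qed

text \<open>For \<open>i, j < 2\<close>, the associators alternate in at most two distinct even arguments and
  hence vanish; so the even part is associative, and \<open>e\<^sub>i f = l\<^sub>i f\<close> and \<open>f e\<^sub>i = r\<^sub>i f\<close> define
  characters \<open>l\<close> and \<open>r\<close>. With \<open>p = f f\<close> the remaining identities say \<open>x p = r(x) p\<close> and
  \<open>p x = l(x) p\<close>, with left and right exchanged in comparison to an associative bimodule.\<close>

lemma BAS21_iff:
  assumes c: "c \<in> ambient"
  shows "c \<in> BAS21 \<longleftrightarrow>
    (\<forall>i<2. \<forall>j<2. \<forall>n<2. \<forall>k<2. (\<Sum>m<2. c i j m * c m n k) = (\<Sum>m<2. c j n m * c i m k)) \<and>
    (\<forall>i<2. \<forall>j<2. (\<Sum>m<2. c i j m * c m 2 2) = c i 2 2 * c j 2 2) \<and>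
    (\<forall>i<2. \<forall>j<2. (\<Sum>m<2. c i j m * c 2 m 2) = c 2 i 2 * c 2 j 2) \<and>
    (\<forall>i<2. \<forall>k<2. (\<Sum>m<2. c 2 2 m * c i m k) = c 2 i 2 * c 2 2 k) \<and>
    (\<forall>i<2. \<forall>k<2. (\<Sum>m<2. c 2 2 m * c m i k) = c i 2 2 * c 2 2 k)"
    (is "_ \<longleftrightarrow> ?A \<and> ?L \<and> ?R \<and> ?P \<and> ?Q")
proof -
  let ?a = "assoc_const c"
  note z = ambient_zero[OF c]
  have d: "deg i = 0" if "i < 2" for i using that by (simp add: deg_def)
  have d2: "deg 2 = 1" by (simp add: deg_def)
  have eee: "?a i j n k = (\<Sum>m<2. c i j m * c m n k) - (\<Sum>m<2. c j n m * c i m k)"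
    if "i < 2" "j < 2" "n < 2" "k < 2" for i j n k
    using that z unfolding less_2_iff by (auto simp: assoc_const_def sum_lessThan_3 sum_lessThan_2)
  have eee': "?a i j n k = 0" if "i < 2" "j < 2" "n < 2" "\<not> k < 2" for i j n k
    using that z(1-13) z(14)[of k] unfolding less_2_iff
    by (cases "k < 3") (auto simp: assoc_const_def sum_lessThan_3 less_3_iff)
  have eeo: "?a i j 2 k = (if k = 2 then (\<Sum>m<2. c i j m * c m 2 2) - c i 2 2 * c j 2 2 else 0)"
    if "i < 2" "j < 2" for i j k
    using that z(1-13) z(14)[of k] unfolding less_2_iff
    by (cases "k < 3") (auto simp: assoc_const_def sum_lessThan_3 sum_lessThan_2 less_3_iff)
  \<comment> \<open>The odd part is a line, so both bracketings of
    \<open>e\<^sub>i f e\<^sub>j\<close> give \<open>l\<^sub>i r\<^sub>j f\<close>. The identities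
    then also force the associators with the odd argument in first or last place to vanish.\<close>
  have eoe: "?a i 2 j k = 0" if "i < 2" "j < 2" for i j k
    using that z(1-13) z(14)[of k] unfolding less_2_iff
    by (cases "k < 3") (auto simp: assoc_const_def sum_lessThan_3 less_3_iff)
  have oee: "?a 2 i j k = (if k = 2 then c 2 i 2 * c 2 j 2 - (\<Sum>m<2. c i j m * c 2 m 2) else 0)"
    if "i < 2" "j < 2" for i j k
    using that z(1-13) z(14)[of k] unfolding less_2_iff
    by (cases "k < 3") (auto simp: assoc_const_def sum_lessThan_3 sum_lessThan_2 less_3_iff)
  have ooe: "?a 2 2 i k = (if k < 2 then (\<Sum>m<2. c 2 2 m * c m i k) - c 2 i 2 * c 2 2 k else 0)"
    if "i < 2" for i k
    using that z(1-13) z(14)[of k] unfolding less_2_iff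
    by (cases "k < 3") (auto simp: assoc_const_def sum_lessThan_3 sum_lessThan_2 less_3_iff)
  have oeo: "?a 2 i 2 k = (if k < 2 then (c 2 i 2 - c i 2 2) * c 2 2 k else 0)"
    if "i < 2" for i k
    using that z(1-13) z(14)[of k] unfolding less_2_iff
    by (cases "k < 3") (auto simp: assoc_const_def sum_lessThan_3 less_3_iff algebra_simps)
  have eoo: "?a i 2 2 k = (if k < 2 then c i 2 2 * c 2 2 k - (\<Sum>m<2. c 2 2 m * c i m k) else 0)"
    if "i < 2" for i k
    using that z(1-13) z(14)[of k] unfolding less_2_iff
    by (cases "k < 3") (auto simp: assoc_const_def sum_lessThan_3 sum_lessThan_2 less_3_iff)
  show ?thesis
  proof
    assume "c \<in> BAS21"
    then have B: "?a i j n k = - ((-1) ^ (deg j * deg n)) * ?a i n j k"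
        "?a i j n k = - ((-1) ^ (deg i * deg j)) * ?a j i n k"
      if "i < 3" "j < 3" "n < 3" for i j n k
      using that unfolding BAS21_def bin_assoc_iff by blast+
    show "?A \<and> ?L \<and> ?R \<and> ?P \<and> ?Q"
    proof (intro conjI allI impI)
      fix i j n k :: nat assume i: "i < 2" "j < 2" "n < 2" "k < 2"
      have alt: "?a i j n k = - ?a i n j k" "?a i j n k = - ?a j i n k"
        if "i < 2" "j < 2" "n < 2" for i j n
        using B[of i j n k] that by (auto simp: d)
      have self: "x = 0" if "x = - x" for x :: complex
        using that by (simp add: eq_neg_iff_add_eq_0 flip: mult_2)
      \<comment> \<open>Three indices below 2 contain a repetition, and there the associator equals
        its own negative.\<close>
      have "?a i j j k = 0" "?a i i j k = 0" "?a i j i k = 0" if "i < 2" "j < 2" for i j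
        using alt[of i j j] alt[of i i j] alt[of i j i] that self by auto
      then have "?a i j n k = 0"
        using i unfolding less_2_iff by fastforce
      then show "(\<Sum>m<2. c i j m * c m n k) = (\<Sum>m<2. c j n m * c i m k)"
        using eee[OF i] by simp
    next
      fix i j :: nat assume i: "i < 2" "j < 2"
      show "(\<Sum>m<2. c i j m * c m 2 2) = c i 2 2 * c j 2 2"
        using B(1)[of i j 2 2] i eeo[OF i, of 2] eoe[OF i, of 2] by (auto simp: d d2)
      show "(\<Sum>m<2. c i j m * c 2 m 2) = c 2 i 2 * c 2 j 2"
        using B(2)[of 2 i j 2] i oee[OF i, of 2] eoe[OF i, of 2] by (auto simp: d d2)
    next
      fix i k :: nat assume i: "i < 2" "k < 2"
      \<comment> \<open>The identity \<open>(e\<^sub>i, f, f) = - (f, e\<^sub>i, f)\<close> reads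
        \<open>l\<^sub>i p - e\<^sub>i p = (l\<^sub>i - r\<^sub>i) p\<close>: this exchanges
        \<open>l\<close> and \<open>r\<close>. The other side is
        \<open>(f, f, e\<^sub>i) = - (f, e\<^sub>i, f)\<close>.\<close>
      show "(\<Sum>m<2. c 2 2 m * c i m k) = c 2 i 2 * c 2 2 k"
        using B(2)[of i 2 2 k] i eoo[OF i(1), of k] oeo[OF i(1), of k] by (auto simp: d d2 algebra_simps)
      show "(\<Sum>m<2. c 2 2 m * c m i k) = c i 2 2 * c 2 2 k"
        using B(1)[of 2 2 i k] i ooe[OF i(1), of k] oeo[OF i(1), of k] by (auto simp: d d2 algebra_simps)
    qed
  next
    assume C: "?A \<and> ?L \<and> ?R \<and> ?P \<and> ?Q"
    have lt: "i = 2 \<or> i < 2" if "i < 3" for i :: nat using that by auto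
    have eee0: "?a i j n k = 0" if "i < 2" "j < 2" "n < 2" for i j n k
      using that C eee eee' by (cases "k < 2") auto
    have eeo0: "?a i j 2 k = 0" "?a 2 i j k = 0" if "i < 2" "j < 2" for i j k
      using that C by (auto simp: eeo oee)
    have ooe': "?a 2 2 i k = (if k < 2 then (c i 2 2 - c 2 i 2) * c 2 2 k else 0)"
      "?a i 2 2 k = (if k < 2 then (c i 2 2 - c 2 i 2) * c 2 2 k else 0)" if "i < 2" for i k
      using that C by (auto simp: ooe eoo algebra_simps)
    \<comment> \<open>Two odd arguments are exchanged with sign +1, so the identities for (f, f, f)
      hold trivially.\<close>
    have "?a i j n k = - ((-1) ^ (deg j * deg n)) * ?a i n j k \<and>
        ?a i j n k = - ((-1) ^ (deg i * deg j)) * ?a j i n k"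
      if "i < 3" "j < 3" "n < 3" for i j n k
      using lt[OF that(1)] lt[OF that(2)] lt[OF that(3)]
      by (elim disjE) (auto simp: d d2 eee0 eeo0 eoe oeo ooe' algebra_simps)
    then show "c \<in> BAS21"
      unfolding BAS21_def bin_assoc_iff using c by blast
  qed
qed

section \<open>The group action\<close>

definition app :: "(nat \<Rightarrow> nat \<Rightarrow> complex) \<Rightarrow> (nat \<Rightarrow> complex) \<Rightarrow> nat \<Rightarrow> complex" where
  "app M x = (\<lambda>k. \<Sum>i<3. M k i * x i)"

definition mm :: "(nat \<Rightarrow> nat \<Rightarrow> complex) \<Rightarrow> (nat \<Rightarrow> nat \<Rightarrow> complex) \<Rightarrow> nat \<Rightarrow> nat \<Rightarrow> complex" where
  "mm M N = (\<lambda>i j. \<Sum>k<3. M i k * N k j)"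

definition idm :: "nat \<Rightarrow> nat \<Rightarrow> complex" where
  "idm = (\<lambda>i j. if i < 3 \<and> i = j then 1 else 0)"

definition graded :: "(nat \<Rightarrow> nat \<Rightarrow> complex) \<Rightarrow> bool" where
  "graded M \<longleftrightarrow> (\<forall>i j. M i j \<noteq> 0 \<longrightarrow> i < 3 \<and> j < 3 \<and> deg i = deg j)"

lemma mm_assoc: "mm (mm A B) C = mm A (mm B C)"
  by (simp add: mm_def sum_lessThan_3 algebra_simps)

lemma app_app: "app M (app N x) = app (mm M N) x"
  by (simp add: mm_def app_def sum_lessThan_3 algebra_simps)

lemma graded_mm:
  assumes "graded M" "graded N"
  shows "graded (mm M N)"
  unfolding graded_def
proof (intro allI impI)
  fix i j assume "mm M N i j \<noteq> 0"
  then obtain k where "M i k * N k j \<noteq> 0"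
    unfolding mm_def by (meson sum.not_neutral_contains_not_neutral)
  then show "i < 3 \<and> j < 3 \<and> deg i = deg j"
    using assms unfolding graded_def by (metis mult_eq_0_iff)
qed

lemma mm_idm: "graded M \<Longrightarrow> mm M idm = M"
  by (fastforce simp: mm_def idm_def graded_def fun_eq_iff sum_lessThan_3)

lemma graded_idm: "graded idm"
  by (simp add: graded_def idm_def)

lemma glpairs_iff: "(G, H) \<in> glpairs \<longleftrightarrow> graded G \<and> graded H \<and> mm G H = idm \<and> mm H G = idm"
proof -
  have "mm M N = idm \<longleftrightarrow> (\<forall>i<3. \<forall>j<3. (\<Sum>k<3. M i k * N k j) = (if i = j then 1 else 0))"
    if "graded M" "graded N" for M N
  proof
    assume "mm M N = idm"
    then show "\<forall>i<3. \<forall>j<3. (\<Sum>k<3. M i k * N k j) = (if i = j then 1 else 0)"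
      unfolding mm_def idm_def fun_eq_iff by simp
  next
    assume *: "\<forall>i<3. \<forall>j<3. (\<Sum>k<3. M i k * N k j) = (if i = j then 1 else 0)"
    show "mm M N = idm"
    proof (intro ext)
      fix i j
      show "mm M N i j = idm i j"
      proof (cases "i < 3 \<and> j < 3")
        case True
        then show ?thesis using * by (simp add: mm_def idm_def)
      next
        case False
        then show ?thesis
          using graded_mm[OF that] unfolding graded_def idm_def by force
      qed
    qed
  qed
  then show ?thesis
    unfolding glpairs_def graded_def by auto
qed

lemma glpairs_swap: "(G, H) \<in> glpairs \<Longrightarrow> (H, G) \<in> glpairs"
  unfolding glpairs_iff by blast

lemma glpairs_id: "(idm, idm) \<in> glpairs"
  unfolding glpairs_iff using mm_idm[OF graded_idm] graded_idm by blast

lemma glpairs_mm: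
  assumes "(G, H) \<in> glpairs" "(G', H') \<in> glpairs"
  shows "(mm G' G, mm H H') \<in> glpairs"
proof -
  have "mm (mm G' G) (mm H H') = mm (mm G' (mm G H)) H'" "mm (mm H H') (mm G' G) = mm (mm H (mm H' G')) G"
    by (simp_all add: mm_assoc)
  then show ?thesis
    using assms unfolding glpairs_iff by (auto simp: graded_mm mm_idm)
qed

lemma glpairs_scale:
  assumes "(G, H) \<in> glpairs" "s \<noteq> 0"
  shows "((\<lambda>i j. G i j / s), (\<lambda>i j. s * H i j)) \<in> glpairs"
  using assms unfolding glpairs_def by simp

lemma mult_act: "mult (act G H c) x y = app G (mult c (app H x) (app H y))"
  by (simp add: mult_def act_def app_def sum_lessThan_3 algebra_simps)

lemma graded_act_ambient:
  assumes "graded G" "graded H" "c \<in> ambient"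
  shows "act G H c \<in> ambient"
  unfolding ambient_def mem_Collect_eq
proof (intro allI impI)
  fix i j k assume "act G H c i j k \<noteq> 0"
  then obtain p q r where "H p i * H q j * c p q r * G k r \<noteq> 0"
    unfolding act_def by (meson sum.not_neutral_contains_not_neutral)
  then have "H p i \<noteq> 0" "H q j \<noteq> 0" "c p q r \<noteq> 0" "G k r \<noteq> 0" by auto
  then show "i < 3 \<and> j < 3 \<and> k < 3 \<and> deg k = (deg i + deg j) mod 2"
    using assms unfolding graded_def ambient_def by force
qed

lemma act_ambient: "(G, H) \<in> glpairs \<Longrightarrow> c \<in> ambient \<Longrightarrow> act G H c \<in> ambient"
  unfolding glpairs_iff by (intro graded_act_ambient) auto

lemma eq_iff_mult:
  assumes "c \<in> ambient" "d \<in> ambient" "\<And>x y. mult c x y = mult d x y"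
  shows "c = d"
  using assms(3) by (intro ambient_eqI assms(1,2)) (metis mult_unitv less_3_iff less_2_iff)+

lemma mult_cong:
  assumes "\<And>i. i < 3 \<Longrightarrow> x i = x' i" "\<And>i. i < 3 \<Longrightarrow> y i = y' i"
  shows "mult c x y = mult c x' y'"
  using assms unfolding mult_def by (intro ext sum.cong) auto

lemma app_idm: "i < 3 \<Longrightarrow> app idm x i = x i"
  unfolding app_def idm_def less_3_iff by (auto simp: sum_lessThan_3)

lemma act_act:
  assumes "(G, H) \<in> glpairs" "(G', H') \<in> glpairs" "c \<in> ambient"
  shows "act G' H' (act G H c) = act (mm G' G) (mm H H') c"
  using assms glpairs_mm by (intro eq_iff_mult act_ambient) (auto simp: mult_act app_app)

lemma act_idm:
  assumes "c \<in> ambient"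
  shows "act idm idm c = c"
proof (rule eq_iff_mult[OF act_ambient[OF glpairs_id assms] assms], rule ext)
  fix x y k
  have "mult c (app idm x) (app idm y) = mult c x y"
    by (rule mult_cong) (auto simp: app_idm)
  moreover have "app idm (mult c x y) k = mult c x y k"
  proof (cases "k < 3")
    case False
    then show ?thesis
      using ambient_zero(14)[OF assms] by (simp add: app_def idm_def mult_def)
  qed (rule app_idm)
  ultimately show "mult (act idm idm c) x y k = mult c x y k"
    unfolding mult_act by simp
qed

lemma act_inverse:
  assumes "(G, H) \<in> glpairs" "c \<in> ambient"
  shows "act H G (act G H c) = c"
  using act_act[OF assms(1) glpairs_swap[OF assms(1)] assms(2)] act_idm[OF assms(2)] assms(1)
  unfolding glpairs_iff by simp

lemma act_BAS21:
  assumes GH: "(G, H) \<in> glpairs" and c: "c \<in> BAS21"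
  shows "act G H c \<in> BAS21"
proof -
  have amb: "c \<in> ambient" and bin: "bin_assoc c" using c unfolding BAS21_def by auto
  have inv: "app H (app G x) i = x i" if "i < 3" for x i
    using GH that by (simp add: app_app glpairs_iff app_idm)
  have hom: "homog (app H x) d" if "homog x d" for x d
    unfolding homog_def
  proof (intro allI impI)
    fix i assume "app H x i \<noteq> 0"
    then obtain j where "H i j * x j \<noteq> 0"
      unfolding app_def by (meson sum.not_neutral_contains_not_neutral)
    then show "i < 3 \<and> deg i = d"
      using GH that unfolding glpairs_iff graded_def homog_def by (metis mult_eq_0_iff)
  qed
  have diff: "app G (x - y) = app G x - app G y" for x y
    by (auto simp: app_def algebra_simps sum_subtractf)
  have scale: "app G (\<lambda>k. s * x k) = (\<lambda>k. s * app G x k)" for s x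
    by (auto simp: app_def algebra_simps sum_distrib_left)
  have assoc: "assoc (act G H c) x y z = app G (assoc c (app H x) (app H y) (app H z))" for x y z
  proof -
    have "mult c (app H (app G u)) w = mult c u w" "mult c w (app H (app G u)) = mult c w u" for u w
      by (auto intro: mult_cong simp: inv)
    then show ?thesis
      unfolding assoc_def mult_act diff by simp
  qed
  have "bin_assoc (act G H c)"
    unfolding bin_assoc_def
  proof (intro allI impI conjI)
    fix x y z a b d assume h: "homog x a" "homog y b" "homog z d"
    note * = bin[unfolded bin_assoc_def, rule_format, OF hom[OF h(1)] hom[OF h(2)] hom[OF h(3)]]
    show "assoc (act G H c) x y z = (\<lambda>k. - ((-1) ^ (b * d)) * assoc (act G H c) x z y k)"
      unfolding assoc scale[symmetric] by (rule arg_cong[of _ _ "app G"], rule *[THEN conjunct1])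
    show "assoc (act G H c) x y z = (\<lambda>k. - ((-1) ^ (a * b)) * assoc (act G H c) y x z k)"
      unfolding assoc scale[symmetric] by (rule arg_cong[of _ _ "app G"], rule *[THEN conjunct2])
  qed
  then show ?thesis
    using act_ambient[OF GH amb] unfolding BAS21_def by simp
qed

lemma orbit_self: "c \<in> ambient \<Longrightarrow> c \<in> orbit c"
  unfolding orbit_def using act_idm glpairs_id by force

lemma orbit_eq:
  assumes "c \<in> ambient" "d \<in> orbit c"
  shows "orbit d = orbit c"
proof -
  obtain G H where GH: "(G, H) \<in> glpairs" "d = act G H c"
    using assms(2) unfolding orbit_def by blast
  have sub: "orbit (act G H c) \<subseteq> orbit c" if "c \<in> ambient" "(G, H) \<in> glpairs" for c G H
    unfolding orbit_def using act_act[OF that(2) _ that(1)] glpairs_mm[OF that(2)] by blast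
  have "orbit (act H G d) \<subseteq> orbit d"
    using sub act_ambient glpairs_swap GH assms(1) by metis
  then show ?thesis
    using sub[OF assms(1) GH(1)] act_inverse[OF GH(1) assms(1)] GH(2) by auto
qed

lemma orbit_subset_ambient: "c \<in> ambient \<Longrightarrow> orbit c \<subseteq> ambient"
  unfolding orbit_def using act_ambient by blast

lemma orbit_subset_BAS21: "c \<in> BAS21 \<Longrightarrow> orbit c \<subseteq> BAS21"
  unfolding orbit_def using act_BAS21 by blast

lemma zclosed_act_vimage:
  assumes "(G, H) \<in> glpairs" "zclosed C"
  shows "zclosed {c \<in> ambient. act G H c \<in> C}"
proof -
  obtain F where F: "F \<subseteq> polyfun" "C = {c \<in> ambient. \<forall>f\<in>F. f c = 0}"
    using assms(2) unfolding zclosed_def by blast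
  have "{c \<in> ambient. act G H c \<in> C} = {c \<in> ambient. \<forall>f\<in>(\<lambda>f c. f (act G H c)) ` F. f c = 0}"
    unfolding F(2) using act_ambient[OF assms(1)] by auto
  moreover have "(\<lambda>f c. f (act G H c)) ` F \<subseteq> polyfun"
    using F(1) by (auto intro!: polyfun_comp[OF _ polyfun_act])
  ultimately show ?thesis
    unfolding zclosed_def by blast
qed

text \<open>A group element acts by a polynomial map, so the preimage of the closure is closed; it
  contains the orbit.\<close>

lemma act_zclosure_orbit:
  assumes GH: "(G, H) \<in> glpairs" and R: "R \<in> ambient" and c: "c \<in> zclosure (orbit R)"
  shows "act G H c \<in> zclosure (orbit R)"
proof -
  have "act G H d \<in> orbit R" if "d \<in> orbit R" for d
    using orbit_eq[OF R that] GH unfolding orbit_def by blast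
  then have "orbit R \<subseteq> {c \<in> ambient. act G H c \<in> zclosure (orbit R)}"
    using orbit_subset_ambient[OF R] zclosure_superset by blast
  from zclosure_minimal[OF zclosed_act_vimage[OF GH] this]
  show ?thesis
    using zclosed_zclosure[OF orbit_subset_ambient[OF R]] c by blast
qed

section \<open>Block matrices and the polynomial parametrization of orbits\<close>

definition blk :: "complex \<Rightarrow> complex \<Rightarrow> complex \<Rightarrow> complex \<Rightarrow> complex \<Rightarrow> nat \<Rightarrow> nat \<Rightarrow> complex" where
  "blk a b c d e = (\<lambda>i j. if i = 0 \<and> j = 0 then a else if i = 0 \<and> j = 1 then b
     else if i = 1 \<and> j = 0 then c else if i = 1 \<and> j = 1 then d else if i = 2 \<and> j = 2 then e else 0)"

lemma graded_blk: "graded (blk a b c d e)"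
  unfolding graded_def blk_def deg_def by (auto split: if_splits)

lemma graded_eq_blk: "graded M \<Longrightarrow> M = blk (M 0 0) (M 0 1) (M 1 0) (M 1 1) (M 2 2)"
proof (intro ext)
  fix i j assume g: "graded M"
  show "M i j = blk (M 0 0) (M 0 1) (M 1 0) (M 1 1) (M 2 2) i j"
  proof (cases "i < 3 \<and> j < 3 \<and> deg i = deg j")
    case True
    then show ?thesis unfolding less_3_iff by (auto simp: blk_def deg_def)
  next
    case False
    then show ?thesis
      using g graded_blk[of "M 0 0" "M 0 1" "M 1 0" "M 1 1" "M 2 2"] unfolding graded_def by metis
  qed
qed

lemma mm_blk: "mm (blk a b c d e) (blk a' b' c' d' e')
    = blk (a * a' + b * c') (a * b' + b * d') (c * a' + d * c') (c * b' + d * d') (e * e')"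
  by (auto simp: fun_eq_iff mm_def sum_lessThan_3 blk_def)

lemma idm_blk: "idm = blk 1 0 0 1 1"
  by (auto simp: idm_def blk_def fun_eq_iff)

lemma blk_eq_iff: "blk a b c d e = blk a' b' c' d' e' \<longleftrightarrow> a = a' \<and> b = b' \<and> c = c' \<and> d = d' \<and> e = e'"
  (is "?L \<longleftrightarrow> ?R")
proof
  assume L: ?L
  have "blk a b c d e i j = blk a' b' c' d' e' i j" for i j using L by simp
  from this[of 0 0] this[of 0 1] this[of 1 0] this[of 1 1] this[of 2 2]
  show ?R by (simp add: blk_def)
qed simp

lemma glpairs_blk:
  assumes "a * d - b * c \<noteq> 0" "e \<noteq> 0"
  shows "(blk (d / (a * d - b * c)) (- b / (a * d - b * c)) (- c / (a * d - b * c)) (a / (a * d - b * c)) (1 / e),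
    blk a b c d e) \<in> glpairs"
proof -
  define D where "D = a * d - b * c"
  have "D \<noteq> 0" "d * a = D + b * c" using assms by (simp_all add: D_def algebra_simps)
  then show ?thesis
    unfolding glpairs_iff idm_blk mm_blk blk_eq_iff D_def[symmetric] using assms(2) graded_blk
    by (simp add: mult.commute[of c b] mult.commute[of a d] flip: add_divide_distrib diff_divide_distrib)
qed

lemma glpairs_blkE:
  assumes "(G, H) \<in> glpairs"
  obtains a b c d e where "a * d - b * c \<noteq> 0" "e \<noteq> 0" "H = blk a b c d e"
    "G = blk (d / (a * d - b * c)) (- b / (a * d - b * c)) (- c / (a * d - b * c)) (a / (a * d - b * c)) (1 / e)"
proof -
  obtain a b c d e where H: "H = blk a b c d e"
    using assms graded_eq_blk unfolding glpairs_iff by metis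
  obtain a' b' c' d' e' where G: "G = blk a' b' c' d' e'"
    using assms graded_eq_blk unfolding glpairs_iff by metis
  have eqs: "a' * a + b' * c = 1" "a' * b + b' * d = 0" "c' * a + d' * c = 0" "c' * b + d' * d = 1" "e' * e = 1"
    using assms unfolding glpairs_iff G H idm_blk mm_blk blk_eq_iff by auto
  have "(a' * d' - b' * c') * (a * d - b * c) = (a' * a + b' * c) * (c' * b + d' * d) - (a' * b + b' * d) * (c' * a + d' * c)"
    by (simp add: algebra_simps)
  then have D: "a * d - b * c \<noteq> 0" and e: "e \<noteq> 0" using eqs by auto
  have "a' * (a * d - b * c) = (a' * a + b' * c) * d - (a' * b + b' * d) * c"
    "b' * (a * d - b * c) = (a' * b + b' * d) * a - (a' * a + b' * c) * b"
    "c' * (a * d - b * c) = (c' * a + d' * c) * d - (c' * b + d' * d) * c"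
    "d' * (a * d - b * c) = (c' * b + d' * d) * a - (c' * a + d' * c) * b"
    by (simp_all add: algebra_simps)
  then have "G = blk (d / (a * d - b * c)) (- b / (a * d - b * c)) (- c / (a * d - b * c)) (a / (a * d - b * c)) (1 / e)"
    unfolding G blk_eq_iff eqs using D e eqs(5) by (simp add: eq_divide_eq eq_neg_iff_add_eq_0 add_divide_eq_iff)
  then show thesis using that D e H by blast
qed

text \<open>Scaling \<open>g\<close> by \<open>s\<close> scales the structure constants by \<open>1 / s\<close>, which absorbs the determinant
  in \<open>g = h\<inverse> = adj h / det h\<close>: the orbit has a polynomial parametrization by \<open>h\<close>.\<close>

definition par :: "sconst \<Rightarrow> (nat \<Rightarrow> complex) \<Rightarrow> sconst" where
  "par c h = act (blk (h 3 * h 4) (- h 1 * h 4) (- h 2 * h 4) (h 0 * h 4) (h 0 * h 3 - h 1 * h 2))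
     (blk (h 0) (h 1) (h 2) (h 3) (h 4)) c"

definition pdet :: "(nat \<Rightarrow> complex) \<Rightarrow> complex" where
  "pdet h = (h 0 * h 3 - h 1 * h 2) * h 4"

lemma act_scale: "act (\<lambda>i j. u * G i j) (\<lambda>i j. v * H i j) c = (\<lambda>i j k. u * v\<^sup>2 * act G H c i j k)"
  by (simp add: act_def sum_distrib_left power2_eq_square algebra_simps)

lemma blk_scale: "(\<lambda>i j. s * blk a b c d e i j) = blk (s * a) (s * b) (s * c) (s * d) (s * e)"
  by (auto simp: blk_def fun_eq_iff)

lemma orbit_eq_par: "orbit c = par c ` {h. pdet h \<noteq> 0}"
proof (intro equalityI subsetI)
  fix x assume "x \<in> orbit c"
  then obtain G H where x: "x = act G H c" and GH: "(G, H) \<in> glpairs"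
    unfolding orbit_def by blast
  from GH obtain a b c' d e where D: "a * d - b * c' \<noteq> 0" and e: "e \<noteq> 0" and H: "H = blk a b c' d e"
    and G: "G = blk (d / (a * d - b * c')) (- b / (a * d - b * c')) (- c' / (a * d - b * c')) (a / (a * d - b * c')) (1 / e)"
    by (rule glpairs_blkE)
  let ?q = "(a * d - b * c') * e"
  \<comment> \<open>At the unscaled matrix \<open>par\<close> yields \<open>?q\<close> times the
    wanted structure, and \<open>par\<close> is homogeneous of degree 4: two from the adjugate, one
    from each argument. So the matrix is scaled by a fourth root of \<open>1 / ?q\<close>.\<close>
  define t where "t = csqrt (csqrt (1 / ?q))"
  have "t ^ 4 = (t\<^sup>2)\<^sup>2" by (simp flip: power_mult)
  then have t: "t ^ 4 = 1 / ?q" unfolding t_def power2_csqrt .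
  then have "t \<noteq> 0" using D e by auto
  define h where "h = (\<lambda>i::nat. t * [a, b, c', d, e] ! i)"
  have h: "h 0 = t * a" "h 1 = t * b" "h 2 = t * c'" "h 3 = t * d" "h 4 = t * e"
    unfolding h_def by (simp_all add: numeral_2_eq_2 numeral_3_eq_3 eval_nat_numeral)
  have "par c h = act (\<lambda>i j. (t\<^sup>2 * ?q) * G i j) (\<lambda>i j. t * H i j) c"
    unfolding par_def G H blk_scale h
    by (intro arg_cong3[of _ _ _ _ _ _ act] refl)
      (use D e in \<open>simp add: blk_eq_iff power2_eq_square right_diff_distrib\<close>)
  also have "\<dots> = (\<lambda>i j k. (t\<^sup>2 * ?q * t\<^sup>2) * x i j k)"
    unfolding act_scale x ..
  also have "t\<^sup>2 * ?q * t\<^sup>2 = t ^ 4 * ?q"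
    by (simp add: power2_eq_square power4_eq_xxxx)
  finally have "par c h = x" using t D e by simp
  moreover have "pdet h \<noteq> 0"
    using D e \<open>t \<noteq> 0\<close> unfolding pdet_def h by (simp add: algebra_simps)
  ultimately show "x \<in> par c ` {h. pdet h \<noteq> 0}" by blast
next
  fix x assume "x \<in> par c ` {h. pdet h \<noteq> 0}"
  then obtain h where x: "x = par c h" and q: "pdet h \<noteq> 0" by blast
  let ?D = "h 0 * h 3 - h 1 * h 2" and ?q = "pdet h"
  let ?H = "blk (h 0) (h 1) (h 2) (h 3) (h 4)"
  let ?G = "blk (h 3 / ?D) (- h 1 / ?D) (- h 2 / ?D) (h 0 / ?D) (1 / h 4)"
  have D: "?D \<noteq> 0" "h 4 \<noteq> 0" using q unfolding pdet_def by auto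
  have gl: "((\<lambda>i j. ?G i j / ?q), (\<lambda>i j. ?q * ?H i j)) \<in> glpairs"
    by (rule glpairs_scale[OF glpairs_blk[OF D] q])
  have "x = act (\<lambda>i j. ?q * ?G i j) (\<lambda>i j. 1 * ?H i j) c"
    unfolding x par_def blk_scale using D
    by (intro arg_cong3[of _ _ _ _ _ _ act] refl) (simp_all add: blk_eq_iff pdet_def)
  also have "\<dots> = act (\<lambda>i j. (1 / ?q) * ?G i j) (\<lambda>i j. ?q * ?H i j) c"
    unfolding act_scale using q by (simp add: power2_eq_square)
  finally show "x \<in> orbit c"
    unfolding orbit_def using gl by auto
qed

lemma ppoly_blk:
  assumes "a \<in> ppoly n" "b \<in> ppoly n" "c \<in> ppoly n" "d \<in> ppoly n" "e \<in> ppoly n"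
  shows "(\<lambda>h. blk (a h) (b h) (c h) (d h) (e h) i j) \<in> ppoly n"
  unfolding blk_def using assms by (intro ppoly_intros)

lemma ppoly_par: "(\<lambda>h. par c h i j k) \<in> ppoly 5"
  unfolding par_def act_def by (intro ppoly_intros ppoly_blk) auto

lemma ppoly_pdet: "pdet \<in> ppoly 5"
  unfolding pdet_def[abs_def] by (intro ppoly_intros) auto

lemma par_ambient: "c \<in> ambient \<Longrightarrow> par c h \<in> ambient"
  unfolding par_def by (intro graded_act_ambient graded_blk)

lemma zirreducible_orbit:
  assumes "c \<in> ambient"
  shows "zirreducible (orbit c)"
proof -
  have "pdet (\<lambda>i. if i = 1 then 0 else 1) \<noteq> 0" by (simp add: pdet_def)
  from zirreducible_image[OF ppoly_par par_ambient[OF assms] ppoly_pdet this]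
  show ?thesis unfolding orbit_eq_par .
qed

text \<open>The five parameters are the entries of the block matrix: four on the even part, one on
  the odd part.\<close>

lemma trdeg_less_zclosure_orbit:
  assumes "c \<in> ambient"
  shows "trdeg_less (zclosure (orbit c)) 6"
proof -
  have "trdeg_less (orbit c) (Suc 5)"
    unfolding orbit_eq_par by (rule trdeg_less_image[OF ppoly_par])
  then show ?thesis
    using trdeg_less_zclosure orbit_subset_ambient[OF assms] by simp
qed

section \<open>Families of superalgebras\<close>

lemma all_less_2: "(\<forall>i<2. P (i::nat)) \<longleftrightarrow> P 0 \<and> P 1"
  by (auto simp: less_2_iff)

definition st :: "(nat \<Rightarrow> nat \<Rightarrow> nat \<Rightarrow> complex) \<Rightarrow> (nat \<Rightarrow> complex) \<Rightarrow> (nat \<Rightarrow> complex) \<Rightarrow> (nat \<Rightarrow> complex) \<Rightarrow> sconst" where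
  "st a l r p = (\<lambda>i j k. if i < 2 \<and> j < 2 \<and> k < 2 then a i j k
     else if i < 2 \<and> j = 2 \<and> k = 2 then l i else if i = 2 \<and> j < 2 \<and> k = 2 then r j
     else if i = 2 \<and> j = 2 \<and> k < 2 then p k else 0)"

lemma st_ambient: "st a l r p \<in> ambient"
  unfolding ambient_def st_def deg_def by (auto split: if_splits)

lemma st_simps [simp]:
  "i < 2 \<Longrightarrow> j < 2 \<Longrightarrow> k < 2 \<Longrightarrow> st a l r p i j k = a i j k"
  "i < 2 \<Longrightarrow> st a l r p i 2 2 = l i" "i < 2 \<Longrightarrow> st a l r p 2 i 2 = r i" "k < 2 \<Longrightarrow> st a l r p 2 2 k = p k"
  unfolding st_def by auto

lemma ppoly_st:
  assumes "\<And>i j k. (\<lambda>h. a h i j k) \<in> ppoly n" "\<And>i. (\<lambda>h. l h i) \<in> ppoly n"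
    "\<And>i. (\<lambda>h. r h i) \<in> ppoly n" "\<And>i. (\<lambda>h. p h i) \<in> ppoly n"
  shows "(\<lambda>h. st (a h) (l h) (r h) (p h) i j k) \<in> ppoly n"
  unfolding st_def by (intro ppoly_intros assms)

lemma ambient_eq_st:
  assumes "c \<in> ambient" "\<And>i j k. i < 2 \<Longrightarrow> j < 2 \<Longrightarrow> k < 2 \<Longrightarrow> c i j k = a i j k"
    "\<And>i. i < 2 \<Longrightarrow> c i 2 2 = l i" "\<And>i. i < 2 \<Longrightarrow> c 2 i 2 = r i" "\<And>i. i < 2 \<Longrightarrow> c 2 2 i = p i"
  shows "c = st a l r p"
  using assms by (intro ambient_eqI st_ambient) auto

lemma act_graded:
  assumes "graded G" "graded H" "c \<in> ambient"
  shows "i < 2 \<Longrightarrow> j < 2 \<Longrightarrow> k < 2 \<Longrightarrow>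
      act G H c i j k = (\<Sum>p<2. \<Sum>q<2. \<Sum>r<2. H p i * H q j * c p q r * G k r)"
    "i < 2 \<Longrightarrow> act G H c i 2 2 = (\<Sum>p<2. H p i * c p 2 2) * (H 2 2 * G 2 2)"
    "i < 2 \<Longrightarrow> act G H c 2 i 2 = (\<Sum>p<2. H p i * c 2 p 2) * (H 2 2 * G 2 2)"
    "k < 2 \<Longrightarrow> act G H c 2 2 k = (H 2 2)\<^sup>2 * (\<Sum>r<2. c 2 2 r * G k r)"
proof -
  have z: "M 2 i = 0" "M i 2 = 0" if "graded M" "i < 2" for M and i :: nat
    using that unfolding graded_def deg_def by force+
  note zs = z[OF assms(1)] z[OF assms(2)] ambient_zero[OF assms(3)]
  show "i < 2 \<Longrightarrow> j < 2 \<Longrightarrow> k < 2 \<Longrightarrow>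
      act G H c i j k = (\<Sum>p<2. \<Sum>q<2. \<Sum>r<2. H p i * H q j * c p q r * G k r)"
    by (simp add: act_def sum_lessThan_2 sum_lessThan_3 zs)
  show "i < 2 \<Longrightarrow> act G H c i 2 2 = (\<Sum>p<2. H p i * c p 2 2) * (H 2 2 * G 2 2)"
    "i < 2 \<Longrightarrow> act G H c 2 i 2 = (\<Sum>p<2. H p i * c 2 p 2) * (H 2 2 * G 2 2)"
    "k < 2 \<Longrightarrow> act G H c 2 2 k = (H 2 2)\<^sup>2 * (\<Sum>r<2. c 2 2 r * G k r)"
    by (simp_all add: act_def sum_lessThan_2 sum_lessThan_3 zs algebra_simps power2_eq_square)
qed

text \<open>The premises say that the invertible matrix \<open>blk a b c d e\<close> is a
  homomorphism from \<open>x\<close> to \<open>R\<close>; in this form no inverse has to be written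
  down. In \<open>left\<close> and \<open>right\<close> the factor \<open>e\<close> has been
  cancelled.\<close>

lemma orbitI:
  assumes x: "x \<in> ambient" and R: "R \<in> ambient" and D: "a * d - b * c \<noteq> 0" "e \<noteq> 0"
    and even: "\<And>i j n. i < 2 \<Longrightarrow> j < 2 \<Longrightarrow> n < 2 \<Longrightarrow> (\<Sum>k<2. blk a b c d e n k * x i j k)
      = (\<Sum>p<2. \<Sum>q<2. blk a b c d e p i * blk a b c d e q j * R p q n)"
    and left: "\<And>i. i < 2 \<Longrightarrow> x i 2 2 = (\<Sum>p<2. blk a b c d e p i * R p 2 2)"
    and right: "\<And>i. i < 2 \<Longrightarrow> x 2 i 2 = (\<Sum>p<2. blk a b c d e p i * R 2 p 2)"
    and odd: "\<And>n. n < 2 \<Longrightarrow> (\<Sum>k<2. blk a b c d e n k * x 2 2 k) = e\<^sup>2 * R 2 2 n"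
  shows "x \<in> orbit R"
proof -
  let ?H = "blk a b c d e"
  define G where "G = blk (d / (a * d - b * c)) (- b / (a * d - b * c)) (- c / (a * d - b * c)) (a / (a * d - b * c)) (1 / e)"
  have GH: "(G, ?H) \<in> glpairs" unfolding G_def by (rule glpairs_blk[OF D])
  then have gr: "graded G" "graded ?H" and "mm G ?H = idm"
    unfolding glpairs_iff by auto
  then have "mm G ?H k n = (if k = n then 1 else 0)" if "k < 2" "n < 2" for k n
    using that by (simp add: idm_def)
  moreover have "mm G ?H k n = (\<Sum>r<2. G k r * ?H r n)" if "n < 2" for k n
    using that by (auto simp: mm_def sum_lessThan_3 sum_lessThan_2 blk_def less_2_iff)
  ultimately have inv: "(\<Sum>r<2. G k r * ?H r n) = (if k = n then 1 else 0)" if "k < 2" "n < 2" for k n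
    using that by simp
  have solve: "(\<Sum>r<2. (\<Sum>n<2. ?H r n * y n) * G k r) = y k" if "k < 2" for k and y :: "nat \<Rightarrow> complex"
  proof -
    have "(\<Sum>r<2. (\<Sum>n<2. ?H r n * y n) * G k r) = (\<Sum>n<2. (\<Sum>r<2. G k r * ?H r n) * y n)"
      by (simp add: sum_lessThan_2 algebra_simps)
    also have "\<dots> = (\<Sum>n<2. (if k = n then 1 else 0) * y n)"
      using that by (intro sum.cong refl) (simp add: inv)
    finally show ?thesis using that by (auto simp: sum_lessThan_2 less_2_iff)
  qed
  have e: "?H 2 2 = e" "e * G 2 2 = 1" using D(2) by (simp_all add: G_def blk_def)
  have "x = act G ?H R"
  proof (rule ambient_eqI[OF x act_ambient[OF GH R]])
    fix i j k :: nat assume i: "i < 2" "j < 2" "k < 2"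
    have "act G ?H R i j k = (\<Sum>r<2. (\<Sum>p<2. \<Sum>q<2. ?H p i * ?H q j * R p q r) * G k r)"
      unfolding act_graded(1)[OF gr R i] by (simp add: sum_lessThan_2 algebra_simps)
    also have "\<dots> = (\<Sum>r<2. (\<Sum>n<2. ?H r n * x i j n) * G k r)"
      using i by (intro sum.cong refl) (simp add: even)
    finally show "x i j k = act G ?H R i j k" using solve[OF i(3)] by simp
  next
    fix i :: nat assume i: "i < 2"
    show "x i 2 2 = act G ?H R i 2 2" "x 2 i 2 = act G ?H R 2 i 2"
      unfolding act_graded(2,3)[OF gr R i] e by (simp_all add: i left right)
    have "act G ?H R 2 2 i = (\<Sum>r<2. (e\<^sup>2 * R 2 2 r) * G i r)"
      unfolding act_graded(4)[OF gr R i] e by (simp add: sum_lessThan_2 algebra_simps)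
    also have "\<dots> = (\<Sum>r<2. (\<Sum>n<2. ?H r n * x 2 2 n) * G i r)"
      using i by (intro sum.cong refl) (simp add: odd)
    finally show "x 2 2 i = act G ?H R 2 2 i" using solve[OF i] by simp
  qed
  then show ?thesis unfolding orbit_def using GH by blast
qed

text \<open>The entries of the inverse are kept as unknowns \<open>a'\<close>, ...,
  \<open>d'\<close> with the inverse relations, which keeps later computations free of fractions.
  The odd entry of the inverse does not occur at even indices and is replaced by 0.\<close>

lemma orbitE:
  assumes "x \<in> orbit R" "R \<in> ambient"
  obtains a b c d e a' b' c' d' where "a' * a + b' * c = 1" "a' * b + b' * d = 0" "c' * a + d' * c = 0"
    "c' * b + d' * d = 1" "a * a' + b * c' = 1" "a * b' + b * d' = 0" "c * a' + d * c' = 0" "c * b' + d * d' = 1"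
    "e \<noteq> 0" "a * d - b * c \<noteq> 0"
    "\<forall>i<2. \<forall>j<2. \<forall>k<2. x i j k = (\<Sum>p<2. \<Sum>q<2. \<Sum>r<2.
       blk a b c d e p i * blk a b c d e q j * R p q r * blk a' b' c' d' 0 k r)"
    "\<forall>i<2. x i 2 2 = (\<Sum>p<2. blk a b c d e p i * R p 2 2)"
    "\<forall>i<2. x 2 i 2 = (\<Sum>p<2. blk a b c d e p i * R 2 p 2)"
    "\<forall>k<2. x 2 2 k = e\<^sup>2 * (\<Sum>r<2. R 2 2 r * blk a' b' c' d' 0 k r)"
proof -
  obtain G H where x: "x = act G H R" and GH: "(G, H) \<in> glpairs"
    using assms(1) unfolding orbit_def by blast
  obtain a b c d e where D: "a * d - b * c \<noteq> 0" and e: "e \<noteq> 0" and H: "H = blk a b c d e"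
    using glpairs_blkE[OF GH] by metis
  obtain a' b' c' d' e' where G: "G = blk a' b' c' d' e'"
    using GH graded_eq_blk unfolding glpairs_iff by metis
  have eqs: "a' * a + b' * c = 1" "a' * b + b' * d = 0" "c' * a + d' * c = 0"
    "c' * b + d' * d = 1" "a * a' + b * c' = 1" "a * b' + b * d' = 0" "c * a' + d * c' = 0"
    "c * b' + d * d' = 1" and ee: "e * e' = 1"
    using GH unfolding glpairs_iff G H idm_blk mm_blk blk_eq_iff by auto
  have G': "G k r = blk a' b' c' d' 0 k r" if "k < 2" "r < 2" for k r
    using that unfolding G blk_def by auto
  note ag = act_graded[OF graded_blk[of a' b' c' d' e'] graded_blk[of a b c d e] assms(2)]
  have [simp]: "blk a b c d e 2 2 = e" "G 2 2 = e'" by (simp_all add: blk_def G)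
  show thesis
  proof (rule that[OF eqs e D]; intro allI impI)
    fix i j k :: nat assume i: "i < 2" "j < 2" "k < 2"
    show "x i j k = (\<Sum>p<2. \<Sum>q<2. \<Sum>r<2.
       blk a b c d e p i * blk a b c d e q j * R p q r * blk a' b' c' d' 0 k r)"
      unfolding x H G ag(1)[OF i] using i G'[unfolded G] by (intro sum.cong refl) simp
  next
    fix i :: nat assume i: "i < 2"
    show "x i 2 2 = (\<Sum>p<2. blk a b c d e p i * R p 2 2)" "x 2 i 2 = (\<Sum>p<2. blk a b c d e p i * R 2 p 2)"
      unfolding x H G ag(2,3)[OF i] by (simp_all add: ee flip: G)
    show "x 2 2 i = e\<^sup>2 * (\<Sum>r<2. R 2 2 r * blk a' b' c' d' 0 i r)"
      unfolding x H G ag(4)[OF i] using i G'[unfolded G]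
      by (intro arg_cong2[of _ _ _ _ "(*)"] sum.cong) simp_all
  qed
qed

definition ustr :: "(nat \<Rightarrow> complex) \<Rightarrow> (nat \<Rightarrow> complex) \<Rightarrow> (nat \<Rightarrow> complex) \<Rightarrow> sconst" where
  "ustr = st (\<lambda>i j k. if i = j \<and> j = k then 1 else 0)"

text \<open>The boolean treats the mutually opposite algebras \<open>x y = lam(x) y\<close> and
  \<open>x y = lam(y) x\<close> together. Their only characters are 0 and \<open>lam\<close>, so 0
  and 1 are the relevant values of \<open>\<epsilon>\<close> and \<open>\<delta>\<close>.\<close>

definition nstr :: "bool \<Rightarrow> (nat \<Rightarrow> complex) \<Rightarrow> complex \<Rightarrow> complex \<Rightarrow> (nat \<Rightarrow> complex) \<Rightarrow> sconst" where
  "nstr \<tau> lam \<epsilon> \<delta> = st (\<lambda>i j k. if \<tau> then (if j = k then lam i else 0) else (if i = k then lam j else 0))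
     (\<lambda>i. \<epsilon> * lam i) (\<lambda>i. \<delta> * lam i)"

text \<open>The subalgebra of even elements is spanned by \<open>x\<close> and \<open>x\<^sup>2\<close> with
  \<open>x (x - s) (x - t) = 0\<close>, \<open>x f = l f\<close>, \<open>f x = r f\<close>, \<open>f f = g (x\<^sup>2 - t x)\<close>.\<close>

definition mono_str :: "complex \<Rightarrow> complex \<Rightarrow> complex \<Rightarrow> complex \<Rightarrow> complex \<Rightarrow> sconst" where
  "mono_str s t l r g = st (\<lambda>i j k. if i = 0 \<and> j = 0 then (if k = 0 then 0 else 1)
       else if i = 1 \<and> j = 1 then (if k = 0 then - s * t * (s + t) else (s + t)\<^sup>2 - s * t)
       else (if k = 0 then - s * t else s + t))
     (\<lambda>i. l ^ Suc i) (\<lambda>i. r ^ Suc i) (\<lambda>k. if k = 0 then - g * t else g)"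

lemma R_eq:
  "R01 = ustr (\<lambda>_. 0) (\<lambda>_. 0) (\<lambda>_. 0)"
  "R03 = ustr (unitv 0) (unitv 0) (unitv 0)"
  "R04 = ustr (\<lambda>_. 0) (unitv 0) (\<lambda>_. 0)"
  "R05 = ustr (unitv 0) (\<lambda>_. 0) (\<lambda>_. 0)"
  "R07 = ustr (unitv 1) (unitv 0) (\<lambda>_. 0)"
  "R23 = nstr True (unitv 0) 0 0 (\<lambda>_. 0)"
  "R25 = nstr False (unitv 0) 0 0 (\<lambda>_. 0)"
  "R28 = nstr False (unitv 0) 1 0 (unitv 1)"
  "R30 = nstr True (unitv 0) 0 1 (unitv 1)"
  "R31 = nstr False (unitv 0) 0 1 (\<lambda>_. 0)"
  "R32 = nstr True (unitv 0) 1 0 (\<lambda>_. 0)"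
  "R33 = nstr False (unitv 0) 1 1 (\<lambda>_. 0)"
  "R36 = nstr True (unitv 0) 1 1 (\<lambda>_. 0)"
  unfolding R01_def R03_def R04_def R05_def R07_def R23_def R25_def R28_def R30_def R31_def R32_def R33_def R36_def
  by (auto simp: sc_of_def ustr_def nstr_def st_def unitv_def fun_eq_iff)

lemma str_ambient: "ustr l r p \<in> ambient" "nstr \<tau> lam \<epsilon> \<delta> p \<in> ambient" "mono_str s t l' r' g \<in> ambient"
  unfolding ustr_def nstr_def mono_str_def by (rule st_ambient)+

lemma R_BAS21: "R \<in> Rlist \<Longrightarrow> R \<in> BAS21"
  unfolding Rlist_def R_eq ustr_def nstr_def
  by (auto simp: BAS21_iff[OF st_ambient] all_less_2 sum_lessThan_2 unitv_def)

lemma Rlist_ambient: "R \<in> Rlist \<Longrightarrow> R \<in> ambient"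
  using R_BAS21 BAS21_subset_ambient by blast

lemma ex_det_1:
  fixes x y :: complex
  assumes "x \<noteq> 0 \<or> y \<noteq> 0"
  obtains u v where "x * v - y * u = 1"
proof (cases "x = 0")
  case True
  then show thesis using assms that[of 0 "- 1 / y"] by simp
next
  case False
  then show thesis using that[of "1 / x" 0] by simp
qed

lemma nstr_orbit:
  assumes "lam 0 \<noteq> 0 \<or> lam 1 \<noteq> 0"
  shows "nstr \<tau> lam \<epsilon> \<delta> (\<lambda>_. 0) \<in> orbit (nstr \<tau> (unitv 0) \<epsilon> \<delta> (\<lambda>_. 0))"
proof -
  obtain u v where "lam 0 * v - lam 1 * u = 1" using ex_det_1[OF assms] by blast
  \<comment> \<open>The matrix has rows (\<open>lam 0\<close>, \<open>lam 1\<close>) and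
    (\<open>u\<close>, \<open>v\<close>): its first coordinate function is
    \<open>lam\<close>.\<close>
  then show ?thesis
    by (intro orbitI[of _ _ "lam 0" v "lam 1" u 1] str_ambient)
      (auto simp: less_2_iff sum_lessThan_2 nstr_def blk_def unitv_def)
qed

lemma nstr_orbit_odd:
  assumes "lam 0 \<noteq> 0 \<or> lam 1 \<noteq> 0" "p 0 \<noteq> 0 \<or> p 1 \<noteq> 0" "lam 0 * p 0 + lam 1 * p 1 = 0"
  shows "nstr \<tau> lam \<epsilon> \<delta> p \<in> orbit (nstr \<tau> (unitv 0) \<epsilon> \<delta> (unitv 1))"
proof -
  obtain u v where uv: "lam 0 * v - lam 1 * u = 1" using ex_det_1[OF assms(1)] by blast
  \<comment> \<open>The matrix with rows \<open>lam\<close> and (\<open>u\<close>, \<open>v\<close>)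
    sends \<open>p\<close> to (0, \<open>u * p 0 + v * p 1\<close>), which has to be
    \<open>?e\<^sup>2\<close> times the second basis vector. It is nonzero since the matrix is
    invertible and \<open>p\<close> is nonzero.\<close>
  let ?e = "csqrt (u * p 0 + v * p 1)"
  have "u * p 0 + v * p 1 \<noteq> 0"
  proof
    assume 0: "u * p 0 + v * p 1 = 0"
    have "p 0 = (lam 0 * v - lam 1 * u) * p 0" "p 1 = (lam 0 * v - lam 1 * u) * p 1"
      unfolding uv by simp_all
    then have "p 0 = v * (lam 0 * p 0 + lam 1 * p 1) - lam 1 * (u * p 0 + v * p 1)"
      "p 1 = lam 0 * (u * p 0 + v * p 1) - u * (lam 0 * p 0 + lam 1 * p 1)"
      by (simp_all add: algebra_simps)
    then show False using 0 assms(2,3) by simp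
  qed
  then show ?thesis
    using uv assms(3)
    by (intro orbitI[of _ _ "lam 0" v "lam 1" u ?e] str_ambient)
      (auto simp: less_2_iff sum_lessThan_2 nstr_def blk_def unitv_def)
qed

lemma orbit_ambient': "orbit (ustr l r p) \<subseteq> ambient" "orbit (nstr \<tau> lam \<epsilon> \<delta> p') \<subseteq> ambient"
  using orbit_subset_ambient str_ambient by blast+

lemma nstr_zclosure: "nstr \<tau> lam \<epsilon> \<delta> (\<lambda>_. 0) \<in> zclosure (orbit (nstr \<tau> (unitv 0) \<epsilon> \<delta> (\<lambda>_. 0)))"
proof (rule dense_image[of "\<lambda>h. nstr \<tau> h \<epsilon> \<delta> (\<lambda>_. 0)" 2 "\<lambda>h. h 0" "\<lambda>_. 1"])
  fix i j k
  have "(\<lambda>h. nstr \<tau> h \<epsilon> \<delta> (\<lambda>_. 0) i j k) = (\<lambda>h. st (\<lambda>i j k. if \<tau> then (if j = k then h i else 0) else (if i = k then h j else 0))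
     (\<lambda>i. \<epsilon> * h i) (\<lambda>i. \<delta> * h i) (\<lambda>_. 0) i j k)"
    by (simp add: nstr_def)
  also have "\<dots> \<in> ppoly 2"
    unfolding st_def by (intro ppoly_intros) auto
  finally show "(\<lambda>h. nstr \<tau> h \<epsilon> \<delta> (\<lambda>_. 0) i j k) \<in> ppoly 2" .
qed (auto intro: str_ambient ppoly.intros nstr_orbit orbit_ambient'(2)[THEN subsetD])

text \<open>The pairs with \<open>lam(p) = 0\<close> form a quadric, so they cannot serve as free
  parameters. This quadric is the image of a polynomial map: \<open>p\<close> is a multiple of
  (\<open>h 0\<close>, \<open>h 1\<close>) and \<open>lam\<close> a multiple of
  (\<open>- h 1\<close>, \<open>h 0\<close>), including the cases where one of them
  vanishes.\<close>

lemma nstr_zclosure_odd: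
  assumes "lam 0 * p 0 + lam 1 * p 1 = 0"
  shows "nstr \<tau> lam \<epsilon> \<delta> p \<in> zclosure (orbit (nstr \<tau> (unitv 0) \<epsilon> \<delta> (unitv 1)))"
proof -
  let ?lam = "\<lambda>(h :: nat \<Rightarrow> complex) i. if i = 0 then - h 2 * h 1 else h 2 * h 0" and ?p = "\<lambda>(h :: nat \<Rightarrow> complex) i. if i = 0 then h 3 * h 0 else h 3 * h 1"
  let ?\<Phi> = "\<lambda>h. nstr \<tau> (?lam h) \<epsilon> \<delta> (?p h)"
  have dense: "?\<Phi> h \<in> zclosure (orbit (nstr \<tau> (unitv 0) \<epsilon> \<delta> (unitv 1)))" for h
  proof (rule dense_image[of ?\<Phi> 4 "\<lambda>h. h 0 * h 2 * h 3" "\<lambda>_. 1"])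
    show "(\<lambda>h. ?\<Phi> h i j k) \<in> ppoly 4" for i j k
      unfolding nstr_def by (intro ppoly_st ppoly_intros) auto
    show "(\<lambda>h. h 0 * h 2 * h 3) \<in> ppoly 4"
      by (intro ppoly_intros) auto
    show "?\<Phi> h \<in> orbit (nstr \<tau> (unitv 0) \<epsilon> \<delta> (unitv 1))" if "h 0 * h 2 * h 3 \<noteq> 0" for h
      using that by (intro nstr_orbit_odd) auto
  qed (auto intro: str_ambient orbit_ambient'(2)[THEN subsetD])
  have cong: "nstr \<tau> lam \<epsilon> \<delta> p = ?\<Phi> h"
    if "lam 0 = - h 2 * h 1" "lam 1 = h 2 * h 0" "p 0 = h 3 * h 0" "p 1 = h 3 * h 1" for h
    using that by (intro ambient_eqI str_ambient) (auto simp: nstr_def less_2_iff)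
  have "\<exists>h. lam 0 = - h 2 * h 1 \<and> lam 1 = h 2 * h 0 \<and> p 0 = h 3 * h 0 \<and> p 1 = h 3 * h (1::nat)"
  proof -
    have [simp]: "([u, v, w, z] ! 3) = z" for u v w z :: complex by (simp add: numeral_3_eq_3)
    have "lam 1 = - lam 0 * p 0 / p 1" if "p 1 \<noteq> 0"
      using assms that by (simp add: field_simps) (metis add.commute add_eq_0_iff2)
    moreover have "lam 0 = - lam 1 * p 1 / p 0" if "p 0 \<noteq> 0"
      using assms that by (simp add: field_simps eq_neg_iff_add_eq_0)
    ultimately consider "p 0 = 0" "p 1 = 0" | "p 0 \<noteq> 0" "lam 0 = - lam 1 * p 1 / p 0"
      | "p 1 \<noteq> 0" "lam 1 = - lam 0 * p 0 / p 1" by blast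
    then show ?thesis
    proof cases
      case 1
      then show ?thesis by (intro exI[of _ "\<lambda>i. [lam 1, - lam 0, 1, 0] ! i"]) simp
    next
      case 2
      then show ?thesis by (intro exI[of _ "\<lambda>i. [p 0, p 1, lam 1 / p 0, 1] ! i"]) simp
    next
      case 3
      then show ?thesis by (intro exI[of _ "\<lambda>i. [p 0, p 1, - lam 0 / p 1, 1] ! i"]) simp
    qed
  qed
  then show ?thesis using dense cong by metis
qed

lemma mono_str_orbit:
  assumes "s * t * (s - t) \<noteq> 0"
  shows "mono_str s t 0 0 0 \<in> orbit R01" "mono_str s t 0 s 0 \<in> orbit R04"
    "mono_str s t s 0 0 \<in> orbit R05" "mono_str s t t s 0 \<in> orbit R07"
    "g \<noteq> 0 \<Longrightarrow> mono_str s t s s g \<in> orbit R03"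
proof -
  \<comment> \<open>The two characters x -> s and x -> t map the even part to C x C; on the basis x,
    x^2 they form the matrix with rows (s, s^2) and (t, t^2), of determinant
    \<open>s * t * (t - s)\<close>.\<close>
  have D: "s * t\<^sup>2 - s\<^sup>2 * t \<noteq> 0" using assms by (auto simp: power2_eq_square)
  have 0: "1 \<noteq> (0::complex)" by simp
  note I = orbitI[OF str_ambient(3) str_ambient(1) D 0]
  show "mono_str s t 0 0 0 \<in> orbit R01" "mono_str s t 0 s 0 \<in> orbit R04"
    "mono_str s t s 0 0 \<in> orbit R05" "mono_str s t t s 0 \<in> orbit R07"
    unfolding R_eq
    by (rule I; auto simp: less_2_iff sum_lessThan_2 mono_str_def ustr_def blk_def unitv_def
        power2_eq_square algebra_simps)+
  show "mono_str s t s s g \<in> orbit R03" if "g \<noteq> 0"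
  proof -
    \<comment> \<open>The character x -> s takes \<open>f f = g (x\<^sup>2 - t x)\<close> to
      \<open>g * s * (s - t)\<close>, and x -> t takes it to 0.\<close>
    obtain e where e2: "e * e = g * s * (s - t)"
      using power2_csqrt unfolding power2_eq_square by blast
    then have e: "e \<noteq> 0" using assms that by auto
    show ?thesis
      unfolding R_eq
      by (rule orbitI[OF str_ambient(3) str_ambient(1) D e])
        (auto simp: less_2_iff sum_lessThan_2 mono_str_def ustr_def blk_def unitv_def
          power2_eq_square e2 algebra_simps)
  qed
qed

lemma mono_str_zclosure:
  "mono_str s t 0 0 0 \<in> zclosure (orbit R01)" "mono_str s t 0 s 0 \<in> zclosure (orbit R04)"
  "mono_str s t s 0 0 \<in> zclosure (orbit R05)" "mono_str s t t s 0 \<in> zclosure (orbit R07)"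
  "mono_str s t s s g \<in> zclosure (orbit R03)"
proof -
  let ?h = "\<lambda>i::nat. if i = 0 then s else if i = 1 then t else g"
  have dense: "mono_str (h 0) (h 1) (l h) (r h) (g h) \<in> zclosure (orbit R)"
    if R: "R \<in> Rlist" and "l \<in> ppoly 3" "r \<in> ppoly 3" "g \<in> ppoly 3"
      and "\<And>h. h 0 * h 1 * (h 0 - h 1) * h 2 \<noteq> 0 \<Longrightarrow> mono_str (h 0) (h 1) (l h) (r h) (g h) \<in> orbit R"
    for R l r g h
  \<comment> \<open>The point \<open>of_nat i + 1\<close> has the parameters 1, 2, 3, at which the
    polynomial is nonzero.\<close>
  proof (rule dense_image[of "\<lambda>h. mono_str (h 0) (h 1) (l h) (r h) (g h)" 3 "\<lambda>h. h 0 * h 1 * (h 0 - h 1) * h 2" "\<lambda>i. of_nat i + 1"])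
    show "(\<lambda>h. mono_str (h 0) (h 1) (l h) (r h) (g h) i j k) \<in> ppoly 3" for i j k
      unfolding mono_str_def by (intro ppoly_st ppoly_intros that) auto
    show "(\<lambda>h. h 0 * h 1 * (h 0 - h 1) * h 2) \<in> ppoly 3"
      by (intro ppoly_intros) auto
  qed (use that orbit_subset_ambient[OF Rlist_ambient[OF R]] in \<open>auto intro: str_ambient\<close>)
  have v: "(\<lambda>h. h 0) \<in> ppoly 3" "(\<lambda>h. h 1) \<in> ppoly 3" "(\<lambda>h. h 2) \<in> ppoly 3"
    by (auto intro: ppoly.intros)
  note z = ppoly.const[of 0 3]
  show "mono_str s t 0 0 0 \<in> zclosure (orbit R01)"
    using dense[OF _ z z z, of R01 ?h] mono_str_orbit(1) by (simp add: Rlist_def)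
  show "mono_str s t 0 s 0 \<in> zclosure (orbit R04)"
    using dense[OF _ z v(1) z, of R04 ?h] mono_str_orbit(2) by (simp add: Rlist_def)
  show "mono_str s t s 0 0 \<in> zclosure (orbit R05)"
    using dense[OF _ v(1) z z, of R05 ?h] mono_str_orbit(3) by (simp add: Rlist_def)
  show "mono_str s t t s 0 \<in> zclosure (orbit R07)"
    using dense[OF _ v(2) v(1) z, of R07 ?h] mono_str_orbit(4) by (simp add: Rlist_def)
  show "mono_str s t s s g \<in> zclosure (orbit R03)"
    using dense[OF _ v(1) v(1) v(3), of R03 ?h] mono_str_orbit(5) by (simp add: Rlist_def)
qed

section \<open>Separating the orbits\<close>

text \<open>Trace of left multiplication by the \<open>i\<close>-th basis vector on the even
  part.\<close>

definition trd :: "sconst \<Rightarrow> nat \<Rightarrow> complex" where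
  "trd x i = (\<Sum>k<2. x i k k)"

definition trform :: "sconst \<Rightarrow> nat \<Rightarrow> nat \<Rightarrow> complex" where
  "trform x i j = (\<Sum>k<2. x i j k * trd x k)"

text \<open>Discriminant of the trace form. For an associative even part it is nonzero exactly when
  that part is C x C.\<close>

definition disc :: "sconst \<Rightarrow> complex" where
  "disc x = trform x 0 0 * trform x 1 1 - trform x 0 1 * trform x 1 0"

lemma disc_orbit:
  assumes "y \<in> orbit x" "x \<in> ambient"
  shows "\<exists>D. D \<noteq> 0 \<and> disc y = D\<^sup>2 * disc x"
proof -
  obtain a b c d e a' b' c' d' where eqs: "a * a' + b * c' = 1" "a * b' + b * d' = 0"
      "c * a' + d * c' = 0" "c * b' + d * d' = 1" and D: "a * d - b * c \<noteq> 0"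
    and y: "\<forall>i<2. \<forall>j<2. \<forall>k<2. y i j k = (\<Sum>p<2. \<Sum>q<2. \<Sum>r<2.
       blk a b c d e p i * blk a b c d e q j * x p q r * blk a' b' c' d' 0 k r)"
    by (rule orbitE[OF assms]) (rule that; assumption)
  define H G where "H = blk a b c d e" and "G = blk a' b' c' d' 0"
  have HG: "(\<Sum>k<2. H q k * G k r) = (if q = r then 1 else 0)" if "q < 2" "r < 2" for q r
    using that eqs by (auto simp: H_def G_def blk_def sum_lessThan_2 less_2_iff)
  have tr: "trd y i = (\<Sum>p<2. H p i * trd x p)" if "i < 2" for i
  proof -
    have "trd y i = (\<Sum>p<2. \<Sum>q<2. \<Sum>r<2. H p i * x p q r * (\<Sum>k<2. H q k * G k r))"
      unfolding trd_def using that by (simp add: y flip: H_def G_def) (simp add: sum_lessThan_2 algebra_simps)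
    also have "\<dots> = (\<Sum>p<2. \<Sum>q<2. \<Sum>r<2. H p i * x p q r * (if q = r then 1 else 0))"
      by (intro sum.cong refl) (simp add: HG)
    finally show ?thesis by (simp add: trd_def sum_lessThan_2 algebra_simps)
  qed
  have Gtr: "(\<Sum>k<2. G k r * trd y k) = trd x r" if "r < 2" for r
  proof -
    have "(\<Sum>k<2. G k r * trd y k) = (\<Sum>p<2. (\<Sum>k<2. H p k * G k r) * trd x p)"
      by (simp add: tr sum_lessThan_2 algebra_simps)
    also have "\<dots> = (\<Sum>p<2. (if p = r then 1 else 0) * trd x p)"
      using that by (intro sum.cong refl) (simp add: HG)
    finally show ?thesis using that by (auto simp: sum_lessThan_2 less_2_iff)
  qed
  have form: "trform y i j = (\<Sum>p<2. \<Sum>q<2. H p i * H q j * trform x p q)" if "i < 2" "j < 2" for i j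
  proof -
    have "trform y i j = (\<Sum>p<2. \<Sum>q<2. \<Sum>r<2. H p i * H q j * x p q r * (\<Sum>k<2. G k r * trd y k))"
      unfolding trform_def using that by (simp add: y flip: H_def G_def) (simp add: sum_lessThan_2 algebra_simps)
    also have "\<dots> = (\<Sum>p<2. \<Sum>q<2. \<Sum>r<2. H p i * H q j * x p q r * trd x r)"
      by (intro sum.cong refl) (simp add: Gtr)
    finally show ?thesis by (simp add: trform_def sum_lessThan_2 algebra_simps)
  qed
  have "disc y = (H 0 0 * H 1 1 - H 0 1 * H 1 0)\<^sup>2 * disc x"
    by (simp add: disc_def form sum_lessThan_2 power2_eq_square algebra_simps)
  then show ?thesis
    using D by (intro exI[of _ "a * d - b * c"]) (simp add: H_def blk_def)
qed

text \<open>The equations pass to the closure and separate orbits. The two nonvanishing statements,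
  from \<open>lam \<noteq> 0\<close> and \<open>f f \<noteq> 0\<close>, need not; they separate the
  orbit from degenerate members of its family.\<close>

lemma nstr_orbitD:
  assumes "y \<in> orbit (nstr \<tau> (unitv 0) \<epsilon> \<delta> p)"
  shows "y (if \<tau> then 0 else 1) (if \<tau> then 1 else 0) 1 = y 0 0 0"
    "y 0 2 2 = \<epsilon> * y 0 0 0" "y 2 0 2 = \<delta> * y 0 0 0" "y 0 0 0 \<noteq> 0 \<or> y 1 1 1 \<noteq> 0"
    "p 1 \<noteq> 0 \<Longrightarrow> p 0 = 0 \<Longrightarrow> y 2 2 0 \<noteq> 0 \<or> y 2 2 1 \<noteq> 0"
proof -
  obtain a b c d e a' b' c' d' where eqs: "a' * a + b' * c = 1" "a' * b + b' * d = 0" "c' * a + d' * c = 0"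
    "c' * b + d' * d = 1" "c * b' + d * d' = 1" and D: "a * d - b * c \<noteq> 0" "e \<noteq> 0"
    and y: "\<forall>i<2. \<forall>j<2. \<forall>k<2. y i j k = (\<Sum>p'<2. \<Sum>q<2. \<Sum>r<2.
       blk a b c d e p' i * blk a b c d e q j * nstr \<tau> (unitv 0) \<epsilon> \<delta> p p' q r * blk a' b' c' d' 0 k r)"
    "\<forall>i<2. y i 2 2 = (\<Sum>p'<2. blk a b c d e p' i * nstr \<tau> (unitv 0) \<epsilon> \<delta> p p' 2 2)"
    "\<forall>i<2. y 2 i 2 = (\<Sum>p'<2. blk a b c d e p' i * nstr \<tau> (unitv 0) \<epsilon> \<delta> p 2 p' 2)"
    "\<forall>k<2. y 2 2 k = e\<^sup>2 * (\<Sum>r<2. nstr \<tau> (unitv 0) \<epsilon> \<delta> p 2 2 r * blk a' b' c' d' 0 k r)"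
    by (rule orbitE[OF assms str_ambient(2)]) (rule that; assumption)
  have v: "y 0 0 0 = a * (a' * a + b' * c)" "y 1 1 1 = b * (c' * b + d' * d)"
    "y (if \<tau> then 0 else 1) (if \<tau> then 1 else 0) 1 = a * (c' * b + d' * d)"
    by (simp_all add: y sum_lessThan_2 nstr_def unitv_def blk_def algebra_simps)
  then show "y (if \<tau> then 0 else 1) (if \<tau> then 1 else 0) 1 = y 0 0 0"
    unfolding eqs by simp
  show "y 0 2 2 = \<epsilon> * y 0 0 0" "y 2 0 2 = \<delta> * y 0 0 0"
    unfolding v eqs by (simp_all add: y sum_lessThan_2 nstr_def unitv_def blk_def)
  show "y 0 0 0 \<noteq> 0 \<or> y 1 1 1 \<noteq> 0"
    unfolding v eqs using D by auto
  show "y 2 2 0 \<noteq> 0 \<or> y 2 2 1 \<noteq> 0" if "p 1 \<noteq> 0" "p 0 = 0"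
    using that D eqs(5) by (auto simp: y sum_lessThan_2 nstr_def unitv_def blk_def)
qed

text \<open>The quadratic relations are characteristic equations: the value of \<open>l\<close> or
  \<open>r\<close> at z = e1 + e2 is an eigenvalue of left multiplication by z, whose trace and
  determinant are written out. If \<open>l\<close> and \<open>r\<close> are the two coordinate
  characters, they add up to the trace.\<close>

lemma ustr_orbitD:
  assumes "y \<in> orbit (ustr l r p)"
  shows "y 0 1 1 = y 1 0 1"
    "l = (\<lambda>_. 0) \<Longrightarrow> y 0 2 2 = 0" "r = (\<lambda>_. 0) \<Longrightarrow> y 2 0 2 = 0" "l = (\<lambda>_. 0) \<Longrightarrow> y 1 2 2 = 0"
    "l = r \<Longrightarrow> y 0 2 2 = y 2 0 2" "l = r \<Longrightarrow> y 1 2 2 = y 2 1 2"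
    "l = unitv 1 \<Longrightarrow> r = unitv 0 \<Longrightarrow> y 1 2 2 + y 2 1 2 = trd y 1"
    "l = unitv 0 \<Longrightarrow> (y 0 2 2 + y 1 2 2)\<^sup>2 - (trd y 0 + trd y 1) * (y 0 2 2 + y 1 2 2)
      + (y 0 0 0 + y 1 0 0) * (y 0 1 1 + y 1 1 1) - (y 0 0 1 + y 1 0 1) * (y 0 1 0 + y 1 1 0) = 0"
    "r = unitv 0 \<Longrightarrow> (y 2 0 2 + y 2 1 2)\<^sup>2 - (trd y 0 + trd y 1) * (y 2 0 2 + y 2 1 2)
      + (y 0 0 0 + y 1 0 0) * (y 0 1 1 + y 1 1 1) - (y 0 0 1 + y 1 0 1) * (y 0 1 0 + y 1 1 0) = 0"
    "p = unitv 0 \<Longrightarrow> y 2 2 0 \<noteq> 0 \<or> y 2 2 1 \<noteq> 0"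
proof -
  obtain a b c d e a' b' c' d' where eqs: "a' * a + b' * c = 1" "a' * b + b' * d = 0" "c' * a + d' * c = 0"
    "c' * b + d' * d = 1" "a * a' + b * c' = 1" "c * b' + d * d' = 1" and D: "e \<noteq> 0"
    and y: "\<forall>i<2. \<forall>j<2. \<forall>k<2. y i j k = (\<Sum>p'<2. \<Sum>q<2. \<Sum>r'<2.
       blk a b c d e p' i * blk a b c d e q j * ustr l r p p' q r' * blk a' b' c' d' 0 k r')"
    "\<forall>i<2. y i 2 2 = (\<Sum>p'<2. blk a b c d e p' i * ustr l r p p' 2 2)"
    "\<forall>i<2. y 2 i 2 = (\<Sum>p'<2. blk a b c d e p' i * ustr l r p 2 p' 2)"
    "\<forall>k<2. y 2 2 k = e\<^sup>2 * (\<Sum>r'<2. ustr l r p 2 2 r' * blk a' b' c' d' 0 k r')"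
    by (rule orbitE[OF assms str_ambient(1)]) (rule that; assumption)
  have ev: "y 0 0 0 = a * a * a' + c * c * b'" "y 0 0 1 = a * a * c' + c * c * d'"
    "y 0 1 0 = a * b * a' + c * d * b'" "y 0 1 1 = a * b * c' + c * d * d'"
    "y 1 0 0 = a * b * a' + c * d * b'" "y 1 0 1 = a * b * c' + c * d * d'"
    "y 1 1 0 = b * b * a' + d * d * b'" "y 1 1 1 = b * b * c' + d * d * d'"
    by (simp_all add: y(1) sum_lessThan_2 ustr_def blk_def)
  have lr: "y 0 2 2 = a * l 0 + c * l 1" "y 1 2 2 = b * l 0 + d * l 1"
    "y 2 0 2 = a * r 0 + c * r 1" "y 2 1 2 = b * r 0 + d * r 1"
    by (simp_all add: y(2,3) sum_lessThan_2 ustr_def blk_def)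
  show "y 0 1 1 = y 1 0 1" unfolding ev by simp
  show "l = (\<lambda>_. 0) \<Longrightarrow> y 0 2 2 = 0" "r = (\<lambda>_. 0) \<Longrightarrow> y 2 0 2 = 0"
    "l = (\<lambda>_. 0) \<Longrightarrow> y 1 2 2 = 0"
    "l = r \<Longrightarrow> y 0 2 2 = y 2 0 2" "l = r \<Longrightarrow> y 1 2 2 = y 2 1 2"
    unfolding lr by simp_all
  have "trd y 0 = a * (a * a' + b * c') + c * (c * b' + d * d')"
    "trd y 1 = b * (a * a' + b * c') + d * (c * b' + d * d')"
    by (simp_all add: trd_def sum_lessThan_2 ev[unfolded One_nat_def] algebra_simps)
  then have tr: "trd y 0 = a + c" "trd y 1 = b + d" unfolding eqs by simp_all
  show "l = unitv 1 \<Longrightarrow> r = unitv 0 \<Longrightarrow> y 1 2 2 + y 2 1 2 = trd y 1"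
    unfolding lr tr by (simp add: unitv_def)
  have "(y 0 0 0 + y 1 0 0) * (y 0 1 1 + y 1 1 1) - (y 0 0 1 + y 1 0 1) * (y 0 1 0 + y 1 1 0)
      = (a + b) * (c + d) * ((a' * a + b' * c) * (c' * b + d' * d) - (a' * b + b' * d) * (c' * a + d' * c))"
    unfolding ev by (simp add: algebra_simps)
  then have dt: "(y 0 0 0 + y 1 0 0) * (y 0 1 1 + y 1 1 1) - (y 0 0 1 + y 1 0 1) * (y 0 1 0 + y 1 1 0)
      = (a + b) * (c + d)"
    unfolding eqs by simp
  show "l = unitv 0 \<Longrightarrow> (y 0 2 2 + y 1 2 2)\<^sup>2 - (trd y 0 + trd y 1) * (y 0 2 2 + y 1 2 2)
      + (y 0 0 0 + y 1 0 0) * (y 0 1 1 + y 1 1 1) - (y 0 0 1 + y 1 0 1) * (y 0 1 0 + y 1 1 0) = 0"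
    "r = unitv 0 \<Longrightarrow> (y 2 0 2 + y 2 1 2)\<^sup>2 - (trd y 0 + trd y 1) * (y 2 0 2 + y 2 1 2)
      + (y 0 0 0 + y 1 0 0) * (y 0 1 1 + y 1 1 1) - (y 0 0 1 + y 1 0 1) * (y 0 1 0 + y 1 1 0) = 0"
    unfolding add_diff_eq[symmetric] dt lr tr by (simp_all add: unitv_def power2_eq_square algebra_simps)
  show "p = unitv 0 \<Longrightarrow> y 2 2 0 \<noteq> 0 \<or> y 2 2 1 \<noteq> 0"
    using D eqs(5) by (auto simp: y sum_lessThan_2 ustr_def unitv_def blk_def)
qed

lemma polyfun_eq_zclosure:
  assumes "f \<in> polyfun" "g \<in> polyfun" "R \<in> ambient" "\<And>y. y \<in> orbit R \<Longrightarrow> f y = g y" "y \<in> zclosure (orbit R)"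
  shows "f y = g y"
  using polyfun_zero_zclosure[OF polyfun_diff[OF assms(1,2)] orbit_subset_ambient[OF assms(3)] _ assms(5)]
    assms(4) by simp

lemma nstr_zclosureD:
  assumes "y \<in> zclosure (orbit (nstr \<tau> (unitv 0) \<epsilon> \<delta> p))"
  shows "y (if \<tau> then 0 else 1) (if \<tau> then 1 else 0) 1 = y 0 0 0"
    "y 0 2 2 = \<epsilon> * y 0 0 0" "y 2 0 2 = \<delta> * y 0 0 0"
  by (rule polyfun_eq_zclosure[OF _ _ str_ambient(2) _ assms]; (intro polyfun_intros)?; erule nstr_orbitD)+

lemma ustr_zclosureD:
  assumes "y \<in> zclosure (orbit (ustr l r p))"
  shows "y 0 1 1 = y 1 0 1" "l = (\<lambda>_. 0) \<Longrightarrow> y 0 2 2 = 0" "r = (\<lambda>_. 0) \<Longrightarrow> y 2 0 2 = 0"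
    "l = (\<lambda>_. 0) \<Longrightarrow> y 1 2 2 = 0" "l = r \<Longrightarrow> y 0 2 2 = y 2 0 2"
    "l = r \<Longrightarrow> y 1 2 2 = y 2 1 2"
    "l = unitv 1 \<Longrightarrow> r = unitv 0 \<Longrightarrow> y 1 2 2 + y 2 1 2 = trd y 1"
    "l = unitv 0 \<Longrightarrow> (y 0 2 2 + y 1 2 2)\<^sup>2 - (trd y 0 + trd y 1) * (y 0 2 2 + y 1 2 2)
      + (y 0 0 0 + y 1 0 0) * (y 0 1 1 + y 1 1 1) - (y 0 0 1 + y 1 0 1) * (y 0 1 0 + y 1 1 0) = 0"
    "r = unitv 0 \<Longrightarrow> (y 2 0 2 + y 2 1 2)\<^sup>2 - (trd y 0 + trd y 1) * (y 2 0 2 + y 2 1 2)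
      + (y 0 0 0 + y 1 0 0) * (y 0 1 1 + y 1 1 1) - (y 0 0 1 + y 1 0 1) * (y 0 1 0 + y 1 1 0) = 0"
proof -
  have tr: "(\<lambda>y. trd y i) \<in> polyfun" for i
    unfolding trd_def by (intro polyfun_intros)
  note E = polyfun_eq_zclosure[OF _ _ str_ambient(1) _ assms]
  show "y 0 1 1 = y 1 0 1" by (rule E; (intro polyfun_intros)?) (erule ustr_orbitD)
  show "y 0 2 2 = 0" if "l = (\<lambda>_. 0)" by (rule E; (intro polyfun_intros)?) (erule ustr_orbitD, rule that)
  show "y 1 2 2 = 0" if "l = (\<lambda>_. 0)" by (rule E; (intro polyfun_intros)?) (erule ustr_orbitD, rule that)
  show "y 2 0 2 = 0" if "r = (\<lambda>_. 0)" by (rule E; (intro polyfun_intros)?) (erule ustr_orbitD, rule that)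
  show "y 0 2 2 = y 2 0 2" if "l = r" by (rule E; (intro polyfun_intros)?) (erule ustr_orbitD, rule that)
  show "y 1 2 2 = y 2 1 2" if "l = r" by (rule E; (intro polyfun_intros)?) (erule ustr_orbitD, rule that)
  show "y 1 2 2 + y 2 1 2 = trd y 1" if "l = unitv 1" "r = unitv 0"
    by (rule E; (intro polyfun_intros tr)?) (erule ustr_orbitD, (rule that)+)
  show "(y 0 2 2 + y 1 2 2)\<^sup>2 - (trd y 0 + trd y 1) * (y 0 2 2 + y 1 2 2)
      + (y 0 0 0 + y 1 0 0) * (y 0 1 1 + y 1 1 1) - (y 0 0 1 + y 1 0 1) * (y 0 1 0 + y 1 1 0) = 0" if "l = unitv 0"
    by (rule E; (intro polyfun_intros tr)?) (erule ustr_orbitD, rule that)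
  show "(y 2 0 2 + y 2 1 2)\<^sup>2 - (trd y 0 + trd y 1) * (y 2 0 2 + y 2 1 2)
      + (y 0 0 0 + y 1 0 0) * (y 0 1 1 + y 1 1 1) - (y 0 0 1 + y 1 0 1) * (y 0 1 0 + y 1 1 0) = 0" if "r = unitv 0"
    by (rule E; (intro polyfun_intros tr)?) (erule ustr_orbitD, rule that)
qed

text \<open>Five coordinates that already tell the thirteen structures apart.\<close>

definition tag :: "sconst \<Rightarrow> complex list" where
  "tag x = [x 0 1 1, x 1 0 1, x 0 2 2, x 1 2 2, x 2 0 2]"

lemma R_values:
  shows "R \<in> {R01, R03, R04, R05, R07} \<Longrightarrow> R 0 0 0 = 1 \<and> R 0 0 1 = 0 \<and> R 0 1 0 = 0 \<and> R 0 1 1 = 0 \<and> R 1 0 0 = 0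
      \<and> R 1 0 1 = 0 \<and> R 1 1 0 = 0 \<and> R 1 1 1 = 1 \<and> R 2 1 2 = 0"
    and "R \<in> {R23, R25, R28, R30, R31, R32, R33, R36} \<Longrightarrow> R 0 0 0 = 1 \<and> R 0 1 1 \<noteq> R 1 0 1"
  by (auto simp: R_eq ustr_def nstr_def unitv_def)

lemma tag_R:
  "tag R01 = [0, 0, 0, 0, 0]" "tag R03 = [0, 0, 1, 0, 1]" "tag R04 = [0, 0, 0, 0, 1]" "tag R05 = [0, 0, 1, 0, 0]"
  "tag R07 = [0, 0, 0, 1, 1]" "tag R23 = [1, 0, 0, 0, 0]" "tag R25 = [0, 1, 0, 0, 0]" "tag R28 = [0, 1, 1, 0, 0]"
  "tag R30 = [1, 0, 0, 0, 1]" "tag R31 = [0, 1, 0, 0, 1]" "tag R32 = [1, 0, 1, 0, 0]" "tag R33 = [0, 1, 1, 0, 1]"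
  "tag R36 = [1, 0, 1, 0, 1]"
  by (simp_all add: tag_def R_eq ustr_def nstr_def unitv_def)

lemma card_tag_Rlist: "card (tag ` Rlist) = 13"
  unfolding Rlist_def image_insert tag_R by simp

lemma finite_Rlist: "finite Rlist"
  unfolding Rlist_def by simp

lemma card_Rlist: "card Rlist = 13"
proof (rule antisym)
  show "card Rlist \<le> 13"
    unfolding Rlist_def by (intro order_trans[OF card_insert_le_m1]) auto
  show "13 \<le> card Rlist"
    using card_image_le[OF finite_Rlist, of tag] unfolding card_tag_Rlist .
qed

lemma inj_on_tag: "inj_on tag Rlist"
  by (rule eq_card_imp_inj_on[OF finite_Rlist]) (simp add: card_Rlist card_tag_Rlist)

lemma nstr_zclosure_R:
  assumes "R \<in> Rlist" "R \<in> zclosure (orbit (nstr \<tau> (unitv 0) \<epsilon> \<delta> p))"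
  shows "if \<tau> then R 0 1 1 = 1 else R 1 0 1 = 1" "R 0 2 2 = \<epsilon>" "R 2 0 2 = \<delta>"
proof -
  have "R 0 0 0 = 1"
    using assms(1) R_values unfolding Rlist_def by blast
  then show "if \<tau> then R 0 1 1 = 1 else R 1 0 1 = 1" "R 0 2 2 = \<epsilon>" "R 2 0 2 = \<delta>"
    using nstr_zclosureD[OF assms(2)] by (auto split: if_splits)
qed

lemma BAS21D:
  assumes "c \<in> BAS21"
  shows "i < 2 \<Longrightarrow> j < 2 \<Longrightarrow> n < 2 \<Longrightarrow> k < 2 \<Longrightarrow> (\<Sum>m<2. c i j m * c m n k) = (\<Sum>m<2. c j n m * c i m k)"
    "i < 2 \<Longrightarrow> j < 2 \<Longrightarrow> (\<Sum>m<2. c i j m * c m 2 2) = c i 2 2 * c j 2 2"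
    "i < 2 \<Longrightarrow> j < 2 \<Longrightarrow> (\<Sum>m<2. c i j m * c 2 m 2) = c 2 i 2 * c 2 j 2"
    "i < 2 \<Longrightarrow> k < 2 \<Longrightarrow> (\<Sum>m<2. c 2 2 m * c i m k) = c 2 i 2 * c 2 2 k"
    "i < 2 \<Longrightarrow> k < 2 \<Longrightarrow> (\<Sum>m<2. c 2 2 m * c m i k) = c i 2 2 * c 2 2 k"
proof -
  have "c \<in> ambient" using assms BAS21_subset_ambient by blast
  note * = iffD1[OF BAS21_iff[OF this] assms]
  show "i < 2 \<Longrightarrow> j < 2 \<Longrightarrow> n < 2 \<Longrightarrow> k < 2 \<Longrightarrow> (\<Sum>m<2. c i j m * c m n k) = (\<Sum>m<2. c j n m * c i m k)"
    by (rule *[THEN conjunct1, rule_format])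
  show "i < 2 \<Longrightarrow> j < 2 \<Longrightarrow> (\<Sum>m<2. c i j m * c m 2 2) = c i 2 2 * c j 2 2"
    by (rule *[THEN conjunct2, THEN conjunct1, rule_format])
  show "i < 2 \<Longrightarrow> j < 2 \<Longrightarrow> (\<Sum>m<2. c i j m * c 2 m 2) = c 2 i 2 * c 2 j 2"
    by (rule *[THEN conjunct2, THEN conjunct2, THEN conjunct1, rule_format])
  show "i < 2 \<Longrightarrow> k < 2 \<Longrightarrow> (\<Sum>m<2. c 2 2 m * c i m k) = c 2 i 2 * c 2 2 k"
    by (rule *[THEN conjunct2, THEN conjunct2, THEN conjunct2, THEN conjunct1, rule_format])
  show "i < 2 \<Longrightarrow> k < 2 \<Longrightarrow> (\<Sum>m<2. c 2 2 m * c m i k) = c i 2 2 * c 2 2 k"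
    by (rule *[THEN conjunct2, THEN conjunct2, THEN conjunct2, THEN conjunct2, rule_format])
qed

text \<open>The relation between \<open>y 0 1 1\<close> and \<open>y 1 0 1\<close> separates the
  five structures over C x C from the other eight; within each group the characters decide.\<close>

lemma zclosure_orbit_separated:
  assumes R: "R \<in> Rlist" and R': "R' \<in> Rlist" and mem: "R' \<in> zclosure (orbit R)"
  shows "R' = R"
proof -
  have two: "{R01, R03, R04, R05, R07} \<union> {R23, R25, R28, R30, R31, R32, R33, R36} = Rlist"
    unfolding Rlist_def by blast
  note vals = tag_R[unfolded tag_def, simplified]
  show ?thesis
  proof (cases "R \<in> {R01, R03, R04, R05, R07}")
    case True
    then have "R' 0 1 1 = R' 1 0 1"
      using mem by (auto simp: R_eq dest: ustr_zclosureD(1))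
    then have A: "R' \<in> {R01, R03, R04, R05, R07}"
      using R_values(2)[of R'] R' two by blast
    note v = R_values(1)[OF A]
    \<comment> \<open>In \<open>R'\<close> the element e1 + e2 acts as the identity on the even
      part, so the characteristic equation becomes (x - 1)^2 = 0 and excludes a zero
      character.\<close>
    have quad: "(R' 0 0 0 + R' 1 0 0) * (R' 0 1 1 + R' 1 1 1) - (R' 0 0 1 + R' 1 0 1) * (R' 0 1 0 + R' 1 1 0) = 1"
      "trd R' 0 = 1" "trd R' 1 = 1"
      using v by (simp_all add: trd_def sum_lessThan_2)
    note D = ustr_zclosureD[of R', unfolded add_diff_eq[symmetric] quad]
    from True consider "R = R01" | "R = R03" | "R = R04" | "R = R05" | "R = R07" by blast
    then show ?thesis
    proof cases
      case 1
      then have "R' 0 2 2 = 0" "R' 2 0 2 = 0"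
        using mem unfolding R_eq by (auto dest: D)
      then show ?thesis using A 1 by (auto simp: vals)
    next
      case 2
      then have "R' 0 2 2 = R' 2 0 2" "R' 1 2 2 = R' 2 1 2"
        "(R' 0 2 2 + R' 1 2 2)\<^sup>2 - 2 * (R' 0 2 2 + R' 1 2 2) + 1 = 0"
        using mem D(8) unfolding R_eq by (auto dest: D(5,6))
      then show ?thesis using A 2 v by (auto simp: vals)
    next
      case 3
      then have "R' 0 2 2 = 0" "R' 1 2 2 = 0" "(R' 2 0 2 + R' 2 1 2)\<^sup>2 - 2 * (R' 2 0 2 + R' 2 1 2) + 1 = 0"
        using mem D(9) unfolding R_eq by (auto dest: D(2,4))
      then show ?thesis using A 3 v by (auto simp: vals)
    next
      case 4
      then have "R' 2 0 2 = 0" "(R' 0 2 2 + R' 1 2 2)\<^sup>2 - 2 * (R' 0 2 2 + R' 1 2 2) + 1 = 0"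
        using mem D(8) unfolding R_eq by (auto dest: D(3))
      then show ?thesis using A 4 v by (auto simp: vals)
    next
      case 5
      then have "R' 1 2 2 + R' 2 1 2 = 1"
        using mem D(7) unfolding R_eq by auto
      then show ?thesis using A 5 v by (auto simp: vals)
    qed
  next
    case False
    then obtain \<tau> \<epsilon> \<delta> p where Rn: "R = nstr \<tau> (unitv 0) \<epsilon> \<delta> p"
      using R unfolding Rlist_def R_eq(6-13) by blast
    have same: "if \<tau> then x 0 1 1 = 1 else x 1 0 1 = 1" "x 0 2 2 = \<epsilon>" "x 2 0 2 = \<delta>" if "x \<in> {R, R'}" for x
    proof -
      have "x \<in> Rlist" "x \<in> zclosure (orbit (nstr \<tau> (unitv 0) \<epsilon> \<delta> p))"
        using that R R' mem Rn zclosure_superset orbit_self[OF Rlist_ambient[OF R]] by blast+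
      from nstr_zclosure_R[OF this]
      show "if \<tau> then x 0 1 1 = 1 else x 1 0 1 = 1" "x 0 2 2 = \<epsilon>" "x 2 0 2 = \<delta>" .
    qed
    have N: "x 0 1 1 + x 1 0 1 = 1" "x 1 2 2 = 0" if "x \<in> Rlist" "x 0 1 1 = 1 \<or> x 1 0 1 = 1" for x
      using that unfolding Rlist_def by (auto simp: vals)
    have "R 0 1 1 = 1 \<or> R 1 0 1 = 1" "R' 0 1 1 = 1 \<or> R' 1 0 1 = 1"
      using same(1) by (cases \<tau>; simp)+
    note N[OF R this(1)] N[OF R' this(2)]
    moreover have "R 0 1 1 = R' 0 1 1 \<or> R 1 0 1 = R' 1 0 1"
      using same(1)[of R] same(1)[of R'] by (cases \<tau>) simp_all
    ultimately have "R 0 1 1 = R' 0 1 1" "R 1 0 1 = R' 1 0 1" "R 1 2 2 = R' 1 2 2"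
      by (metis add_left_cancel add_right_cancel)+
    then have "tag R' = tag R"
      unfolding tag_def same(2,3)[of R, simplified] same(2,3)[of R', simplified] by simp
    then show ?thesis using inj_on_tag R R' unfolding inj_on_def by blast
  qed
qed

section \<open>Every superalgebra lies in the closure of one of the thirteen orbits\<close>

text \<open>The second conjunct is what makes orbits open: the part of a closure outside its orbit
  is caught by closed sets that miss the orbit. The collection \<open>\<E>\<close> is a parameter
  because the change of basis below needs sets that are stable under the group.\<close>

definition covered :: "sconst set set \<Rightarrow> sconst \<Rightarrow> bool" where
  "covered \<E> c \<longleftrightarrow> (\<exists>R\<in>Rlist. c \<in> zclosure (orbit R) \<and>
     (c \<in> orbit R \<or> (\<exists>E\<in>\<E>. c \<in> E \<and> E \<inter> orbit R = {})))"

definition Edisc :: "sconst set" where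
  "Edisc = {c \<in> ambient. disc c = 0}"

definition Eodd :: "sconst set" where
  "Eodd = {c \<in> ambient. c 2 2 0 = 0} \<inter> {c \<in> ambient. c 2 2 1 = 0}"

text \<open>On a member of \<open>nstr\<close> this says \<open>lam = 0\<close>. In general the
  condition depends on the basis.\<close>

definition Eidem :: "sconst set" where
  "Eidem = {c \<in> ambient. c 0 0 0 = 0} \<inter> {c \<in> ambient. c 1 1 1 = 0}"

lemma zclosed_E: "E \<in> {Edisc, Eodd, Eidem} \<Longrightarrow> zclosed E"
  unfolding Edisc_def Eodd_def Eidem_def disc_def trform_def trd_def
  by (elim insertE; clarify; (intro zclosed_Int)?; intro zclosed_zeros polyfun_intros)

lemma disjoint_E:
  "R \<in> {R01, R03, R04, R05, R07} \<Longrightarrow> Edisc \<inter> orbit R = {}"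
  "R \<in> {R03, R28, R30} \<Longrightarrow> Eodd \<inter> orbit R = {}"
  "R \<in> {R23, R25, R28, R30, R31, R32, R33, R36} \<Longrightarrow> Eidem \<inter> orbit R = {}"
proof -
  show "Edisc \<inter> orbit R = {}" if "R \<in> {R01, R03, R04, R05, R07}"
  proof -
    have "R \<in> Rlist" using that by (auto simp: Rlist_def)
    moreover have "disc R = 1"
      using R_values(1)[OF that] by (simp add: disc_def trform_def trd_def sum_lessThan_2)
    ultimately show ?thesis
      using disc_orbit[OF _ Rlist_ambient] unfolding Edisc_def by fastforce
  qed
  show "Eodd \<inter> orbit R = {}" if "R \<in> {R03, R28, R30}"
    using that unfolding R_eq Eodd_def
    by (auto dest!: ustr_orbitD(10) nstr_orbitD(5)) (simp_all add: unitv_def)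
  show "Eidem \<inter> orbit R = {}" if "R \<in> {R23, R25, R28, R30, R31, R32, R33, R36}"
    using that unfolding R_eq Eidem_def by (auto dest: nstr_orbitD(4))
qed

lemma coveredI1: "R \<in> Rlist \<Longrightarrow> c \<in> zclosure (orbit R) \<Longrightarrow> c \<in> orbit R \<Longrightarrow> covered \<E> c"
  unfolding covered_def by blast

lemma coveredI2: "R \<in> Rlist \<Longrightarrow> c \<in> zclosure (orbit R) \<Longrightarrow> E \<in> \<E> \<Longrightarrow> c \<in> E \<Longrightarrow> E \<inter> orbit R = {} \<Longrightarrow> covered \<E> c"
  unfolding covered_def by blast

lemma disc_mono_str: "disc (mono_str s t l r g) = (s * t * (s - t))\<^sup>2"
  by (simp add: disc_def trform_def trd_def sum_lessThan_2 mono_str_def power2_eq_square algebra_simps)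

lemma covered_mono_str:
  "covered {Edisc, Eodd} (mono_str s t 0 0 0)" "covered {Edisc, Eodd} (mono_str s t 0 s 0)"
  "covered {Edisc, Eodd} (mono_str s t s 0 0)" "covered {Edisc, Eodd} (mono_str s t t s 0)"
  "covered {Edisc, Eodd} (mono_str s t s s g)"
proof -
  have cov: "covered {Edisc, Eodd} (mono_str s t l r g)"
    if "R \<in> {R01, R03, R04, R05, R07}" "mono_str s t l r g \<in> zclosure (orbit R)"
      "s * t * (s - t) \<noteq> 0 \<Longrightarrow> mono_str s t l r g \<in> orbit R" for l r g R
  proof (cases "s * t * (s - t) = 0")
    case True
    then have "mono_str s t l r g \<in> Edisc"
      unfolding Edisc_def using str_ambient by (simp add: disc_mono_str)
    then show ?thesis
      using that(1,2) disjoint_E(1)[OF that(1)] by (intro coveredI2[of R]) (auto simp: Rlist_def)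
  next
    case False
    then show ?thesis
      using that by (intro coveredI1[of R]) (auto simp: Rlist_def)
  qed
  show "covered {Edisc, Eodd} (mono_str s t 0 0 0)"
    by (rule cov[of R01]) (auto intro: mono_str_zclosure mono_str_orbit)
  show "covered {Edisc, Eodd} (mono_str s t 0 s 0)"
    by (rule cov[of R04]) (auto intro: mono_str_zclosure mono_str_orbit)
  show "covered {Edisc, Eodd} (mono_str s t s 0 0)"
    by (rule cov[of R05]) (auto intro: mono_str_zclosure mono_str_orbit)
  show "covered {Edisc, Eodd} (mono_str s t t s 0)"
    by (rule cov[of R07]) (auto intro: mono_str_zclosure mono_str_orbit)
  show "covered {Edisc, Eodd} (mono_str s t s s g)"
  proof (cases "g = 0")
    case True
    then have "mono_str s t s s g \<in> Eodd"
      unfolding Eodd_def using str_ambient by (simp add: mono_str_def)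
    then show ?thesis
      using disjoint_E(2)[of R03] mono_str_zclosure(5) by (intro coveredI2[of R03]) (auto simp: Rlist_def)
  next
    case False
    then show ?thesis
      by (intro cov[of R03]) (auto intro: mono_str_zclosure mono_str_orbit)
  qed
qed

section \<open>Even parts generated by one element\<close>

lemma covered_generated:
  assumes c: "c \<in> BAS21" and gen: "c 0 0 0 = 0" "c 0 0 1 = 1"
  shows "covered {Edisc, Eodd} c"
proof -
  have amb: "c \<in> ambient" using c BAS21_subset_ambient by blast
  define \<alpha> \<beta> l r where "\<alpha> = c 0 1 0" and "\<beta> = c 0 1 1" and "l = c 0 2 2" and "r = c 2 0 2"
  \<comment> \<open>\<open>s\<close> and \<open>t\<close> are the roots of X^2 - \<beta> X -
    \<alpha>, so x^3 = \<alpha> x + \<beta> x^2 for x = e1 becomes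
    \<open>x (x - s) (x - t) = 0\<close>.\<close>
  define s where "s = (\<beta> + csqrt (\<beta>\<^sup>2 + 4 * \<alpha>)) / 2"
  define t where "t = \<beta> - s"
  have "(2 * s - \<beta>)\<^sup>2 = \<beta>\<^sup>2 + 4 * \<alpha>" unfolding s_def by (simp add: field_simps)
  then have "4 * (s * s - \<beta> * s - \<alpha>) = 0" by (simp add: power2_eq_square algebra_simps)
  then have "s * s - \<beta> * s - \<alpha> = 0" by (simp only: mult_eq_0_iff) simp
  then have \<alpha>: "\<alpha> = - s * t" and \<beta>: "\<beta> = s + t" unfolding t_def by (simp_all add: algebra_simps)
  have "c 1 0 k = c 0 1 k" "c 1 1 k = \<alpha> * c 0 0 k + \<beta> * c 0 1 k" if "k < 2" for k
    using BAS21D(1)[OF c, of 0 0 0 k] BAS21D(1)[OF c, of 0 0 1 k] that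
    by (simp_all add: sum_lessThan_2 gen[unfolded One_nat_def] \<alpha>_def \<beta>_def)
  from this[of 0] this[of 1]
  have ev: "c 1 0 0 = \<alpha>" "c 1 0 1 = \<beta>" "c 1 1 0 = \<alpha> * \<beta>" "c 1 1 1 = \<alpha> + \<beta>\<^sup>2"
    by (simp_all add: gen[unfolded One_nat_def] power2_eq_square mult.commute
        flip: \<alpha>_def[unfolded One_nat_def] \<beta>_def[unfolded One_nat_def])
  have l: "c 1 2 2 = l\<^sup>2" "\<alpha> * l + \<beta> * l\<^sup>2 = l ^ 3"
    using BAS21D(2)[OF c, of 0 0] BAS21D(2)[OF c, of 0 1] gen
    by (simp_all add: sum_lessThan_2 power2_eq_square power3_eq_cube \<alpha>_def \<beta>_def l_def)
  have r: "c 2 1 2 = r\<^sup>2" "\<alpha> * r + \<beta> * r\<^sup>2 = r ^ 3"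
    using BAS21D(3)[OF c, of 0 0] BAS21D(3)[OF c, of 0 1] gen
    by (simp_all add: sum_lessThan_2 power2_eq_square power3_eq_cube \<alpha>_def \<beta>_def r_def)
  have p: "c 2 2 1 * \<alpha> = r * c 2 2 0" "c 2 2 0 + c 2 2 1 * \<beta> = r * c 2 2 1"
    using BAS21D(4)[OF c, of 0 0] BAS21D(4)[OF c, of 0 1] gen
    by (simp_all add: sum_lessThan_2 \<alpha>_def \<beta>_def r_def)
  have p': "c 2 2 1 * \<alpha> = l * c 2 2 0" "c 2 2 0 + c 2 2 1 * \<beta> = l * c 2 2 1"
    using BAS21D(5)[OF c, of 0 0] BAS21D(5)[OF c, of 0 1] gen ev(1,2)
    by (simp_all add: sum_lessThan_2 l_def)
  define g where "g = c 2 2 1"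
  have root: "x = 0 \<or> x = s \<or> x = t" if "\<alpha> * x + \<beta> * x\<^sup>2 = x ^ 3" for x
  proof -
    have "x * (x - s) * (x - t) = x ^ 3 - (\<alpha> * x + \<beta> * x\<^sup>2)"
      unfolding \<alpha> \<beta> by (simp add: power2_eq_square power3_eq_cube algebra_simps)
    then show ?thesis using that by auto
  qed
  have p0: "c 2 2 0 = (r - \<beta>) * g" using p(2) unfolding g_def by (simp add: algebra_simps)
  have cv: "c 0 0 0 = 0" "c 0 0 1 = 1" "c 0 1 0 = - s * t" "c 0 1 1 = s + t" "c 1 0 0 = - s * t" "c 1 0 1 = s + t"
    "c 1 1 0 = - s * t * (s + t)" "c 1 1 1 = (s + t)\<^sup>2 - s * t"
    "c 0 2 2 = l" "c 1 2 2 = l\<^sup>2" "c 2 0 2 = r" "c 2 1 2 = r\<^sup>2" "c 2 2 0 = (r - \<beta>) * g" "c 2 2 1 = g"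
    using gen ev l(1) r(1) p0 unfolding \<alpha>_def[symmetric] \<beta>_def[symmetric] l_def[symmetric] r_def[symmetric] g_def[symmetric]
    by (simp_all add: \<alpha> \<beta>)
  \<comment> \<open>The roots may be taken in either order; the last condition fixes the order
    needed to write \<open>f f\<close> as \<open>g (x\<^sup>2 - t' x)\<close>.\<close>
  have eq: "c = mono_str s' t' l r g" if "s' + t' = s + t" "s' * t' = s * t" "(r - \<beta>) * g = - g * t'" for s' t'
    unfolding mono_str_def
    by (intro ambient_eq_st amb)
      (use that in \<open>auto simp: less_2_iff cv[unfolded One_nat_def] power2_eq_square algebra_simps\<close>)
  show ?thesis
  proof (cases "l = r")
    case True
    show ?thesis
    proof (cases "l = s \<or> l = t")
      case lst: True
      then show ?thesis
      proof
        assume "l = s"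
        then have "c = mono_str s t s s g"
          using eq[of s t] True by (simp add: \<beta>)
        then show ?thesis using covered_mono_str(5) by simp
      next
        assume "l = t"
        then have "c = mono_str t s t t g"
          using eq[of t s] True by (simp add: \<beta>)
        then show ?thesis using covered_mono_str(5) by simp
      qed
    next
      case False
      then have "l = 0" "s * t \<noteq> 0" using root[OF l(2)] by auto
      then have "g = 0" using p(1) True unfolding g_def \<alpha> by simp
      then have "c = mono_str s t 0 0 0"
        using eq[of s t] True \<open>l = 0\<close> by simp
      then show ?thesis using covered_mono_str(1) by simp
    qed
  next
    case False
    \<comment> \<open>Powers of x commute, so \<open>x p = r p\<close> and \<open>p x = l p\<close>
      coincide; with \<open>l \<noteq> r\<close> this leaves \<open>p = 0\<close>.\<close>
    then have "g = 0" using p(2) p'(2) unfolding g_def by simp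
    then have "c = mono_str s t l r 0" "c = mono_str t s l r 0"
      using eq[of s t] eq[of t s] by simp_all
    then show ?thesis
      using root[OF l(2)] root[OF r(2)] False covered_mono_str[of s t] covered_mono_str[of t s] by auto
  qed
qed

lemma covered_act:
  assumes GH: "(G, H) \<in> glpairs" and c: "c \<in> ambient" and cov: "covered {Edisc, Eodd} c"
  shows "covered {Edisc, Eodd} (act G H c)"
proof -
  from cov obtain R where R: "R \<in> Rlist" "c \<in> zclosure (orbit R)"
    and or: "c \<in> orbit R \<or> (\<exists>E\<in>{Edisc, Eodd}. c \<in> E \<and> E \<inter> orbit R = {})"
    unfolding covered_def by blast
  have orb: "act G H c \<in> orbit c" using GH unfolding orbit_def by blast
  have amb: "act G H c \<in> ambient" by (rule act_ambient[OF GH c])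
  have "act G H c \<in> orbit R" if "c \<in> orbit R"
    using orbit_eq[OF Rlist_ambient[OF R(1)] that] orb by simp
  moreover have "act G H c \<in> Edisc" if "c \<in> Edisc"
    using disc_orbit[OF orb c] that amb unfolding Edisc_def by auto
  moreover have "act G H c \<in> Eodd" if "c \<in> Eodd"
    using act_graded(4)[OF _ _ c, of G H] GH that amb
    unfolding Eodd_def glpairs_iff by (simp add: sum_lessThan_2)
  ultimately have "act G H c \<in> orbit R \<or> (\<exists>E\<in>{Edisc, Eodd}. act G H c \<in> E \<and> E \<inter> orbit R = {})"
    using or by auto
  then show ?thesis
    unfolding covered_def using R act_zclosure_orbit[OF GH Rlist_ambient[OF R(1)] R(2)] by blast
qed

text \<open>Coordinates of the square of \<open>u e\<^sub>1 + v e\<^sub>2\<close>.\<close>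

definition sq :: "sconst \<Rightarrow> complex \<Rightarrow> complex \<Rightarrow> nat \<Rightarrow> complex" where
  "sq c u v k = u * u * c 0 0 k + u * v * c 0 1 k + v * u * c 1 0 k + v * v * c 1 1 k"

lemma covered_square_independent:
  assumes c: "c \<in> BAS21" and ind: "u * sq c u v 1 - v * sq c u v 0 \<noteq> 0"
  shows "covered {Edisc, Eodd} c"
proof -
  have amb: "c \<in> ambient" using c BAS21_subset_ambient by blast
  let ?H = "blk u (sq c u v 0) v (sq c u v 1) 1"
  obtain G where GH: "(G, ?H) \<in> glpairs"
    using glpairs_blk[of u "sq c u v 1" "sq c u v 0" v 1] ind by (auto simp: mult.commute)
  then have gr: "graded G" "graded ?H" and GH1: "mm G ?H = idm"
    unfolding glpairs_iff by auto
  have "act G ?H c 0 0 k = (if k = 1 then 1 else 0)" if "k < 2" for k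
  proof -
    have "act G ?H c 0 0 k = mm G ?H k 1"
      unfolding act_graded(1)[OF gr amb zero_less_numeral zero_less_numeral that]
      by (simp add: mm_def sum_lessThan_2 sum_lessThan_3 blk_def sq_def algebra_simps)
    then show ?thesis using GH1 that by (simp add: idm_def)
  qed
  then have "covered {Edisc, Eodd} (act G ?H c)"
    by (intro covered_generated act_BAS21[OF GH c]) simp_all
  from covered_act[OF glpairs_swap[OF GH] act_ambient[OF GH amb] this]
  show ?thesis unfolding act_inverse[OF GH amb] .
qed

lemma covered_nstr:
  assumes "nstr \<tau> (unitv 0) \<epsilon> \<delta> (\<lambda>_. 0) \<in> {R23, R25, R31, R32, R33, R36}" (is "?R \<in> _")
  shows "covered {Eodd, Eidem} (nstr \<tau> lam \<epsilon> \<delta> (\<lambda>_. 0))"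
proof (cases "lam 0 = 0 \<and> lam 1 = 0")
  case True
  then have "nstr \<tau> lam \<epsilon> \<delta> (\<lambda>_. 0) \<in> Eidem"
    unfolding Eidem_def using str_ambient by (simp add: nstr_def)
  then show ?thesis
    using disjoint_E(3)[of ?R] assms nstr_zclosure by (intro coveredI2[of ?R]) (auto simp: Rlist_def)
next
  case False
  then show ?thesis
    using assms nstr_zclosure nstr_orbit by (intro coveredI1[of ?R]) (auto simp: Rlist_def)
qed

lemma covered_nstr_odd:
  assumes "nstr \<tau> (unitv 0) \<epsilon> \<delta> (unitv 1) \<in> {R28, R30}" (is "?R \<in> _") "lam 0 * p 0 + lam 1 * p 1 = 0"
  shows "covered {Eodd, Eidem} (nstr \<tau> lam \<epsilon> \<delta> p)"
proof -
  note cl = nstr_zclosure_odd[OF assms(2), of \<tau> \<epsilon> \<delta>]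
  consider "lam 0 = 0" "lam 1 = 0" | "p 0 = 0" "p 1 = 0" | "lam 0 \<noteq> 0 \<or> lam 1 \<noteq> 0" "p 0 \<noteq> 0 \<or> p 1 \<noteq> 0"
    by blast
  then show ?thesis
  proof cases
    case 1
    then have "nstr \<tau> lam \<epsilon> \<delta> p \<in> Eidem"
      unfolding Eidem_def using str_ambient by (simp add: nstr_def)
    then show ?thesis
      using disjoint_E(3)[of ?R] assms(1) cl by (intro coveredI2[of ?R]) (auto simp: Rlist_def)
  next
    case 2
    then have "nstr \<tau> lam \<epsilon> \<delta> p \<in> Eodd"
      unfolding Eodd_def using str_ambient by (simp add: nstr_def)
    then show ?thesis
      using disjoint_E(2)[of ?R] assms(1) cl by (intro coveredI2[of ?R]) (auto simp: Rlist_def)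
  next
    case 3
    then show ?thesis
      using assms cl nstr_orbit_odd by (intro coveredI1[of ?R]) (auto simp: Rlist_def)
  qed
qed

section \<open>Even parts in which every square is a multiple of its root\<close>

lemma covered_square_dependent:
  assumes c: "c \<in> BAS21" and dep: "\<And>u v. u * sq c u v 1 - v * sq c u v 0 = 0"
  shows "covered {Eodd, Eidem} c"
proof -
  have amb: "c \<in> ambient" using c BAS21_subset_ambient by blast
  define lam where "lam = (\<lambda>i. c i i i)"
  define l r p where "l = (\<lambda>i. c i 2 2)" and "r = (\<lambda>i. c 2 i 2)" and "p = (\<lambda>k. c 2 2 k)"
  \<comment> \<open>Polarization: the values at e1, e2 and e1 \<plusminus> e2 give
    \<open>x\<^sup>2 = lam(x) x\<close> with \<open>lam\<close> linear, so that only
    \<open>e\<^sub>1 e\<^sub>2\<close> remains to be found.\<close>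
  have d: "c 0 0 1 = 0" "c 1 1 0 = 0"
    using dep[of 1 0] dep[of 0 1] by (simp_all add: sq_def)
  have s1: "c 0 1 1 + c 1 0 1 + c 1 1 1 = c 0 0 0 + c 0 1 0 + c 1 0 0"
    using dep[of 1 1] d by (simp add: sq_def algebra_simps)
  have s2: "c 1 1 1 + c 0 0 0 = c 0 1 1 + c 1 0 1 + c 0 1 0 + c 1 0 0"
    using dep[of 1 "-1"] d by (simp add: sq_def algebra_simps)
  have "2 * c 1 1 1 = 2 * (c 0 1 0 + c 1 0 0)" using s1 s2 by algebra
  then have "c 1 1 1 = c 0 1 0 + c 1 0 0" by (simp only: mult_cancel_left) simp
  then have c100: "c 1 0 0 = lam 1 - c 0 1 0" unfolding lam_def by simp
  have "2 * c 0 0 0 = 2 * (c 0 1 1 + c 1 0 1)" using s1 s2 by algebra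
  then have "c 0 0 0 = c 0 1 1 + c 1 0 1" by (simp only: mult_cancel_left) simp
  then have c101: "c 1 0 1 = lam 0 - c 0 1 1" unfolding lam_def by simp
  \<comment> \<open>Associativity makes \<open>c 0 1 0\<close> equal to 0 or \<open>lam 1\<close>
    and \<open>c 0 1 1\<close> equal to 0 or \<open>lam 0\<close>, with product 0; if both are 0,
    then \<open>a3\<close> makes \<open>lam 0\<close> or \<open>lam 1\<close> vanish, so one of the
    two multiplication rules still holds.\<close>
  have a1: "(\<Sum>m<2. c 0 0 m * c m 1 k) = (\<Sum>m<2. c 0 1 m * c 0 m k)"
    and a2: "(\<Sum>m<2. c 0 1 m * c m 1 k) = (\<Sum>m<2. c 1 1 m * c 0 m k)"
    and a3: "(\<Sum>m<2. c 0 1 m * c m 0 k) = (\<Sum>m<2. c 1 0 m * c 0 m k)" if "k < 2" for k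
    using BAS21D(1)[OF c] that by auto
  have "c 0 1 1 * c 0 1 0 = 0" "c 0 1 1 * (c 0 1 1 - lam 0) = 0" "c 0 1 0 * (c 0 1 0 - lam 1) = 0"
    using a1[of 0] a1[of 1] a2[of 0] d unfolding lam_def by (auto simp: sum_lessThan_2 algebra_simps)
  moreover have "lam 0 * lam 1 = 0" if "c 0 1 0 = 0" "c 0 1 1 = 0"
    using a3[of 0] c100 c101 d that unfolding lam_def by (auto simp: sum_lessThan_2)
  ultimately have "c 0 1 0 = 0 \<and> c 0 1 1 = lam 0 \<or> c 0 1 0 = lam 1 \<and> c 0 1 1 = 0"
    by auto
  then consider "c 0 1 0 = 0" "c 0 1 1 = lam 0" | "c 0 1 0 = lam 1" "c 0 1 1 = 0" by auto
  then obtain \<tau> where \<tau>: "c 0 1 0 = (if \<tau> then 0 else lam 1)" "c 0 1 1 = (if \<tau> then lam 0 else 0)"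
  proof cases
    case 1
    then show thesis using that[of True] by simp
  next
    case 2
    then show thesis using that[of False] by simp
  qed
  have c_eq: "c = nstr \<tau> lam \<epsilon> \<delta> p" if "l 0 = \<epsilon> * lam 0" "l 1 = \<epsilon> * lam 1" "r 0 = \<delta> * lam 0" "r 1 = \<delta> * lam 1" for \<epsilon> \<delta>
    unfolding nstr_def
    by (intro ambient_eq_st amb)
      (use that d c100 c101 \<tau> in \<open>auto simp: less_2_iff l_def r_def p_def lam_def\<close>)
  have ev: "c i j k = (if \<tau> then (if j = k then lam i else 0) else (if i = k then lam j else 0))"
    if "i < 2" "j < 2" "k < 2" for i j k
    using that d c100 c101 \<tau> by (auto simp: less_2_iff lam_def)
  have S: "(\<Sum>m<2. c i j m * x m) = (if \<tau> then lam i * x j else lam j * x i)" if "i < 2" "j < 2" for i j x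
    using that by (auto simp: ev sum_lessThan_2 less_2_iff)
  have L: "lam i * l j = l i * l j" "lam i * r j = r i * r j" if "i < 2" "j < 2" for i j
    using BAS21D(2,3)[OF c that] BAS21D(2,3)[OF c that(2,1)] unfolding S[OF that] S[OF that(2,1)] l_def r_def
    by (cases \<tau>; simp add: mult.commute)+
  have P: "lam i * p k = (if \<tau> then r i else l i) * p k"
    "(if i = k then lam 0 * p 0 + lam 1 * p 1 else 0) = (if \<tau> then l i else r i) * p k" if "i < 2" "k < 2" for i k
    using BAS21D(4,5)[OF c that] that unfolding sum_lessThan_2
    by (cases \<tau>; auto simp: ev less_2_iff p_def l_def r_def algebra_simps)+
  have char: "(\<forall>i<2. x i = 0) \<or> (\<forall>i<2. x i = lam i)" if "\<And>i j. i < 2 \<Longrightarrow> j < 2 \<Longrightarrow> lam i * x j = x i * x j" for x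
    using that by (metis mult_cancel_right)
  show ?thesis
  proof (cases "p 0 = 0 \<and> p 1 = 0")
    case True
    obtain \<epsilon> where \<epsilon>: "\<epsilon> = 0 \<or> \<epsilon> = 1" "l 0 = \<epsilon> * lam 0" "l 1 = \<epsilon> * lam 1"
      using char[of l] L(1) by (metis mult_zero_left mult_1 one_less_numeral_iff semiring_norm(76) zero_less_numeral)
    obtain \<delta> where \<delta>: "\<delta> = 0 \<or> \<delta> = 1" "r 0 = \<delta> * lam 0" "r 1 = \<delta> * lam 1"
      using char[of r] L(2) by (metis mult_zero_left mult_1 one_less_numeral_iff semiring_norm(76) zero_less_numeral)
    show ?thesis
    \<comment> \<open>For these \<epsilon>, \<delta> a nonzero \<open>p\<close> is possible; with
      \<open>p = 0\<close> the structure is a degenerate member of the family of \<open>R28\<close>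
      or \<open>R30\<close>. The other six choices are families of their own.\<close>
    proof (cases "\<delta> = (if \<tau> then 1 else 0) \<and> \<epsilon> = (if \<tau> then 0 else 1)")
      case odd: True
      then have "nstr \<tau> (unitv 0) \<epsilon> \<delta> (unitv 1) \<in> {R28, R30}"
        unfolding R_eq by (cases \<tau>) auto
      then show ?thesis
        using covered_nstr_odd[of \<tau> \<epsilon> \<delta> lam p] c_eq[of \<epsilon> \<delta>] \<epsilon> \<delta> True by simp
    next
      case False
      have "nstr \<tau> lam \<epsilon> \<delta> p = nstr \<tau> lam \<epsilon> \<delta> (\<lambda>_. 0)"
        using True by (intro ambient_eqI str_ambient) (auto simp: nstr_def less_2_iff)
      moreover have "nstr \<tau> (unitv 0) \<epsilon> \<delta> (\<lambda>_. 0) \<in> {R23, R25, R31, R32, R33, R36}"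
        using False \<epsilon>(1) \<delta>(1) unfolding R_eq by (cases \<tau>) auto
      ultimately show ?thesis
        using covered_nstr[of \<tau> \<epsilon> \<delta> lam] c_eq[of \<epsilon> \<delta>] \<epsilon> \<delta> by simp
    qed
  next
    case False
    \<comment> \<open>Both basis vectors multiplied by \<open>lam(p)\<close> are multiples of the
      same vector \<open>p\<close>, which forces \<open>lam(p) = 0\<close>.\<close>
    have ker: "lam 0 * p 0 + lam 1 * p 1 = 0"
      using False P(2)[of 0 0] P(2)[of 0 1] P(2)[of 1 0] P(2)[of 1 1] by (auto split: if_splits)
    have "(if \<tau> then l i else r i) = 0" "(if \<tau> then r i else l i) = lam i" if "i < 2" for i
      using False P(1)[of i 0] P(1)[of i 1] P(2)[of i 0] P(2)[of i 1] ker that by (auto split: if_splits)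
    from this[of 0] this[of 1]
    have "c = nstr \<tau> lam (if \<tau> then 0 else 1) (if \<tau> then 1 else 0) p"
      by (intro c_eq) (auto split: if_splits)
    moreover have "nstr \<tau> (unitv 0) (if \<tau> then 0 else 1) (if \<tau> then 1 else 0) (unitv 1) \<in> {R28, R30}"
      unfolding R_eq by (cases \<tau>) auto
    ultimately show ?thesis using covered_nstr_odd ker by metis
  qed
qed

lemma covered_BAS21:
  assumes "c \<in> BAS21"
  shows "covered {Edisc, Eodd, Eidem} c"
proof -
  have mono: "covered \<E>' c" if "covered \<E> c" "\<E> \<subseteq> \<E>'" for \<E> \<E>'
    using that unfolding covered_def by blast
  show ?thesis
    using covered_square_independent[OF assms] covered_square_dependent[OF assms] mono
    by (metis insert_subset subset_insertI insertI1 insertI2 empty_subsetI)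
qed

section \<open>Irreducible components and rigid superalgebras\<close>

lemma BAS21_eq_Union: "BAS21 = (\<Union>R\<in>Rlist. zclosure (orbit R))"
proof (intro equalityI subsetI)
  fix c assume "c \<in> BAS21"
  then show "c \<in> (\<Union>R\<in>Rlist. zclosure (orbit R))"
    using covered_BAS21 unfolding covered_def by blast
next
  fix c assume "c \<in> (\<Union>R\<in>Rlist. zclosure (orbit R))"
  then show "c \<in> BAS21"
    using zclosure_minimal[OF zclosed_BAS21 orbit_subset_BAS21[OF R_BAS21]] by blast
qed

lemma zclosed_zclosure_orbit: "R \<in> Rlist \<Longrightarrow> zclosed (zclosure (orbit R))"
  using zclosed_zclosure orbit_subset_ambient Rlist_ambient by blast

lemma zirreducible_zclosure_orbit: "R \<in> Rlist \<Longrightarrow> zirreducible (zclosure (orbit R))"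
  using zirreducible_zclosure zirreducible_orbit Rlist_ambient by blast

lemma zirreducible_BAS21_subset:
  assumes "zirreducible Z" "Z \<subseteq> BAS21"
  obtains R where "R \<in> Rlist" "Z \<subseteq> zclosure (orbit R)"
proof -
  have "\<exists>C\<in>(\<lambda>R. zclosure (orbit R)) ` Rlist. Z \<subseteq> C"
    using assms zclosed_zclosure_orbit finite_Rlist unfolding BAS21_eq_Union
    by (intro zirreducible_Union) auto
  then show thesis using that by blast
qed

lemma zclosure_orbit_subset:
  assumes "R \<in> Rlist" "R' \<in> Rlist" "zclosure (orbit R) \<subseteq> zclosure (orbit R')"
  shows "R = R'"
  using zclosure_orbit_separated[OF assms(2,1)] assms zclosure_superset orbit_self[OF Rlist_ambient] by blast

lemma irr_components_BAS21: "irr_components BAS21 = zclosure ` orbit ` Rlist"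
proof (intro equalityI subsetI)
  fix Z assume Z: "Z \<in> irr_components BAS21"
  then have "zirreducible Z" "Z \<subseteq> BAS21" unfolding irr_components_def by auto
  then obtain R where R: "R \<in> Rlist" "Z \<subseteq> zclosure (orbit R)"
    by (rule zirreducible_BAS21_subset)
  then have "zclosure (orbit R) = Z"
    using Z zirreducible_zclosure_orbit unfolding irr_components_def BAS21_eq_Union by blast
  then show "Z \<in> zclosure ` orbit ` Rlist" using R(1) by blast
next
  fix Z assume "Z \<in> zclosure ` orbit ` Rlist"
  then obtain R where R: "R \<in> Rlist" and Z: "Z = zclosure (orbit R)" by blast
  have "W = Z" if W: "zirreducible W" "Z \<subseteq> W" "W \<subseteq> BAS21" for W
  proof -
    obtain R' where R': "R' \<in> Rlist" "W \<subseteq> zclosure (orbit R')"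
      using zirreducible_BAS21_subset[OF W(1,3)] .
    then have "R = R'" using zclosure_orbit_subset[OF R] W(2) Z by blast
    then show ?thesis using R'(2) W(2) Z by blast
  qed
  then show "Z \<in> irr_components BAS21"
    using R Z zirreducible_zclosure_orbit unfolding irr_components_def BAS21_eq_Union by blast
qed

lemma inj_on_zclosure_orbit: "inj_on (\<lambda>R. zclosure (orbit R)) Rlist"
  by (rule inj_onI) (simp add: zclosure_orbit_subset)

lemma card_orbits: "card (zclosure ` orbit ` Rlist) = 13" "card (orbit ` Rlist) = 13"
proof -
  show "card (zclosure ` orbit ` Rlist) = 13"
    using card_image[OF inj_on_zclosure_orbit] by (simp add: image_image card_Rlist)
  have "inj_on orbit Rlist"
    using inj_on_zclosure_orbit unfolding inj_on_def by metis
  then show "card (orbit ` Rlist) = 13"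
    using card_image card_Rlist by metis
qed

text \<open>The complement of the orbit is cut out by the other twelve closures and by those
  exceptional sets that miss the orbit. A structure outside all of them can only be covered by
  \<open>R\<close> itself, and only through the first alternative.\<close>

lemma rigid_Rlist:
  assumes R: "R \<in> Rlist"
  shows "rigid_in BAS21 R"
proof -
  define Es where "Es = {E \<in> {Edisc, Eodd, Eidem}. E \<inter> orbit R = {}}"
  define C where "C = (\<Union>R'\<in>Rlist - {R}. zclosure (orbit R')) \<union> (\<Union>E\<in>Es. E)"
  have "zclosed C"
    unfolding C_def
  proof (intro zclosed_Un zclosed_UN)
    show "zclosed E" if "E \<in> Es" for E using that zclosed_E unfolding Es_def by blast
  qed (auto simp: Es_def finite_Rlist zclosed_zclosure_orbit)
  moreover have "orbit R = BAS21 - C"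
  proof (intro equalityI subsetI)
    fix c assume c: "c \<in> orbit R"
    have "c \<notin> zclosure (orbit R')" if R': "R' \<in> Rlist" "R' \<noteq> R" for R'
    proof
      assume cl: "c \<in> zclosure (orbit R')"
      obtain G H where GH: "(G, H) \<in> glpairs" "c = act G H R"
        using c unfolding orbit_def by blast
      have "R = act H G c"
        using act_inverse[OF GH(1) Rlist_ambient[OF R]] GH(2) by simp
      then have "R \<in> zclosure (orbit R')"
        using act_zclosure_orbit[OF glpairs_swap[OF GH(1)] Rlist_ambient[OF R'(1)] cl] by simp
      then show False using zclosure_orbit_separated[OF R'(1) R] R'(2) by simp
    qed
    moreover have "c \<notin> E" if "E \<in> Es" for E using that c unfolding Es_def by blast
    ultimately show "c \<in> BAS21 - C"
      using c orbit_subset_BAS21[OF R_BAS21[OF R]] unfolding C_def by blast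
  next
    fix c assume c: "c \<in> BAS21 - C"
    then have "covered {Edisc, Eodd, Eidem} c" using covered_BAS21 by blast
    then obtain R' where R': "R' \<in> Rlist" "c \<in> zclosure (orbit R')"
      "c \<in> orbit R' \<or> (\<exists>E\<in>{Edisc, Eodd, Eidem}. c \<in> E \<and> E \<inter> orbit R' = {})"
      unfolding covered_def by (elim bexE conjE)
    then have eq: "R' = R" using c unfolding C_def by blast
    have "E \<notin> Es" if "c \<in> E" for E
      using c that unfolding C_def by blast
    then show "c \<in> orbit R" using R'(3) unfolding eq Es_def by auto
  qed
  ultimately show ?thesis
    using R_BAS21[OF R] unfolding rigid_in_def by blast
qed

lemma rigid_orbits: "{orbit c | c. rigid_in BAS21 c} = orbit ` Rlist"
proof (intro equalityI subsetI)
  fix O' assume "O' \<in> {orbit c | c. rigid_in BAS21 c}"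
  then obtain c C where O': "O' = orbit c" and c: "c \<in> BAS21" and C: "zclosed C" "orbit c = BAS21 - C"
    unfolding rigid_in_def by blast
  have amb: "c \<in> ambient" using c BAS21_subset_ambient by blast
  obtain R where R: "R \<in> Rlist" "c \<in> zclosure (orbit R)"
    using c unfolding BAS21_eq_Union by blast
  \<comment> \<open>The open orbit of \<open>c\<close> meets the closure of \<open>orbit R\<close>
    in \<open>c\<close>, hence meets \<open>orbit R\<close> itself, which is dense there.\<close>
  have "\<not> orbit R \<subseteq> C"
    using zclosure_minimal[OF C(1)] R(2) orbit_self[OF amb] C(2) by blast
  then obtain x where "x \<in> orbit R" "x \<in> orbit c"
    using orbit_subset_BAS21[OF R_BAS21[OF R(1)]] C(2) by blast
  then have "orbit c = orbit R"
    using orbit_eq amb Rlist_ambient[OF R(1)] by metis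
  then show "O' \<in> orbit ` Rlist" using R(1) O' by blast
next
  fix O' assume "O' \<in> orbit ` Rlist"
  then show "O' \<in> {orbit c | c. rigid_in BAS21 c}" using rigid_Rlist by blast
qed

section \<open>A chain of irreducible closed subsets\<close>

text \<open>With \<open>w = (m\<^sub>1, - m\<^sub>0)\<close> and \<open>v = (- a\<^sub>1, a\<^sub>0)\<close>, so that \<open>m w = a v = 0\<close>:
  \<open>x y = s a(x) a(y) w + t m(x) m(y) v\<close>, \<open>x f = f x = s a(w) a(x) f\<close> and \<open>f f = b w\<close>. Generically this is
  isomorphic to \<open>R03\<close>.\<close>

definition chain_str :: "complex \<Rightarrow> complex \<Rightarrow> complex \<Rightarrow> complex \<Rightarrow> complex \<Rightarrow> complex \<Rightarrow> complex \<Rightarrow> sconst" where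
  "chain_str a0 a1 m0 m1 s t b = st
     (\<lambda>i j k. s * (if i = 0 then a0 else a1) * (if j = 0 then a0 else a1) * (if k = 0 then m1 else - m0)
        + t * (if i = 0 then m0 else m1) * (if j = 0 then m0 else m1) * (if k = 0 then - a1 else a0))
     (\<lambda>i. s * (a0 * m1 - a1 * m0) * (if i = 0 then a0 else a1))
     (\<lambda>i. s * (a0 * m1 - a1 * m0) * (if i = 0 then a0 else a1))
     (\<lambda>k. b * (if k = 0 then m1 else - m0))"

lemma chain_str_ambient: "chain_str a0 a1 m0 m1 s t b \<in> ambient"
  unfolding chain_str_def by (rule st_ambient)

lemma chain_str_BAS21: "chain_str a0 a1 m0 m1 s t b \<in> BAS21"
  unfolding BAS21_iff[OF chain_str_ambient] all_less_2 sum_lessThan_2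
  by (simp add: chain_str_def algebra_simps)

text \<open>Level 0 is the zero structure, and every further level frees one more part of the data.
  There are more parameters than dimensions: scaling \<open>a\<close> by k and \<open>m\<close> by
  \<open>k\<^sup>-\<^sup>2\<close> does not change level 3.\<close>

definition chain_map :: "nat \<Rightarrow> (nat \<Rightarrow> complex) \<Rightarrow> sconst" where
  "chain_map n h =
    (if n = 0 then chain_str 1 0 0 0 1 0 0
     else if n = 1 then chain_str 1 0 (h 2) 0 1 0 0
     else if n = 2 then chain_str 1 0 (h 2) (h 3) 1 0 0
     else if n = 3 then chain_str (h 0) (h 1) (h 2) (h 3) 1 0 0
     else if n = 4 then chain_str (h 0) (h 1) (h 2) (h 3) 1 0 (h 4)
     else chain_str (h 0) (h 1) (h 2) (h 3) (h 5) (h 6) (h 4))"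

lemma ppoly_chain_str:
  assumes "a0 \<in> ppoly n" "a1 \<in> ppoly n" "m0 \<in> ppoly n" "m1 \<in> ppoly n" "s \<in> ppoly n" "t \<in> ppoly n" "b \<in> ppoly n"
  shows "(\<lambda>h. chain_str (a0 h) (a1 h) (m0 h) (m1 h) (s h) (t h) (b h) i j k) \<in> ppoly n"
  unfolding chain_str_def by (intro ppoly_st ppoly_intros assms)

lemma zirreducible_chain: "zirreducible (range (chain_map n))"
proof (rule zirreducible_range)
  show "(\<lambda>h. chain_map n h i j k) \<in> ppoly 7" for i j k
    unfolding chain_map_def if_distrib[of "\<lambda>x. x i j k"]
    by (intro ppoly_if ppoly_chain_str ppoly_intros) auto
  show "chain_map n h \<in> ambient" for h
    unfolding chain_map_def by (auto intro: chain_str_ambient)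
qed

lemma chain_BAS21: "range (chain_map n) \<subseteq> BAS21"
  unfolding chain_map_def by (auto intro: chain_str_BAS21)

lemma chain_map_subset:
  assumes "n < 5"
  shows "range (chain_map n) \<subseteq> range (chain_map (Suc n))"
proof
  fix x assume "x \<in> range (chain_map n)"
  then obtain h where x: "x = chain_map n h" by blast
  consider "n = 0" | "n = 1" | "n = 2" | "n = 3" | "n = 4" using assms by linarith
  then show "x \<in> range (chain_map (Suc n))"
  proof cases
    case 1
    then show ?thesis unfolding x by (intro image_eqI[of _ _ "\<lambda>_. 0"]) (auto simp: chain_map_def)
  next
    case 2
    then show ?thesis unfolding x by (intro image_eqI[of _ _ "h(3 := 0)"]) (auto simp: chain_map_def)
  next
    case 3
    then show ?thesis unfolding x by (intro image_eqI[of _ _ "h(0 := 1, 1 := 0)"]) (auto simp: chain_map_def)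
  next
    case 4
    then show ?thesis unfolding x by (intro image_eqI[of _ _ "h(4 := 0)"]) (auto simp: chain_map_def)
  next
    case 5
    then show ?thesis unfolding x by (intro image_eqI[of _ _ "h(5 := 1, 6 := 0)"]) (auto simp: chain_map_def)
  qed
qed

lemma zclosure_strict:
  assumes "f \<in> polyfun" "S \<subseteq> ambient" "\<And>c. c \<in> S \<Longrightarrow> f c = 0" "x \<in> T" "f x \<noteq> 0" "S \<subseteq> T"
  shows "zclosure S \<subset> zclosure T"
  using polyfun_zero_zclosure[OF assms(1-3)] zclosure_mono[OF assms(6)] zclosure_superset[of T] assms(4,5) by blast

lemma chain_strict:
  assumes "n < 5"
  shows "zclosure (range (chain_map n)) \<subset> zclosure (range (chain_map (Suc n)))"
proof -
  have amb: "range (chain_map n) \<subseteq> ambient" using chain_BAS21 BAS21_subset_ambient by blast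
  note strict = zclosure_strict[OF _ amb _ rangeI[of "chain_map (Suc n)" "\<lambda>_. 1"] _ chain_map_subset[OF assms]]
  \<comment> \<open>At the constant point 1 one has \<open>a = m\<close>, so \<open>v = - w\<close>
    and the two terms of the even product cancel. The last inclusion therefore needs another point;
    its equation says that \<open>e\<^sub>1\<^sup>2\<close> and \<open>e\<^sub>2\<^sup>2\<close> are
    dependent, as they are for \<open>t = 0\<close>.\<close>
  note strict' = zclosure_strict[OF _ amb _ rangeI[of "chain_map (Suc n)" "\<lambda>i. if i = 1 then 0 else 1"] _ chain_map_subset[OF assms]]
  consider "n = 0" | "n = 1" | "n = 2" | "n = 3" | "n = 4" using assms by linarith
  then show ?thesis
  proof cases
    case 1
    then show ?thesis
      by (intro strict[of "\<lambda>c. c 0 0 1"] polyfun_intros) (auto simp: chain_map_def chain_str_def)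
  next
    case 2
    then show ?thesis
      by (intro strict[of "\<lambda>c. c 0 0 0"] polyfun_intros) (auto simp: chain_map_def chain_str_def)
  next
    case 3
    then show ?thesis
      by (intro strict[of "\<lambda>c. c 1 1 1"] polyfun_intros) (auto simp: chain_map_def chain_str_def)
  next
    case 4
    then show ?thesis
      by (intro strict[of "\<lambda>c. c 2 2 0"] polyfun_intros) (auto simp: chain_map_def chain_str_def)
  next
    case 5
    then show ?thesis
      by (intro strict'[of "\<lambda>c. c 0 0 0 * c 1 1 1 - c 0 0 1 * c 1 1 0"] polyfun_intros)
        (auto simp: chain_map_def chain_str_def)
  qed
qed

lemma zdim_BAS21: "zdim BAS21 = 5"
proof (rule antisym)
  show "zdim BAS21 \<le> 5"
    unfolding zdim_def
  proof (rule Sup_least)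
    fix d assume "d \<in> {enat n | n. \<exists>Z. (\<forall>i\<le>n. zclosed (Z i) \<and> zirreducible (Z i) \<and> Z i \<subseteq> BAS21) \<and>
      (\<forall>i<n. Z i \<subset> Z (Suc i))}"
    then obtain n Z where d: "d = enat n"
      and Z: "\<And>i. i \<le> n \<Longrightarrow> zclosed (Z i) \<and> zirreducible (Z i) \<and> Z i \<subseteq> BAS21" "\<And>i. i < n \<Longrightarrow> Z i \<subset> Z (Suc i)"
      by auto
    obtain R where R: "R \<in> Rlist" "Z n \<subseteq> zclosure (orbit R)"
      using zirreducible_BAS21_subset[of "Z n"] Z(1)[of n] by auto
    have "trdeg_less (Z n) (Suc 5)"
      using trdeg_less_mono[OF trdeg_less_zclosure_orbit[OF Rlist_ambient[OF R(1)]] R(2)] by simp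
    then have "n \<le> 5"
      using Z by (intro chain_length_le[of n Z 5]) auto
    then show "d \<le> 5" unfolding d by (simp add: numeral_eq_enat)
  qed
  have "zclosed (zclosure (range (chain_map i)))" for i
    using chain_BAS21 BAS21_subset_ambient by (intro zclosed_zclosure) blast
  then have "enat 5 \<in> {enat n | n. \<exists>Z. (\<forall>i\<le>n. zclosed (Z i) \<and> zirreducible (Z i) \<and> Z i \<subseteq> BAS21) \<and>
      (\<forall>i<n. Z i \<subset> Z (Suc i))}"
    using zirreducible_zclosure[OF zirreducible_chain] chain_strict
      zclosure_minimal[OF zclosed_BAS21 chain_BAS21]
    by (intro CollectI exI[of _ 5] exI[of _ "\<lambda>i. zclosure (range (chain_map i))"] conjI) auto
  then show "5 \<le> zdim BAS21"
    unfolding zdim_def by (simp add: Sup_upper numeral_eq_enat)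
qed

theorem mainTheorem12:
  shows "zdim BAS21 = 5 \<and>
         irr_components BAS21 = zclosure ` orbit ` Rlist \<and>
         card (irr_components BAS21) = 13 \<and>
         {orbit c | c. rigid_in BAS21 c} = orbit ` Rlist \<and>
         card {orbit c | c. rigid_in BAS21 c} = 13"
  unfolding irr_components_BAS21 rigid_orbits card_orbits zdim_BAS21 by simp

end
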